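(* The restricted optimization value $\mathcal K_*$ satisfies \[ 1.35584631827168<\mathcal K_*<1.35584697425050 . \]
   Context: Definition of $\mathcal K_*$: it is the supremum of $(1-\rho)/(\rho+\mu_W)$ over every finite set $\Lambda\subset\mathbb N_{\ge1}$ (including the empty set), every $0<\rho<1$, every family $(\beta_\ell)_{\ell\in\Lambda}$ of positive reals, and every measurable $W:[0,\infty)\to(0,\infty)$ with $\mu_W<\infty$ and finite entries in the matrices $\mathcal M^{p,q}(W)$ below, such that $\mathcal M^{p,q}(W)\preceq I$ for every $p,q\in\mathbb N_0$ with $\mathcal I_{p,q}^\Lambda\ne\varnothing$, and $S\le1$. ($A\preceq B$ means $B-A$ is positive semidefinite.) The notation is as follows. $\mathrm d\nu(r)=2re^{-r^2}\,\mathrm dr$ on $[0,\infty)$ and $\mu_W=\int_0^\infty W(r^2)\,\mathrm d\nu(r)$. For $a,b\in\mathbb N_0$, $e_{a,b}(r)=\frac1{\sqrt{a!b!}}\sum_{j=0}^{\min(a,b)}(-1)^jj!\binom aj\binom bj r^{a+b-2j}$, and $\phi_\ell=e_{\ell+1,\ell}$. $\mathcal I_{p,q}^\Lambda=\{\ell\in\Lambda:p\le\ell+1,\ q\le\ell\}$ and, for $\ell,m\in\mathcal I_{p,q}^\Lambda$, \[ \mathcal M^{p,q}_{\ell m}(W)=\sqrt{\beta_\ell\beta_m}\int_0^\infty\frac{e_{\ell+1-p,\ell-q}(r)\,e_{m+1-p,m-q}(r)}{W(r^2)}\,\mathrm d\nu(r). \] With $D(r)=2\rho+W(r^2)$ and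 $B=\operatorname{diag}(\beta_\ell)_{\ell\in\Lambda}$: $R=\int_0^\infty\frac{r^2}{D}\,\mathrm d\nu$, $b_\ell=\int_0^\infty\frac{r\phi_\ell}{D}\,\mathrm d\nu$, $G_{\ell m}=\int_0^\infty\frac{\phi_\ell\phi_m}{D}\,\mathrm d\nu$ for $\ell,m\in\Lambda$, $\boldsymbol b=(b_\ell)_{\ell\in\Lambda}$, $G=(G_{\ell m})_{\ell,m\in\Lambda}$, and $S=R-\boldsymbol b^T(B^{-1}+G)^{-1}\boldsymbol b$ (with $S=R$ if $\Lambda=\varnothing$). Decimals denote exact rational numbers. *)

theory Defs
  imports "HOL-Analysis.Analysis"
begin

text \<open>Matrices are real-valued functions on pairs of indices, with rows and columns ranging
  over an arbitrary finite set of naturals; only the entries in that set matter.\<close>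

definition psd_on :: "nat set \<Rightarrow> (nat \<Rightarrow> nat \<Rightarrow> real) \<Rightarrow> bool" where
  "psd_on I A \<longleftrightarrow>
     (\<forall>i\<in>I. \<forall>j\<in>I. A i j = A j i) \<and>
     (\<forall>x :: nat \<Rightarrow> real. 0 \<le> (\<Sum>i\<in>I. \<Sum>j\<in>I. x i * A i j * x j))"

definition loewner_le_on ::
    "nat set \<Rightarrow> (nat \<Rightarrow> nat \<Rightarrow> real) \<Rightarrow> (nat \<Rightarrow> nat \<Rightarrow> real) \<Rightarrow> bool" where
  "loewner_le_on I A B \<longleftrightarrow> psd_on I (\<lambda>i j. B i j - A i j)"

definition diag_mat :: "(nat \<Rightarrow> real) \<Rightarrow> nat \<Rightarrow> nat \<Rightarrow> real" where
  "diag_mat d = (\<lambda>i j. if i = j then d i else 0)"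

definition id_mat :: "nat \<Rightarrow> nat \<Rightarrow> real" where
  "id_mat = diag_mat (\<lambda>_. 1)"

text \<open>Entries outside the index set are normalised to 0, which makes the inverse unique as a
  function on all pairs of indices.\<close>

definition is_inverse_on ::
    "nat set \<Rightarrow> (nat \<Rightarrow> nat \<Rightarrow> real) \<Rightarrow> (nat \<Rightarrow> nat \<Rightarrow> real) \<Rightarrow> bool" where
  "is_inverse_on I A N \<longleftrightarrow>
     (\<forall>i j. i \<notin> I \<or> j \<notin> I \<longrightarrow> N i j = 0) \<and>
     (\<forall>i\<in>I. \<forall>j\<in>I. (\<Sum>k\<in>I. A i k * N k j) = id_mat i j) \<and>
     (\<forall>i\<in>I. \<forall>j\<in>I. (\<Sum>k\<in>I. N i k * A k j) = id_mat i j)"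

definition inverse_on :: "nat set \<Rightarrow> (nat \<Rightarrow> nat \<Rightarrow> real) \<Rightarrow> nat \<Rightarrow> nat \<Rightarrow> real" where
  "inverse_on I A = (THE N. is_inverse_on I A N)"

lemma inverse_on_eqI:
  assumes fin: "finite I" and N: "is_inverse_on I A N"
  shows "inverse_on I A = N"
  unfolding inverse_on_def
proof (rule the_equality, rule N)
  fix N' assume N': "is_inverse_on I A N'"
  show "N' = N"
  proof (intro ext)
    fix i j
    show "N' i j = N i j"
    proof (cases "i \<in> I \<and> j \<in> I")
      case False
      then show ?thesis using N N' by (auto simp: is_inverse_on_def)
    next
      case True
      have "N' i j = (\<Sum>k\<in>I. N' i k * id_mat k j)"
        using fin True by (simp add: id_mat_def diag_mat_def if_distrib cong: if_cong)
      also have "\<dots> = (\<Sum>k\<in>I. N' i k * (\<Sum>l\<in>I. A k l * N l j))"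
        using N True by (intro sum.cong) (auto simp: is_inverse_on_def)
      also have "\<dots> = (\<Sum>l\<in>I. (\<Sum>k\<in>I. N' i k * A k l) * N l j)"
        unfolding sum_distrib_left sum_distrib_right
        by (subst sum.swap) (simp add: mult.assoc)
      also have "\<dots> = (\<Sum>l\<in>I. id_mat i l * N l j)"
        using N' True by (intro sum.cong) (auto simp: is_inverse_on_def)
      also have "\<dots> = N i j"
        using fin True
        by (simp add: id_mat_def diag_mat_def if_distrib[of "\<lambda>z. z * _"] cong: if_cong)
      finally show ?thesis .
    qed
  qed
qed

definition nu :: "real measure" where
  "nu = density (restrict_space lborel {0..}) (\<lambda>r. ennreal (2 * r * exp (- (r\<^sup>2))))"

definition mu_val :: "(real \<Rightarrow> real) \<Rightarrow> real" where
  "mu_val W = (\<integral>r. W (r\<^sup>2) \<partial>nu)"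

text \<open>The radial parts of the normalised complex Hermite polynomials, orthonormal in \<open>L\<^sup>2(nu)\<close> for fixed \<open>a - b\<close>.\<close>

definition e_fun :: "nat \<Rightarrow> nat \<Rightarrow> real \<Rightarrow> real" where
  "e_fun a b r = 1 / sqrt (fact a * fact b) *
     (\<Sum>j = 0..min a b. (-1) ^ j * fact j * real (a choose j) * real (b choose j)
        * r ^ (a + b - 2 * j))"

definition phi :: "nat \<Rightarrow> real \<Rightarrow> real" where
  "phi l = e_fun (l + 1) l"

definition idx :: "nat set \<Rightarrow> nat \<Rightarrow> nat \<Rightarrow> nat set" where
  "idx \<Lambda> p q = {l \<in> \<Lambda>. p \<le> l + 1 \<and> q \<le> l}"

definition M_integrand :: "(real \<Rightarrow> real) \<Rightarrow> nat \<Rightarrow> nat \<Rightarrow> nat \<Rightarrow> nat \<Rightarrow> real \<Rightarrow> real" where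
  "M_integrand W p q l m r =
     e_fun (l + 1 - p) (l - q) r * e_fun (m + 1 - p) (m - q) r / W (r\<^sup>2)"

definition M_mat ::
    "(nat \<Rightarrow> real) \<Rightarrow> (real \<Rightarrow> real) \<Rightarrow> nat \<Rightarrow> nat \<Rightarrow> nat \<Rightarrow> nat \<Rightarrow> real" where
  "M_mat \<beta> W p q l m = sqrt (\<beta> l * \<beta> m) * (\<integral>r. M_integrand W p q l m r \<partial>nu)"

definition D_fun :: "real \<Rightarrow> (real \<Rightarrow> real) \<Rightarrow> real \<Rightarrow> real" where
  "D_fun \<rho> W r = 2 * \<rho> + W (r\<^sup>2)"

definition R_val :: "real \<Rightarrow> (real \<Rightarrow> real) \<Rightarrow> real" where
  "R_val \<rho> W = (\<integral>r. r\<^sup>2 / D_fun \<rho> W r \<partial>nu)"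

definition b_vec :: "real \<Rightarrow> (real \<Rightarrow> real) \<Rightarrow> nat \<Rightarrow> real" where
  "b_vec \<rho> W l = (\<integral>r. r * phi l r / D_fun \<rho> W r \<partial>nu)"

definition G_mat :: "real \<Rightarrow> (real \<Rightarrow> real) \<Rightarrow> nat \<Rightarrow> nat \<Rightarrow> real" where
  "G_mat \<rho> W l m = (\<integral>r. phi l r * phi m r / D_fun \<rho> W r \<partial>nu)"

text \<open>For empty \<open>\<Lambda>\<close> the double sum vanishes and the value is \<open>R_val \<rho> W\<close>.\<close>

definition S_val :: "nat set \<Rightarrow> real \<Rightarrow> (nat \<Rightarrow> real) \<Rightarrow> (real \<Rightarrow> real) \<Rightarrow> real" where
  "S_val \<Lambda> \<rho> \<beta> W =
     (let N = inverse_on \<Lambda> (\<lambda>l m. inverse_on \<Lambda> (diag_mat \<beta>) l m + G_mat \<rho> W l m)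
      in R_val \<rho> W - (\<Sum>l\<in>\<Lambda>. \<Sum>m\<in>\<Lambda>. b_vec \<rho> W l * N l m * b_vec \<rho> W m))"

text \<open>Finiteness of an integral is rendered as integrability, since the Bochner integral of a
  non-integrable function is 0 by convention. The function \<open>W\<close> is only constrained on
  \<open>[0,\<infinity>)\<close>; its values elsewhere are never used.\<close>

definition admissible ::
    "nat set \<Rightarrow> real \<Rightarrow> (nat \<Rightarrow> real) \<Rightarrow> (real \<Rightarrow> real) \<Rightarrow> bool" where
  "admissible \<Lambda> \<rho> \<beta> W \<longleftrightarrow>
     finite \<Lambda> \<and> (\<forall>l\<in>\<Lambda>. 1 \<le> l) \<and>
     0 < \<rho> \<and> \<rho> < 1 \<and>
     (\<forall>l\<in>\<Lambda>. 0 < \<beta> l) \<and>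
     W \<in> borel_measurable (restrict_space borel {0..}) \<and>
     (\<forall>t\<ge>0. 0 < W t) \<and>
     integrable nu (\<lambda>r. W (r\<^sup>2)) \<and>
     (\<forall>p q. \<forall>l\<in>idx \<Lambda> p q. \<forall>m\<in>idx \<Lambda> p q. integrable nu (M_integrand W p q l m)) \<and>
     (\<forall>p q. idx \<Lambda> p q \<noteq> {} \<longrightarrow> loewner_le_on (idx \<Lambda> p q) (M_mat \<beta> W p q) id_mat) \<and>
     S_val \<Lambda> \<rho> \<beta> W \<le> 1"

text \<open>The supremum is taken in the extended reals, so that no boundedness is presupposed.\<close>

definition Kstar :: ereal where
  "Kstar = Sup {ereal ((1 - \<rho>) / (\<rho> + mu_val W)) | \<Lambda> \<rho> \<beta> W. admissible \<Lambda> \<rho> \<beta> W}"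

end

theory Submission
  imports Defs "HOL-Probability.Distributions"
begin

text \<open>Upper bound, by duality: only the constraint with \<open>(p, q) = (2, 1)\<close> matters. Let \<open>g\<^sup>2 + f\<^sup>2 \<le> 1\<close> and
  \<open>\<langle>phi l, g\<rangle>\<^sup>2 \<le> \<langle>e_fun (l - 1) (l - 1), f\<rangle>\<^sup>2\<close> for \<open>l \<ge> 1\<close>, and put \<open>m = \<langle>r, g\<rangle>\<close>. Testing \<open>S \<le> 1\<close> with \<open>g / m\<close> gives
  \<open>m\<^sup>2 - 2 \<rho> \<parallel>g\<parallel>\<^sup>2 \<le> \<mu>\<close>, and Parseval gives \<open>2 \<parallel>g\<parallel>\<^sup>2 \<le> 1 + m\<^sup>2\<close>, so that \<open>(1 - \<rho>) / (\<rho> + \<mu>) \<le> 1 / m\<^sup>2\<close>.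
  For sums of exponentials in \<open>r\<^sup>2\<close> the Laguerre coefficients are sums of geometric sequences; the pointwise inequality
  is certified by Taylor expansions in integer arithmetic.

  Lower bound: \<open>W = 1 / U\<close> for a sum \<open>U\<close> of exponentials makes all matrix entries explicit. The tight matrix is handled by
  a Cholesky factor and diagonal dominance, all others have trace at most 1. By the variational form of \<open>S\<close> and
  \<open>1 / (2 \<rho> + W) \<le> (1 - 2 \<rho> Z)\<^sup>2 U + 2 \<rho> Z\<^sup>2\<close>, valid for every \<open>Z\<close>, the condition \<open>S \<le> 1\<close> reduces to moments of exponentials, and
  \<open>1 / U = Y (1 - z) + z\<^sup>2 / U\<close> with \<open>z = U Y - 1\<close> does the same for \<open>\<mu>\<close>.\<close>

section \<open>Laguerre functions and the measure nu\<close>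

text \<open>The matrix with (p, q) = (2, 1) involves the whole of \<Lambda>. In the constraint on S
  a test function g leaves a penalty, the \<beta>-weighted sum of its squared coefficients; f pays
  for it through this matrix. As the coefficients are compared for every l \<ge> 1, the resulting
  bound sees neither \<Lambda> nor \<beta>. The condition on g and f lets both share one copy of
  \<mu>, and the norm condition on g is exactly what removes \<rho>.

  The required decimals differ by less than 7 / 10^7, so both sides need sharp data, and the
  pointwise certificate may lose only about 2 / 10^8. The exponents therefore form doubling chains:
  all exponentials at a point come from one value by repeated squaring.

  For the lower bound the matrices are linear in U, but \<mu> and S contain 1 / U and 1 / (2 \<rho>
  + 1 / U), whose integrals have no closed form. Both replacements err only to second order in the
  accuracy of the auxiliary sums Y and Z, so short lists suffice, and ten indices l are
  enough.\<close>

lemma space_nu [simp]: "space nu = {0..}"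
  by (simp add: nu_def space_restrict_space)

lemma sets_nu: "sets nu = sets (restrict_space borel {0..})"
  by (simp add: nu_def sets_restrict_space)

lemma measurable_nu_borel: "f \<in> borel_measurable borel \<Longrightarrow> f \<in> borel_measurable nu"
  for f :: "real \<Rightarrow> real"
  by (subst measurable_cong_sets[OF sets_nu refl]) (rule measurable_restrict_space1)

lemma has_bochner_integral_nu:
  assumes "f \<in> borel_measurable borel"
    and "has_bochner_integral lborel (\<lambda>r. indicator {0..} r *\<^sub>R (2 * r * exp (- r\<^sup>2) * f r)) I"
  shows "has_bochner_integral nu f (I :: real)"
  unfolding nu_def
proof (rule has_bochner_integral_density)
  show "f \<in> borel_measurable (restrict_space lborel {0..})"
    by (rule measurable_restrict_space1) (use assms(1) in simp)
  have "(\<lambda>r::real. 2 * r * exp (- (r\<^sup>2))) \<in> borel_measurable borel" by measurable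
  then show "(\<lambda>r::real. 2 * r * exp (- (r\<^sup>2))) \<in> borel_measurable (restrict_space lborel {0..})"
    by (intro measurable_restrict_space1) simp
  show "AE r::real in restrict_space lborel {0..}. 0 \<le> 2 * r * exp (- r\<^sup>2)"
    by (rule AE_I2) (simp add: space_restrict_space)
  have "{0..} \<inter> space lborel \<in> sets (lborel :: real measure)" by simp
  note r = integrable_restrict_space[OF this] integral_restrict_space[OF this]
  show "has_bochner_integral (restrict_space lborel {0..}) (\<lambda>r. (2 * r * exp (- r\<^sup>2)) *\<^sub>R f r) I"
    using assms(2) unfolding has_bochner_integral_iff r real_scaleR_def by (simp only: mult.assoc)
qed

text \<open>Scaling \<open>r\<close> by \<open>sqrt (1 + s)\<close> absorbs the extra exponential
  into the Gaussian and leaves its odd half-line moment. Every closed-form integral below is a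
  linear combination of these.\<close>

lemma nu_moment:
  assumes s: "-1 < s"
  shows "has_bochner_integral nu (\<lambda>r. (r\<^sup>2) ^ k * exp (- (s * r\<^sup>2))) (fact k / (1 + s) ^ Suc k)"
proof (rule has_bochner_integral_nu)
  define c where "c = sqrt (1 + s)"
  have c: "c > 0" "c\<^sup>2 = 1 + s" using s by (auto simp: c_def)
  have "has_bochner_integral lborel (\<lambda>x::real. indicator {0..} x *\<^sub>R (exp (- x\<^sup>2) * x ^ (2 * k + 1))) (fact k / 2)"
    by (rule gaussian_moment_odd_pos)
  then have "has_bochner_integral lborel
      (\<lambda>r. indicator {0..} (0 + c * r) *\<^sub>R (exp (- (0 + c * r)\<^sup>2) * (0 + c * r) ^ (2 * k + 1))) ((fact k / 2) /\<^sub>R \<bar>c\<bar>)"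
    using c(1) by (subst (asm) lborel_has_bochner_integral_real_affine_iff[where c = c and t = 0]) auto
  then have "has_bochner_integral lborel
      (\<lambda>r. 2 / c ^ (2 * k + 1) * (indicator {0..} (0 + c * r) *\<^sub>R (exp (- (0 + c * r)\<^sup>2) * (0 + c * r) ^ (2 * k + 1))))
      (2 / c ^ (2 * k + 1) * ((fact k / 2) /\<^sub>R \<bar>c\<bar>))"
    by (rule has_bochner_integral_mult_right)
  also have "(\<lambda>r. 2 / c ^ (2 * k + 1) * (indicator {0..} (0 + c * r) *\<^sub>R (exp (- (0 + c * r)\<^sup>2) * (0 + c * r) ^ (2 * k + 1))))
    = (\<lambda>r. indicator {0..} r *\<^sub>R (2 * r * exp (- r\<^sup>2) * ((r\<^sup>2) ^ k * exp (- (s * r\<^sup>2)))))"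
  proof
    fix r :: real
    have i: "indicator {0..} (0 + c * r) = (indicator {0..} r :: real)"
      using c(1) by (auto simp: indicator_def zero_le_mult_iff)
    have "(0 + c * r)\<^sup>2 = r\<^sup>2 + s * r\<^sup>2"
      by (simp add: power_mult_distrib c(2) algebra_simps)
    then have e: "exp (- (0 + c * r)\<^sup>2) = exp (- r\<^sup>2) * exp (- (s * r\<^sup>2))"
      by (simp flip: exp_add)
    have "r ^ (2 * k + 1) = r * (r\<^sup>2) ^ k" unfolding power_add power_mult by simp
    then have m: "(0 + c * r) ^ (2 * k + 1) = c ^ (2 * k + 1) * (r * (r\<^sup>2) ^ k)"
      by (metis add_0 power_mult_distrib)
    have "2 / C * (I * (E * F * (C * (r * R)))) = I * (2 * r * E * (R * F))" if "C \<noteq> 0" for C I E F R :: real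
      using that by (simp add: field_simps)
    moreover have "c ^ (2 * k + 1) \<noteq> 0" using c(1) by simp
    ultimately show "2 / c ^ (2 * k + 1) * (indicator {0..} (0 + c * r) *\<^sub>R (exp (- (0 + c * r)\<^sup>2) * (0 + c * r) ^ (2 * k + 1)))
      = indicator {0..} r *\<^sub>R (2 * r * exp (- r\<^sup>2) * ((r\<^sup>2) ^ k * exp (- (s * r\<^sup>2))))"
      unfolding i e m real_scaleR_def by blast
  qed
  also have "2 / c ^ (2 * k + 1) * ((fact k / 2) /\<^sub>R \<bar>c\<bar>) = fact k / (c\<^sup>2) ^ Suc k"
  proof -
    have e: "(c\<^sup>2) ^ Suc k = c ^ (2 * k + 1) * c"
      unfolding power_mult[symmetric] power_Suc2[symmetric] by (rule arg_cong[where f = "power c"]) simp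
    have "2 / C * ((f / 2) /\<^sub>R \<bar>c\<bar>) = f / (C * c)" for C f :: real
      using c(1) by (simp add: divide_simps)
    then show ?thesis unfolding e .
  qed
  finally show "has_bochner_integral lborel (\<lambda>r. indicator {0..} r *\<^sub>R (2 * r * exp (- r\<^sup>2) * ((r\<^sup>2) ^ k * exp (- (s * r\<^sup>2)))))
     (fact k / (1 + s) ^ Suc k)"
    unfolding c(2) .
qed measurable

text \<open>The generalised Laguerre polynomial of degree \<open>n\<close> and parameter
  \<open>k\<close>.\<close>

definition lag :: "nat \<Rightarrow> nat \<Rightarrow> real \<Rightarrow> real" where
  "lag k n t = (\<Sum>i\<le>n. (-1) ^ i * real ((n + k) choose (n - i)) / fact i * t ^ i)"

lemma e_fun_commute: "e_fun a b = e_fun b a"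
  by (rule ext) (simp add: e_fun_def min.commute add.commute mult.commute mult.left_commute)

lemma e_fun_lag: "e_fun (n + k) n r = (-1) ^ n * sqrt (fact n / fact (n + k)) * r ^ k * lag k n (r\<^sup>2)"
proof -
  have "(\<Sum>j = 0..min (n + k) n. (-1) ^ j * fact j * real ((n + k) choose j) * real (n choose j) * r ^ (n + k + n - 2 * j))
    = (\<Sum>i\<le>n. (-1) ^ (n - i) * fact (n - i) * real ((n + k) choose (n - i)) * real (n choose (n - i)) * r ^ (n + k + n - 2 * (n - i)))"
    by (intro sum.reindex_bij_witness[of _ "\<lambda>i. n - i" "\<lambda>i. n - i"]) auto
  also have "\<dots> = (\<Sum>i\<le>n. fact n * (-1) ^ n * r ^ k * ((-1) ^ i * real ((n + k) choose (n - i)) / fact i * (r\<^sup>2) ^ i))"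
  proof (intro sum.cong refl)
    fix i assume "i \<in> {..n}"
    then have i: "i \<le> n" by simp
    have "real (n choose (n - i)) = fact n / (fact (n - i) * fact i)"
      using i by (subst binomial_fact) auto
    then have a: "fact (n - i) * real (n choose (n - i)) = fact n / fact i" by simp
    have b: "(-1 :: real) ^ (n - i) = (-1) ^ n * (-1) ^ i"
      using i by (auto simp: minus_one_power_iff)
    have c: "n + k + n - 2 * (n - i) = k + 2 * i" using i by simp
    have d: "r ^ (k + 2 * i) = r ^ k * (r\<^sup>2) ^ i" by (simp add: power_add power_mult)
    have "(-1) ^ (n - i) * fact (n - i) * real ((n + k) choose (n - i)) * real (n choose (n - i)) * r ^ (n + k + n - 2 * (n - i))
      = (-1) ^ (n - i) * real ((n + k) choose (n - i)) * (fact (n - i) * real (n choose (n - i))) * r ^ (n + k + n - 2 * (n - i))"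
      by simp
    then show "(-1) ^ (n - i) * fact (n - i) * real ((n + k) choose (n - i)) * real (n choose (n - i)) * r ^ (n + k + n - 2 * (n - i))
      = fact n * (-1) ^ n * r ^ k * ((-1) ^ i * real ((n + k) choose (n - i)) / fact i * (r\<^sup>2) ^ i)"
      unfolding a b c d by simp
  qed
  also have "\<dots> = fact n * (-1) ^ n * r ^ k * lag k n (r\<^sup>2)"
    by (simp add: lag_def sum_distrib_left)
  finally have "e_fun (n + k) n r = 1 / sqrt (fact (n + k) * fact n) * (fact n * (-1) ^ n * r ^ k * lag k n (r\<^sup>2))"
    by (simp add: e_fun_def)
  moreover have "1 / sqrt (fact (n + k) * fact n) * fact n = (sqrt (fact n / fact (n + k)) :: real)"
  proof -
    have "1 / sqrt (fact (n + k) * fact n) * fact n = (fact n / sqrt (fact n)) / (sqrt (fact (n + k)) :: real)"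
      by (simp add: real_sqrt_mult)
    also have "\<dots> = sqrt (fact n) / sqrt (fact (n + k))"
      by (subst real_div_sqrt) simp_all
    finally show ?thesis by (simp add: real_sqrt_divide)
  qed
  ultimately have "e_fun (n + k) n r = sqrt (fact n / fact (n + k)) * ((-1) ^ n * r ^ k * lag k n (r\<^sup>2))"
    by (metis (no_types, opaque_lifting) mult.assoc)
  then show ?thesis by (simp add: ac_simps)
qed

text \<open>The Laplace transform of a Laguerre polynomial with its weight; the sum over the
  coefficients is the binomial theorem for \<open>1 - 1 / (1 + s)\<close>. The dependence on
  \<open>n\<close> is geometric up to factorials, which makes sums of exponentials convenient test
  functions.\<close>

lemma nu_lag:
  assumes s: "-1 < s"
  shows "has_bochner_integral nu (\<lambda>r. (r\<^sup>2) ^ k * lag k n (r\<^sup>2) * exp (- (s * r\<^sup>2)))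
    (fact (n + k) / fact n * (1 / (1 + s)) ^ Suc k * (s / (1 + s)) ^ n)"
proof -
  define q where "q = 1 / (1 + s)"
  have q1: "1 - q = s / (1 + s)" using s by (simp add: q_def field_simps)
  have "has_bochner_integral nu (\<lambda>r. \<Sum>i\<le>n. ((-1) ^ i * real ((n + k) choose (n - i)) / fact i) * ((r\<^sup>2) ^ (k + i) * exp (- (s * r\<^sup>2))))
    (\<Sum>i\<le>n. ((-1) ^ i * real ((n + k) choose (n - i)) / fact i) * (fact (k + i) / (1 + s) ^ Suc (k + i)))"
    by (intro has_bochner_integral_sum has_bochner_integral_mult_right nu_moment s)
  also have "(\<lambda>r. \<Sum>i\<le>n. ((-1) ^ i * real ((n + k) choose (n - i)) / fact i) * ((r\<^sup>2) ^ (k + i) * exp (- (s * r\<^sup>2))))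
    = (\<lambda>r. (r\<^sup>2) ^ k * lag k n (r\<^sup>2) * exp (- (s * r\<^sup>2)))"
    by (simp add: lag_def sum_distrib_left sum_distrib_right power_add algebra_simps)
  also have "(\<Sum>i\<le>n. ((-1) ^ i * real ((n + k) choose (n - i)) / fact i) * (fact (k + i) / (1 + s) ^ Suc (k + i)))
    = (\<Sum>i\<le>n. fact (n + k) / fact n * q ^ Suc k * (real (n choose i) * (- q) ^ i * 1 ^ (n - i)))"
  proof (intro sum.cong refl)
    fix i assume "i \<in> {..n}"
    then have i: "i \<le> n" by simp
    have a: "real ((n + k) choose (n - i)) = fact (n + k) / (fact (n - i) * fact (k + i))"
      using i by (subst binomial_fact) (auto simp: add.commute)
    have b: "real (n choose i) = fact n / (fact i * fact (n - i))"
      using i by (simp add: binomial_fact)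
    have c: "1 / (1 + s) ^ Suc (k + i) = q ^ Suc k * q ^ i"
      by (simp add: q_def power_add power_one_over)
    have d: "(-q) ^ i = (-1) ^ i * q ^ i" by (metis mult_minus1 power_mult_distrib)
    have "((-1) ^ i * real ((n + k) choose (n - i)) / fact i) * (fact (k + i) / (1 + s) ^ Suc (k + i))
      = ((-1) ^ i * real ((n + k) choose (n - i)) / fact i) * (fact (k + i) * (1 / (1 + s) ^ Suc (k + i)))" by simp
    also have "\<dots> = fact (n + k) / fact n * q ^ Suc k * (real (n choose i) * (- q) ^ i * 1 ^ (n - i))"
      unfolding a b c d by (simp add: field_simps)
    finally show "((-1) ^ i * real ((n + k) choose (n - i)) / fact i) * (fact (k + i) / (1 + s) ^ Suc (k + i))
      = fact (n + k) / fact n * q ^ Suc k * (real (n choose i) * (- q) ^ i * 1 ^ (n - i))" .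
  qed
  also have "\<dots> = fact (n + k) / fact n * q ^ Suc k * (- q + 1) ^ n"
    by (subst binomial_ring) (simp add: sum_distrib_left)
  finally show ?thesis by (simp add: q_def[symmetric] q1[symmetric])
qed

text \<open>Up to sign this is the n-th forward difference of the polynomial
  \<open>x choose r\<close> in \<open>x\<close>. By Pascal's rule each difference lowers
  \<open>r\<close> by one, so nothing remains once \<open>n\<close> exceeds
  \<open>r\<close>.\<close>

lemma alternating_binomial_shift:
  "(\<Sum>i\<le>n. (-1) ^ i * real (n choose i) * real ((x + i) choose r)) = (if n \<le> r then (-1) ^ n * real (x choose (r - n)) else 0)"
proof (induction n arbitrary: x r)
  case (Suc n)
  have "(\<Sum>i\<le>Suc n. (-1) ^ i * real (Suc n choose i) * real ((x + i) choose r))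
    = real (x choose r) + (\<Sum>i\<le>n. (-1) ^ Suc i * real (Suc n choose Suc i) * real ((x + Suc i) choose r))"
    by (subst sum.atMost_Suc_shift) simp
  also have "(\<Sum>i\<le>n. (-1) ^ Suc i * real (Suc n choose Suc i) * real ((x + Suc i) choose r))
    = (\<Sum>i\<le>n. (-1) ^ Suc i * real (n choose i) * real ((x + Suc i) choose r))
      + (\<Sum>i\<le>n. (-1) ^ Suc i * real (n choose Suc i) * real ((x + Suc i) choose r))"
    unfolding sum.distrib[symmetric] by (intro sum.cong refl) (simp add: algebra_simps)
  also have "(\<Sum>i\<le>n. (-1) ^ Suc i * real (n choose Suc i) * real ((x + Suc i) choose r))
    = (\<Sum>i\<le>Suc n. (-1) ^ i * real (n choose i) * real ((x + i) choose r)) - real (x choose r)"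
    by (subst sum.atMost_Suc_shift) simp
  also have "(\<Sum>i\<le>Suc n. (-1) ^ i * real (n choose i) * real ((x + i) choose r))
    = (\<Sum>i\<le>n. (-1) ^ i * real (n choose i) * real ((x + i) choose r))" by simp
  also have "(\<Sum>i\<le>n. (-1) ^ Suc i * real (n choose i) * real ((x + Suc i) choose r))
    = - (\<Sum>i\<le>n. (-1) ^ i * real (n choose i) * real ((Suc x + i) choose r))"
    by (simp add: sum_negf)
  finally have *: "(\<Sum>i\<le>Suc n. (-1) ^ i * real (Suc n choose i) * real ((x + i) choose r))
    = (\<Sum>i\<le>n. (-1) ^ i * real (n choose i) * real ((x + i) choose r))
      - (\<Sum>i\<le>n. (-1) ^ i * real (n choose i) * real ((Suc x + i) choose r))" by simp
  show ?case unfolding * Suc.IH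
  proof (cases "Suc n \<le> r")
    case True
    then obtain d where d: "r - n = Suc d" by (metis Suc_diff_Suc Suc_le_lessD)
    then have "r - Suc n = d" by simp
    then show "(if n \<le> r then (-1) ^ n * real (x choose (r - n)) else 0) - (if n \<le> r then (-1) ^ n * real (Suc x choose (r - n)) else 0)
      = (if Suc n \<le> r then (-1) ^ Suc n * real (x choose (r - Suc n)) else 0)"
      using True d by (simp add: algebra_simps)
  next
    case False
    then show "(if n \<le> r then (-1) ^ n * real (x choose (r - n)) else 0) - (if n \<le> r then (-1) ^ n * real (Suc x choose (r - n)) else 0)
      = (if Suc n \<le> r then (-1) ^ Suc n * real (x choose (r - Suc n)) else 0)"
      by (cases "n = r") auto
  qed
qed simp

definition lagc :: "nat \<Rightarrow> nat \<Rightarrow> nat \<Rightarrow> real" where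
  "lagc k n i = (-1) ^ i * real ((n + k) choose (n - i)) / fact i"

lemma lag_lagc: "lag k n t = (\<Sum>i\<le>n. lagc k n i * t ^ i)"
  by (simp add: lag_def lagc_def)

text \<open>The sum is the half-line integral of \<open>lag k n t\<close> against t^(k + m) exp(-t).
  Its vanishing for m < n is orthogonality to all lower degrees.\<close>

lemma lagc_moment:
  "(\<Sum>i\<le>n. lagc k n i * fact (k + i + m)) =
    (if n \<le> m then fact (n + k) / fact n * fact m * (-1) ^ n * real ((k + m) choose (m - n)) else 0)"
proof -
  have "(\<Sum>i\<le>n. lagc k n i * fact (k + i + m))
    = (\<Sum>i\<le>n. fact (n + k) / fact n * fact m * ((-1) ^ i * real (n choose i) * real ((k + m + i) choose m)))"
  proof (intro sum.cong refl)
    fix i assume "i \<in> {..n}"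
    then have i: "i \<le> n" by simp
    have a: "real ((n + k) choose (n - i)) = fact (n + k) / (fact (n - i) * fact (k + i))"
      using i by (subst binomial_fact) (auto simp: add.commute)
    have b: "real (n choose i) = fact n / (fact i * fact (n - i))"
      using i by (simp add: binomial_fact)
    have c: "real ((k + m + i) choose m) = fact (k + i + m) / (fact m * fact (k + i))"
      by (subst binomial_fact) (auto simp: ac_simps)
    show "lagc k n i * fact (k + i + m) = fact (n + k) / fact n * fact m * ((-1) ^ i * real (n choose i) * real ((k + m + i) choose m))"
      unfolding lagc_def a b c by (simp add: field_simps)
  qed
  also have "\<dots> = fact (n + k) / fact n * fact m * (\<Sum>i\<le>n. (-1) ^ i * real (n choose i) * real ((k + m + i) choose m))"
    by (simp add: sum_distrib_left)
  finally show ?thesis by (simp add: alternating_binomial_shift)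
qed

text \<open>For m \<le> n the moments kill every \<open>j\<close> except j = n, so only the leading
  coefficient contributes; the other case is symmetric. The form as a finite sum lets it be used
  after any rescaling of the argument.\<close>

lemma lagc_orthogonal:
  "(\<Sum>i\<le>n. \<Sum>j\<le>m. lagc k n i * lagc k m j * fact (k + i + j)) = (if n = m then fact (n + k) / fact n else 0)"
proof -
  have *: "(\<Sum>i\<le>n. \<Sum>j\<le>m. lagc k n i * lagc k m j * fact (k + i + j)) = (if n = m then fact (n + k) / fact n else 0)"
    if "m \<le> n" for n m
  proof -
    have "(\<Sum>i\<le>n. \<Sum>j\<le>m. lagc k n i * lagc k m j * fact (k + i + j))
      = (\<Sum>j\<le>m. lagc k m j * (\<Sum>i\<le>n. lagc k n i * fact (k + i + j)))"
      by (subst sum.swap) (simp add: sum_distrib_left algebra_simps)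
    also have "\<dots> = (\<Sum>j\<le>m. if j = n then fact (n + k) / fact n else 0)"
    proof (intro sum.cong refl)
      fix j assume "j \<in> {..m}"
      then have "j \<le> n" using that by simp
      then show "lagc k m j * (\<Sum>i\<le>n. lagc k n i * fact (k + i + j)) = (if j = n then fact (n + k) / fact n else 0)"
        unfolding lagc_moment using \<open>j \<in> {..m}\<close> that
        by (auto simp: lagc_def power_mult_distrib[symmetric])
    qed
    also have "\<dots> = (if n = m then fact (n + k) / fact n else 0)"
      using that by auto
    finally show ?thesis .
  qed
  show ?thesis
  proof (cases "m \<le> n")
    case True then show ?thesis by (rule *)
  next
    case False
    have "(\<Sum>i\<le>n. \<Sum>j\<le>m. lagc k n i * lagc k m j * fact (k + i + j)) = (\<Sum>j\<le>m. \<Sum>i\<le>n. lagc k m j * lagc k n i * fact (k + j + i))"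
      by (subst sum.swap) (simp add: algebra_simps)
    also have "\<dots> = (if m = n then fact (m + k) / fact m else 0)" using False by (intro *) simp
    finally show ?thesis by auto
  qed
qed

text \<open>Binomial weights; for \<open>k = 0\<close> these are the binomial probabilities.\<close>

definition bw :: "nat \<Rightarrow> real \<Rightarrow> nat \<Rightarrow> nat \<Rightarrow> real" where
  "bw k q n j = (if j \<le> n then real ((n + k) choose (n - j)) * q ^ j * (1 - q) ^ (n - j) else 0)"

lemma sum_triangle_swap: "(\<Sum>j\<le>n. \<Sum>i\<le>j. f j i) = (\<Sum>i\<le>n. \<Sum>j=i..n. f j i)"
  for f :: "nat \<Rightarrow> nat \<Rightarrow> real"
proof -
  have "(\<Sum>j\<le>n. \<Sum>i\<le>j. f j i) = (\<Sum>(j, i)\<in>(SIGMA j:{..n}. {..j}). f j i)"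
    by (simp add: sum.Sigma)
  also have "\<dots> = (\<Sum>(i, j)\<in>(SIGMA i:{..n}. {i..n}). f j i)"
    by (rule sum.reindex_bij_witness[of _ "\<lambda>(i, j). (j, i)" "\<lambda>(j, i). (i, j)"]) auto
  also have "\<dots> = (\<Sum>i\<le>n. \<Sum>j=i..n. f j i)"
    by (simp add: sum.Sigma)
  finally show ?thesis .
qed

text \<open>The multiplication theorem for Laguerre polynomials: comparing coefficients of t^i
  leaves a binomial expansion of (q + (1 - q))^(n - i) with q = 1 / p.\<close>

lemma lag_scale:
  assumes p: "p \<noteq> 0"
  shows "lag k n t = (\<Sum>j\<le>n. bw k (1 / p) n j * lag k j (p * t))"
proof -
  define q where "q = 1 / p"
  have "(\<Sum>j\<le>n. bw k q n j * lag k j (p * t))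
    = (\<Sum>j\<le>n. \<Sum>i\<le>j. bw k q n j * (lagc k j i * (p * t) ^ i))"
    by (simp add: lag_lagc sum_distrib_left)
  also have "\<dots> = (\<Sum>i\<le>n. \<Sum>j=i..n. bw k q n j * (lagc k j i * (p * t) ^ i))"
    by (rule sum_triangle_swap)
  also have "\<dots> = (\<Sum>i\<le>n. lagc k n i * t ^ i)"
  proof (intro sum.cong refl)
    fix i assume "i \<in> {..n}"
    then have i: "i \<le> n" by simp
    have "(\<Sum>j=i..n. bw k q n j * (lagc k j i * (p * t) ^ i))
      = (\<Sum>j=i..n. lagc k n i * t ^ i * (real ((n - i) choose (j - i)) * q ^ (j - i) * (1 - q) ^ (n - i - (j - i))))"
    proof (intro sum.cong refl)
      fix j assume "j \<in> {i..n}"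
      then have j: "i \<le> j" "j \<le> n" by auto
      have a: "real ((n + k) choose (n - j)) = fact (n + k) / (fact (n - j) * fact (j + k))"
        using j by (subst binomial_fact) (auto simp: add.commute)
      have b: "real ((j + k) choose (j - i)) = fact (j + k) / (fact (j - i) * fact (i + k))"
        using j by (subst binomial_fact) (auto simp: add.commute)
      have c: "real ((n + k) choose (n - i)) = fact (n + k) / (fact (n - i) * fact (i + k))"
        using i by (subst binomial_fact) (auto simp: add.commute)
      have d: "real ((n - i) choose (j - i)) = fact (n - i) / (fact (j - i) * fact (n - j))"
        using j by (subst binomial_fact) auto
      have e: "q ^ j * p ^ i = q ^ (j - i)"
      proof -
        have "q ^ j = q ^ (j - i) * q ^ i" using j by (simp flip: power_add)
        then show ?thesis using p by (simp add: q_def power_mult_distrib[symmetric])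
      qed
      have "bw k q n j * (lagc k j i * (p * t) ^ i)
        = real ((n + k) choose (n - j)) * real ((j + k) choose (j - i)) * (q ^ j * p ^ i) * (1 - q) ^ (n - j) * ((-1) ^ i / fact i * t ^ i)"
        using j by (simp add: bw_def lagc_def power_mult_distrib)
      also have "\<dots> = lagc k n i * t ^ i * (real ((n - i) choose (j - i)) * q ^ (j - i) * (1 - q) ^ (n - i - (j - i)))"
        unfolding e a b d lagc_def c using j by (simp add: ac_simps)
      finally show "bw k q n j * (lagc k j i * (p * t) ^ i)
        = lagc k n i * t ^ i * (real ((n - i) choose (j - i)) * q ^ (j - i) * (1 - q) ^ (n - i - (j - i)))" .
    qed
    also have "\<dots> = lagc k n i * t ^ i * (\<Sum>j=i..n. real ((n - i) choose (j - i)) * q ^ (j - i) * (1 - q) ^ (n - i - (j - i)))"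
      by (simp add: sum_distrib_left)
    also have "(\<Sum>j=i..n. real ((n - i) choose (j - i)) * q ^ (j - i) * (1 - q) ^ (n - i - (j - i)))
      = (\<Sum>m\<le>n - i. real ((n - i) choose m) * q ^ m * (1 - q) ^ (n - i - m))"
      by (rule sum.reindex_bij_witness[of _ "\<lambda>m. m + i" "\<lambda>j. j - i"]) (use i in auto)
    also have "\<dots> = (q + (1 - q)) ^ (n - i)" by (subst binomial_ring) simp
    finally show "(\<Sum>j=i..n. bw k q n j * (lagc k j i * (p * t) ^ i)) = lagc k n i * t ^ i" by simp
  qed
  finally show ?thesis by (simp add: lag_lagc q_def)
qed

lemma nu_lag_orthogonal:
  assumes s: "-1 < s"
  shows "has_bochner_integral nu (\<lambda>r. (r\<^sup>2) ^ k * lag k n ((1 + s) * r\<^sup>2) * lag k m ((1 + s) * r\<^sup>2) * exp (- (s * r\<^sup>2)))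
    (if n = m then fact (n + k) / fact n / (1 + s) ^ Suc k else 0)"
proof -
  have "has_bochner_integral nu
      (\<lambda>r. \<Sum>i\<le>n. \<Sum>j\<le>m. (lagc k n i * lagc k m j * (1 + s) ^ (i + j)) * ((r\<^sup>2) ^ (k + i + j) * exp (- (s * r\<^sup>2))))
      (\<Sum>i\<le>n. \<Sum>j\<le>m. (lagc k n i * lagc k m j * (1 + s) ^ (i + j)) * (fact (k + i + j) / (1 + s) ^ Suc (k + i + j)))"
    by (intro has_bochner_integral_sum has_bochner_integral_mult_right nu_moment s)
  also have "(\<lambda>r. \<Sum>i\<le>n. \<Sum>j\<le>m. (lagc k n i * lagc k m j * (1 + s) ^ (i + j)) * ((r\<^sup>2) ^ (k + i + j) * exp (- (s * r\<^sup>2))))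
    = (\<lambda>r. (r\<^sup>2) ^ k * lag k n ((1 + s) * r\<^sup>2) * lag k m ((1 + s) * r\<^sup>2) * exp (- (s * r\<^sup>2)))"
  proof
    fix r :: real
    have "(r\<^sup>2) ^ k * lag k n ((1 + s) * r\<^sup>2) * lag k m ((1 + s) * r\<^sup>2) * exp (- (s * r\<^sup>2))
      = (r\<^sup>2) ^ k * exp (- (s * r\<^sup>2)) * (lag k n ((1 + s) * r\<^sup>2) * lag k m ((1 + s) * r\<^sup>2))" by simp
    also have "lag k n ((1 + s) * r\<^sup>2) * lag k m ((1 + s) * r\<^sup>2)
      = (\<Sum>i\<le>n. \<Sum>j\<le>m. lagc k n i * ((1 + s) * r\<^sup>2) ^ i * (lagc k m j * ((1 + s) * r\<^sup>2) ^ j))"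
      unfolding lag_lagc by (rule sum_product)
    also have "(r\<^sup>2) ^ k * exp (- (s * r\<^sup>2)) * \<dots>
      = (\<Sum>i\<le>n. \<Sum>j\<le>m. (lagc k n i * lagc k m j * (1 + s) ^ (i + j)) * ((r\<^sup>2) ^ (k + i + j) * exp (- (s * r\<^sup>2))))"
      unfolding sum_distrib_left
      by (intro sum.cong refl) (simp add: power_mult_distrib power_add ac_simps)
    finally show "(\<Sum>i\<le>n. \<Sum>j\<le>m. (lagc k n i * lagc k m j * (1 + s) ^ (i + j)) * ((r\<^sup>2) ^ (k + i + j) * exp (- (s * r\<^sup>2))))
      = (r\<^sup>2) ^ k * lag k n ((1 + s) * r\<^sup>2) * lag k m ((1 + s) * r\<^sup>2) * exp (- (s * r\<^sup>2))" by simp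
  qed
  also have "(\<Sum>i\<le>n. \<Sum>j\<le>m. (lagc k n i * lagc k m j * (1 + s) ^ (i + j)) * (fact (k + i + j) / (1 + s) ^ Suc (k + i + j)))
    = (\<Sum>i\<le>n. \<Sum>j\<le>m. lagc k n i * lagc k m j * fact (k + i + j)) / (1 + s) ^ Suc k"
    unfolding sum_divide_distrib
  proof (intro sum.cong refl)
    fix i j
    have "(1 + s) ^ Suc (k + i + j) = (1 + s) ^ (i + j) * (1 + s) ^ Suc k" by (simp add: power_add)
    then show "lagc k n i * lagc k m j * (1 + s) ^ (i + j) * (fact (k + i + j) / (1 + s) ^ Suc (k + i + j))
      = lagc k n i * lagc k m j * fact (k + i + j) / (1 + s) ^ Suc k" using s by simp
  qed
  finally show ?thesis by (cases "n = m") (simp_all only: lagc_orthogonal if_True if_False div_0 simp_thms)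
qed

text \<open>After rescaling both factors by \<open>1 + s\<close> they are orthogonal for the
  weighted measure, so the double sum becomes diagonal. The case s = 0 supplies square
  integrability.\<close>

lemma nu_lag_lag:
  assumes s: "-1 < s"
  shows "has_bochner_integral nu (\<lambda>r. (r\<^sup>2) ^ k * lag k n (r\<^sup>2) * lag k m (r\<^sup>2) * exp (- (s * r\<^sup>2)))
    ((1 / (1 + s)) ^ Suc k * (\<Sum>j\<le>n. fact (j + k) / fact j * bw k (1 / (1 + s)) n j * bw k (1 / (1 + s)) m j))"
proof -
  define q where "q = 1 / (1 + s)"
  have p: "1 + s \<noteq> 0" using s by simp
  have "has_bochner_integral nu
      (\<lambda>r. \<Sum>i\<le>n. \<Sum>j\<le>m. (bw k q n i * bw k q m j) * ((r\<^sup>2) ^ k * lag k i ((1 + s) * r\<^sup>2) * lag k j ((1 + s) * r\<^sup>2) * exp (- (s * r\<^sup>2))))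
      (\<Sum>i\<le>n. \<Sum>j\<le>m. (bw k q n i * bw k q m j) * (if i = j then fact (i + k) / fact i / (1 + s) ^ Suc k else 0))"
    by (intro has_bochner_integral_sum has_bochner_integral_mult_right nu_lag_orthogonal s)
  also have "(\<lambda>r. \<Sum>i\<le>n. \<Sum>j\<le>m. (bw k q n i * bw k q m j) * ((r\<^sup>2) ^ k * lag k i ((1 + s) * r\<^sup>2) * lag k j ((1 + s) * r\<^sup>2) * exp (- (s * r\<^sup>2))))
    = (\<lambda>r. (r\<^sup>2) ^ k * lag k n (r\<^sup>2) * lag k m (r\<^sup>2) * exp (- (s * r\<^sup>2)))"
  proof
    fix r :: real
    have "(r\<^sup>2) ^ k * lag k n (r\<^sup>2) * lag k m (r\<^sup>2) * exp (- (s * r\<^sup>2))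
      = (r\<^sup>2) ^ k * exp (- (s * r\<^sup>2)) * (lag k n (r\<^sup>2) * lag k m (r\<^sup>2))" by simp
    also have "lag k n (r\<^sup>2) * lag k m (r\<^sup>2)
      = (\<Sum>i\<le>n. \<Sum>j\<le>m. bw k q n i * lag k i ((1 + s) * r\<^sup>2) * (bw k q m j * lag k j ((1 + s) * r\<^sup>2)))"
      unfolding lag_scale[OF p, of k n] lag_scale[OF p, of k m] q_def by (rule sum_product)
    also have "(r\<^sup>2) ^ k * exp (- (s * r\<^sup>2)) * \<dots>
      = (\<Sum>i\<le>n. \<Sum>j\<le>m. (bw k q n i * bw k q m j) * ((r\<^sup>2) ^ k * lag k i ((1 + s) * r\<^sup>2) * lag k j ((1 + s) * r\<^sup>2) * exp (- (s * r\<^sup>2))))"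
      unfolding sum_distrib_left
      by (intro sum.cong refl) (simp add: ac_simps)
    finally show "(\<Sum>i\<le>n. \<Sum>j\<le>m. (bw k q n i * bw k q m j) * ((r\<^sup>2) ^ k * lag k i ((1 + s) * r\<^sup>2) * lag k j ((1 + s) * r\<^sup>2) * exp (- (s * r\<^sup>2))))
      = (r\<^sup>2) ^ k * lag k n (r\<^sup>2) * lag k m (r\<^sup>2) * exp (- (s * r\<^sup>2))" by simp
  qed
  also have "(\<Sum>i\<le>n. \<Sum>j\<le>m. (bw k q n i * bw k q m j) * (if i = j then fact (i + k) / fact i / (1 + s) ^ Suc k else 0))
    = (\<Sum>i\<le>n. q ^ Suc k * (fact (i + k) / fact i * bw k q n i * bw k q m i))"
  proof (intro sum.cong refl)
    fix i assume "i \<in> {..n}"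
    have "(\<Sum>j\<le>m. (bw k q n i * bw k q m j) * (if i = j then fact (i + k) / fact i / (1 + s) ^ Suc k else 0))
      = (\<Sum>j\<le>m. if i = j then (bw k q n i * bw k q m i) * (fact (i + k) / fact i / (1 + s) ^ Suc k) else 0)"
      by (intro sum.cong) auto
    also have "\<dots> = (bw k q n i * bw k q m i) * (fact (i + k) / fact i / (1 + s) ^ Suc k)"
      by (cases "i \<le> m") (simp_all add: bw_def)
    also have "\<dots> = q ^ Suc k * (fact (i + k) / fact i * bw k q n i * bw k q m i)"
      unfolding q_def power_one_over by (simp add: ac_simps)
    finally show "(\<Sum>j\<le>m. (bw k q n i * bw k q m j) * (if i = j then fact (i + k) / fact i / (1 + s) ^ Suc k else 0))
      = q ^ Suc k * (fact (i + k) / fact i * bw k q n i * bw k q m i)" .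
  qed
  finally show ?thesis by (simp add: sum_distrib_left q_def)
qed

section \<open>The variational form of S and duality\<close>

text \<open>Block elimination, adding one index \<open>a\<close> at a time: the system on
  \<open>I\<close> is solved for \<open>b\<close> and for the column of \<open>a\<close>, and the
  remaining scalar equation has the Schur complement \<open>d\<close> as its coefficient.\<close>

lemma pd_solve:
  fixes A :: "nat \<Rightarrow> nat \<Rightarrow> real"
  assumes "finite I" and "\<And>i j. i \<in> I \<Longrightarrow> j \<in> I \<Longrightarrow> A i j = A j i"
    and "\<And>x. \<exists>i\<in>I. x i \<noteq> 0 \<Longrightarrow> 0 < (\<Sum>i\<in>I. \<Sum>j\<in>I. x i * A i j * x j)"
  shows "\<exists>x. \<forall>i\<in>I. (\<Sum>k\<in>I. A i k * x k) = b i"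
  using assms
proof (induction I arbitrary: b rule: finite_induct)
  case (insert a I)
  have sym: "A i j = A j i" if "i \<in> insert a I" "j \<in> insert a I" for i j
    using insert.prems(1) that by blast
  have pd: "0 < (\<Sum>i\<in>I. \<Sum>j\<in>I. x i * A i j * x j)" if "\<exists>i\<in>I. x i \<noteq> 0" for x
  proof -
    define y where "y i = (if i \<in> I then x i else 0)" for i
    have "\<exists>i\<in>insert a I. y i \<noteq> 0" using that by (auto simp: y_def)
    then have "0 < (\<Sum>i\<in>insert a I. \<Sum>j\<in>insert a I. y i * A i j * y j)" by (rule insert.prems(2))
    also have "\<dots> = (\<Sum>i\<in>I. \<Sum>j\<in>I. x i * A i j * x j)"
      using insert.hyps by (simp add: y_def cong: sum.cong)
    finally show ?thesis .
  qed
  have IH: "\<exists>x. \<forall>i\<in>I. (\<Sum>k\<in>I. A i k * x k) = b i" for b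
    using insert.IH[of b] sym pd by simp
  obtain u where u: "\<And>i. i \<in> I \<Longrightarrow> (\<Sum>k\<in>I. A i k * u k) = b i" using IH[of b] by blast
  obtain w where w: "\<And>i. i \<in> I \<Longrightarrow> (\<Sum>k\<in>I. A i k * w k) = A i a" using IH[of "\<lambda>i. A i a"] by blast
  define d where "d = A a a - (\<Sum>k\<in>I. A a k * w k)"
  \<comment> \<open>On this vector the quadratic form equals the Schur complement, so positivity
    gives d > 0.\<close>
  define y where "y i = (if i = a then 1 else - w i)" for i
  have "0 < (\<Sum>i\<in>insert a I. \<Sum>j\<in>insert a I. y i * A i j * y j)"
    by (rule insert.prems(2)) (auto simp: y_def)
  also have "\<dots> = d"
  proof -
    have na: "i \<noteq> a" if "i \<in> I" for i using that insert.hyps by blast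
    have "(\<Sum>i\<in>I. \<Sum>j\<in>I. y i * A i j * y j) = (\<Sum>i\<in>I. w i * (\<Sum>j\<in>I. A i j * w j))"
      using na by (simp add: y_def sum_distrib_left mult.assoc cong: sum.cong)
    also have "\<dots> = (\<Sum>i\<in>I. w i * A i a)" using w by simp
    also have "\<dots> = (\<Sum>i\<in>I. A a i * w i)" using sym by (intro sum.cong) auto
    finally have 1: "(\<Sum>i\<in>I. \<Sum>j\<in>I. y i * A i j * y j) = (\<Sum>i\<in>I. A a i * w i)" .
    have 2: "(\<Sum>j\<in>I. y a * A a j * y j) = - (\<Sum>i\<in>I. A a i * w i)"
      using na by (simp add: y_def sum_negf cong: sum.cong)
    have 3: "(\<Sum>i\<in>I. y i * A i a * y a) = - (\<Sum>i\<in>I. A a i * w i)"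
      using na sym by (simp add: y_def sum_negf mult.commute cong: sum.cong)
    show ?thesis using insert.hyps 1 2 3
      by (simp add: sum.distrib d_def) (simp add: y_def)
  qed
  finally have d: "d > 0" .
  define s where "s = (b a - (\<Sum>k\<in>I. A a k * u k)) / d"
  define x where "x k = (if k = a then s else u k - s * w k)" for k
  have x: "(\<Sum>k\<in>insert a I. A i k * x k) = A i a * s + ((\<Sum>k\<in>I. A i k * u k) - s * (\<Sum>k\<in>I. A i k * w k))" for i
  proof -
    have "(\<Sum>k\<in>I. A i k * x k) = (\<Sum>k\<in>I. A i k * u k - s * (A i k * w k))"
      using insert.hyps by (intro sum.cong) (auto simp: x_def algebra_simps)
    then show ?thesis using insert.hyps
      by (simp add: sum_subtractf sum_distrib_left) (simp add: x_def)
  qed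
  have "(\<Sum>k\<in>insert a I. A i k * x k) = b i" if "i \<in> insert a I" for i
  proof (cases "i = a")
    case True
    have "s * d = b a - (\<Sum>k\<in>I. A a k * u k)" using d by (simp add: s_def)
    then show ?thesis unfolding x True by (simp add: d_def algebra_simps)
  next
    case False
    then show ?thesis using that u w unfolding x by simp
  qed
  then show ?case by blast
qed simp

text \<open>Solving for the unit vectors gives a right inverse N. From A N = I and the symmetry of A
  it follows that N is symmetric, and hence also a left inverse.\<close>

lemma pd_inverse:
  fixes A :: "nat \<Rightarrow> nat \<Rightarrow> real"
  assumes fin: "finite I" and sym: "\<And>i j. i \<in> I \<Longrightarrow> j \<in> I \<Longrightarrow> A i j = A j i"
    and pd: "\<And>x. \<exists>i\<in>I. x i \<noteq> 0 \<Longrightarrow> 0 < (\<Sum>i\<in>I. \<Sum>j\<in>I. x i * A i j * x j)"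
  shows "is_inverse_on I A (inverse_on I A)"
proof -
  have "\<forall>j. \<exists>x. \<forall>i\<in>I. (\<Sum>k\<in>I. A i k * x k) = id_mat i j"
    by (intro allI pd_solve[OF fin]) (use sym pd in auto)
  then obtain X where X: "\<And>i j. i \<in> I \<Longrightarrow> (\<Sum>k\<in>I. A i k * X j k) = id_mat i j" by metis
  define N where "N i j = (if i \<in> I \<and> j \<in> I then X j i else 0)" for i j
  have r: "(\<Sum>k\<in>I. A i k * N k j) = id_mat i j" if "i \<in> I" "j \<in> I" for i j
    using X that by (simp add: N_def cong: sum.cong)
  have id_sum: "(\<Sum>k\<in>I. f k * id_mat k j) = f j" if "j \<in> I" for j and f :: "nat \<Rightarrow> real"
    using fin that by (simp add: id_mat_def diag_mat_def if_distrib cong: if_cong)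
  have symN: "N i j = N j i" if "i \<in> I" "j \<in> I" for i j
  proof -
    have "N i j = (\<Sum>k\<in>I. N k j * id_mat k i)" using id_sum[of i "\<lambda>k. N k j"] that by simp
    also have "\<dots> = (\<Sum>k\<in>I. N k j * (\<Sum>l\<in>I. A k l * N l i))" using r that by simp
    also have "\<dots> = (\<Sum>k\<in>I. \<Sum>l\<in>I. N k j * A k l * N l i)" by (simp add: sum_distrib_left mult.assoc)
    also have "\<dots> = (\<Sum>l\<in>I. \<Sum>k\<in>I. N k j * A k l * N l i)" by (rule sum.swap)
    also have "\<dots> = (\<Sum>l\<in>I. (\<Sum>k\<in>I. A l k * N k j) * N l i)"
      unfolding sum_distrib_right by (intro sum.cong refl) (simp add: sym mult.commute)
    also have "\<dots> = (\<Sum>l\<in>I. N l i * id_mat l j)" using r that by (simp add: mult.commute)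
    also have "\<dots> = N j i" using id_sum[of j "\<lambda>k. N k i"] that by simp
    finally show ?thesis .
  qed
  have l: "(\<Sum>k\<in>I. N i k * A k j) = id_mat i j" if ij: "i \<in> I" "j \<in> I" for i j
  proof -
    have "(\<Sum>k\<in>I. N i k * A k j) = (\<Sum>k\<in>I. A j k * N k i)"
      using sym symN ij by (intro sum.cong refl) (simp add: mult.commute)
    also have "\<dots> = id_mat i j" using r[OF ij(2) ij(1)] by (simp add: id_mat_def diag_mat_def)
    finally show ?thesis .
  qed
  have "is_inverse_on I A N"
    unfolding is_inverse_on_def using r l by (auto simp: N_def)
  then show ?thesis using inverse_on_eqI[OF fin] by metis
qed

lemma inverse_on_diag:
  assumes "finite I" "\<And>l. l \<in> I \<Longrightarrow> d l \<noteq> 0"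
  shows "inverse_on I (diag_mat d) = (\<lambda>i j. if i = j \<and> i \<in> I then 1 / d i else 0)"
proof (rule inverse_on_eqI[OF assms(1)])
  have "(\<Sum>k\<in>I. diag_mat d i k * (if k = j \<and> k \<in> I then 1 / d k else 0)) = id_mat i j"
    if "i \<in> I" "j \<in> I" for i j
  proof -
    have "(\<Sum>k\<in>I. diag_mat d i k * (if k = j \<and> k \<in> I then 1 / d k else 0)) = (\<Sum>k\<in>I. if k = j then diag_mat d i j * (1 / d j) else 0)"
      using that by (intro sum.cong) auto
    then show ?thesis using assms that by (auto simp: diag_mat_def id_mat_def)
  qed
  moreover have "(\<Sum>k\<in>I. (if i = k \<and> i \<in> I then 1 / d i else 0) * diag_mat d k j) = id_mat i j"
    if "i \<in> I" "j \<in> I" for i j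
  proof -
    have "(\<Sum>k\<in>I. (if i = k \<and> i \<in> I then 1 / d i else 0) * diag_mat d k j) = (\<Sum>k\<in>I. if k = i then (1 / d i) * diag_mat d i j else 0)"
      using that by (intro sum.cong) auto
    then show ?thesis using assms that by (auto simp: diag_mat_def id_mat_def)
  qed
  ultimately show "is_inverse_on I (diag_mat d) (\<lambda>i j. if i = j \<and> i \<in> I then 1 / d i else 0)"
    by (auto simp: is_inverse_on_def)
qed

section \<open>Square integrability of the radial functions\<close>

lemma phi_lag: "phi l r = (-1) ^ l / sqrt (real (l + 1)) * r * lag 1 l (r\<^sup>2)"
proof -
  have "sqrt (fact l / fact (l + 1)) = 1 / sqrt (real (l + 1))"
    by (simp add: real_sqrt_divide real_sqrt_mult)
  then show ?thesis by (simp add: phi_def e_fun_lag[of l 1, simplified])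
qed

lemma e_fun_eq_lag: "e_fun n n r = (-1) ^ n * lag 0 n (r\<^sup>2)"
  using e_fun_lag[of n 0 r] by simp

lemma e_fun_borel [measurable]: "e_fun a b \<in> borel_measurable borel"
  unfolding e_fun_def by measurable

lemma phi_borel [measurable]: "phi l \<in> borel_measurable borel"
  unfolding phi_def by measurable

lemma integrable_e_fun_sq: "integrable nu (\<lambda>r. (e_fun a b r)\<^sup>2)"
proof -
  have *: "integrable nu (\<lambda>r. (e_fun (n + k) n r)\<^sup>2)" for n k
  proof -
    have "integrable nu (\<lambda>r. fact n / fact (n + k) * ((r\<^sup>2) ^ k * lag k n (r\<^sup>2) * lag k n (r\<^sup>2) * exp (- (0 * r\<^sup>2))))"
      using nu_lag_lag[of 0 k n n] by (intro integrable_mult_right) (auto simp: has_bochner_integral_iff)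
    moreover have "(e_fun (n + k) n r)\<^sup>2 = fact n / fact (n + k) * ((r\<^sup>2) ^ k * lag k n (r\<^sup>2) * lag k n (r\<^sup>2) * exp (- (0 * r\<^sup>2)))" for r :: real
      unfolding e_fun_lag
      by (simp add: power_mult_distrib power2_eq_square[of "lag k n (r\<^sup>2)"] flip: power_mult)
        (simp add: mult.commute)
    ultimately show ?thesis by simp
  qed
  show ?thesis
  proof (cases "b \<le> a")
    case True then show ?thesis using *[of b "a - b"] by simp
  next
    case False then show ?thesis using *[of a "b - a"] by (subst e_fun_commute) simp
  qed
qed

lemma integrable_mult_sq:
  fixes f g :: "real \<Rightarrow> real"
  assumes [measurable]: "f \<in> borel_measurable M" "g \<in> borel_measurable M"
    and "integrable M (\<lambda>r. (f r)\<^sup>2)" "integrable M (\<lambda>r. (g r)\<^sup>2)"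
  shows "integrable M (\<lambda>r. f r * g r)"
proof (rule Bochner_Integration.integrable_bound)
  show "integrable M (\<lambda>r. (f r)\<^sup>2 + (g r)\<^sup>2)" using assms by simp
  have "\<bar>x * y\<bar> \<le> x\<^sup>2 + y\<^sup>2" for x y :: real
  proof -
    have "2 * \<bar>x * y\<bar> \<le> x\<^sup>2 + y\<^sup>2" using sum_squares_bound[of "\<bar>x\<bar>" "\<bar>y\<bar>"] by (simp add: abs_mult)
    then show ?thesis by linarith
  qed
  then show "AE r in M. norm (f r * g r) \<le> norm ((f r)\<^sup>2 + (g r)\<^sup>2)" by simp
qed measurable

lemma e_fun_nu [measurable]: "e_fun a b \<in> borel_measurable nu"
  by (rule measurable_nu_borel) measurable

lemma phi_nu [measurable]: "phi l \<in> borel_measurable nu"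
  by (rule measurable_nu_borel) measurable

lemma id_nu [measurable]: "(\<lambda>r. r) \<in> borel_measurable nu"
  by (rule measurable_nu_borel) measurable

lemma integrable_phi_sq: "integrable nu (\<lambda>r. (phi l r)\<^sup>2)"
  unfolding phi_def by (rule integrable_e_fun_sq)

lemma integrable_r_sq: "integrable nu (\<lambda>r. r\<^sup>2)"
  using integrable_e_fun_sq[of 1 0] by (simp add: e_fun_def)

section \<open>The quadratic functional behind S and weak duality\<close>

locale weight =
  fixes \<rho> :: real and W :: "real \<Rightarrow> real"
  assumes \<rho>: "0 < \<rho>" and W_int: "integrable nu (\<lambda>r. W (r\<^sup>2))" and W_pos: "\<And>t. 0 \<le> t \<Longrightarrow> 0 < W t"
begin

lemma W_nu [measurable]: "(\<lambda>r. W (r\<^sup>2)) \<in> borel_measurable nu"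
  using W_int by (rule borel_measurable_integrable)

lemma D_nu [measurable]: "D_fun \<rho> W \<in> borel_measurable nu"
  unfolding D_fun_def by measurable

lemma D_gt: "2 * \<rho> < D_fun \<rho> W r" "0 < D_fun \<rho> W r"
  using W_pos[of "r\<^sup>2"] \<rho> by (simp_all add: D_fun_def)

lemma integrable_div_D:
  fixes f :: "real \<Rightarrow> real"
  assumes "integrable nu f"
  shows "integrable nu (\<lambda>r. f r / D_fun \<rho> W r)"
proof (rule Bochner_Integration.integrable_bound)
  show "integrable nu (\<lambda>r. f r / (2 * \<rho>))" using assms by simp
  show "(\<lambda>r. f r / D_fun \<rho> W r) \<in> borel_measurable nu"
    using borel_measurable_integrable[OF assms] by measurable
  have "\<bar>f r\<bar> / D_fun \<rho> W r \<le> \<bar>f r\<bar> / (2 * \<rho>)" for r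
    using D_gt[of r] \<rho> by (intro divide_left_mono) auto
  then show "AE r in nu. norm (f r / D_fun \<rho> W r) \<le> norm (f r / (2 * \<rho>))"
    using D_gt \<rho> by (simp add: abs_of_pos)
qed

text \<open>Ridge regression: the weighted squared residual of approximating \<open>r\<close> by the
  \<open>phi l\<close>, plus a penalty. S is its minimum over \<open>c\<close>.\<close>

definition Qf :: "nat set \<Rightarrow> (nat \<Rightarrow> real) \<Rightarrow> (nat \<Rightarrow> real) \<Rightarrow> real" where
  "Qf \<Lambda> \<beta> c = (\<integral>r. (r - (\<Sum>l\<in>\<Lambda>. c l * phi l r))\<^sup>2 / D_fun \<rho> W r \<partial>nu) + (\<Sum>l\<in>\<Lambda>. (c l)\<^sup>2 / \<beta> l)"

lemma
  shows integrable_phi_phi: "integrable nu (\<lambda>r. phi l r * phi m r)"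
    and integrable_r_phi: "integrable nu (\<lambda>r. r * phi m r)"
  by (intro integrable_mult_sq integrable_phi_sq integrable_r_sq; measurable)+

lemma Qf_expand:
  assumes fin: "finite \<Lambda>"
  shows "Qf \<Lambda> \<beta> c = R_val \<rho> W - 2 * (\<Sum>l\<in>\<Lambda>. c l * b_vec \<rho> W l)
    + (\<Sum>l\<in>\<Lambda>. \<Sum>m\<in>\<Lambda>. c l * G_mat \<rho> W l m * c m) + (\<Sum>l\<in>\<Lambda>. (c l)\<^sup>2 / \<beta> l)"
proof -
  have e: "(r - (\<Sum>l\<in>\<Lambda>. c l * phi l r))\<^sup>2 / D_fun \<rho> W r = r\<^sup>2 / D_fun \<rho> W r
      - (\<Sum>l\<in>\<Lambda>. (2 * c l) * (r * phi l r / D_fun \<rho> W r))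
      + (\<Sum>l\<in>\<Lambda>. \<Sum>m\<in>\<Lambda>. (c l * c m) * (phi l r * phi m r / D_fun \<rho> W r))" for r
  proof -
    have "(r - (\<Sum>l\<in>\<Lambda>. c l * phi l r))\<^sup>2 = r\<^sup>2 - 2 * r * (\<Sum>l\<in>\<Lambda>. c l * phi l r) + (\<Sum>l\<in>\<Lambda>. c l * phi l r) * (\<Sum>l\<in>\<Lambda>. c l * phi l r)"
      by (simp add: power2_eq_square algebra_simps)
    also have "(\<Sum>l\<in>\<Lambda>. c l * phi l r) * (\<Sum>l\<in>\<Lambda>. c l * phi l r) = (\<Sum>l\<in>\<Lambda>. \<Sum>m\<in>\<Lambda>. c l * phi l r * (c m * phi m r))"
      by (rule sum_product)
    finally show ?thesis
      by (simp add: add_divide_distrib diff_divide_distrib sum_divide_distrib sum_distrib_left mult.assoc mult.left_commute)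
  qed
  have 1: "has_bochner_integral nu (\<lambda>r. r\<^sup>2 / D_fun \<rho> W r) (R_val \<rho> W)"
    unfolding R_val_def by (intro has_bochner_integral_integrable integrable_div_D integrable_r_sq)
  have 2: "has_bochner_integral nu (\<lambda>r. r * phi l r / D_fun \<rho> W r) (b_vec \<rho> W l)" for l
    unfolding b_vec_def by (intro has_bochner_integral_integrable integrable_div_D integrable_r_phi)
  have 3: "has_bochner_integral nu (\<lambda>r. phi l r * phi m r / D_fun \<rho> W r) (G_mat \<rho> W l m)" for l m
    unfolding G_mat_def by (intro has_bochner_integral_integrable integrable_div_D integrable_phi_phi)
  have "has_bochner_integral nu (\<lambda>r. (r - (\<Sum>l\<in>\<Lambda>. c l * phi l r))\<^sup>2 / D_fun \<rho> W r)
    (R_val \<rho> W - (\<Sum>l\<in>\<Lambda>. (2 * c l) * b_vec \<rho> W l) + (\<Sum>l\<in>\<Lambda>. \<Sum>m\<in>\<Lambda>. (c l * c m) * G_mat \<rho> W l m))"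
    unfolding e by (intro has_bochner_integral_add has_bochner_integral_diff has_bochner_integral_sum
        has_bochner_integral_mult_right 1 2 3)
  then have "(\<integral>r. (r - (\<Sum>l\<in>\<Lambda>. c l * phi l r))\<^sup>2 / D_fun \<rho> W r \<partial>nu)
    = R_val \<rho> W - (\<Sum>l\<in>\<Lambda>. (2 * c l) * b_vec \<rho> W l) + (\<Sum>l\<in>\<Lambda>. \<Sum>m\<in>\<Lambda>. (c l * c m) * G_mat \<rho> W l m)"
    by (rule has_bochner_integral_integral_eq)
  then show ?thesis
    unfolding Qf_def by (simp add: sum_distrib_left mult.assoc mult.commute mult.left_commute)
qed

text \<open>With A the sum of the inverse diagonal matrix and the Gram matrix, \<open>Qf\<close> is
  R - 2 c.b + c.Ac, a strictly convex quadratic with minimiser A^-1 b; its minimum is R - b.A^-1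
  b.\<close>

lemma S_val_variational:
  assumes fin: "finite \<Lambda>" and \<beta>: "\<And>l. l \<in> \<Lambda> \<Longrightarrow> 0 < \<beta> l"
  shows "\<exists>y. S_val \<Lambda> \<rho> \<beta> W = Qf \<Lambda> \<beta> y \<and> (\<forall>c. S_val \<Lambda> \<rho> \<beta> W \<le> Qf \<Lambda> \<beta> c)"
proof -
  define A where "A l m = inverse_on \<Lambda> (diag_mat \<beta>) l m + G_mat \<rho> W l m" for l m
  have A: "A l m = (if l = m then 1 / \<beta> l else 0) + G_mat \<rho> W l m" if "l \<in> \<Lambda>" for l m
    using that \<beta> fin by (subst A_def, subst inverse_on_diag) (auto simp: less_imp_neq[symmetric])
  have symA: "A l m = A m l" if "l \<in> \<Lambda>" "m \<in> \<Lambda>" for l m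
    using A[OF that(1)] A[OF that(2)] by (simp add: G_mat_def mult.commute)
  let ?q = "\<lambda>c d. \<Sum>l\<in>\<Lambda>. \<Sum>m\<in>\<Lambda>. c l * A l m * d m"
  have qA: "?q c c = (\<Sum>l\<in>\<Lambda>. (c l)\<^sup>2 / \<beta> l) + (\<Sum>l\<in>\<Lambda>. \<Sum>m\<in>\<Lambda>. c l * G_mat \<rho> W l m * c m)" for c
  proof -
    have "?q c c = (\<Sum>l\<in>\<Lambda>. (\<Sum>m\<in>\<Lambda>. if m = l then (c l)\<^sup>2 / \<beta> l else 0) + (\<Sum>m\<in>\<Lambda>. c l * G_mat \<rho> W l m * c m))"
      unfolding sum.distrib[symmetric] by (intro sum.cong refl) (auto simp: A algebra_simps power2_eq_square)
    then show ?thesis using fin by (simp add: sum.distrib)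
  qed
  have Gpos: "0 \<le> (\<Sum>l\<in>\<Lambda>. \<Sum>m\<in>\<Lambda>. c l * G_mat \<rho> W l m * c m)" for c
  proof -
    have e: "(\<Sum>l\<in>\<Lambda>. \<Sum>m\<in>\<Lambda>. (c l * c m) * (phi l r * phi m r / D_fun \<rho> W r)) = (\<Sum>l\<in>\<Lambda>. c l * phi l r)\<^sup>2 / D_fun \<rho> W r" for r
      unfolding power2_eq_square sum_product sum_divide_distrib by (intro sum.cong refl) simp
    have "has_bochner_integral nu (\<lambda>r. \<Sum>l\<in>\<Lambda>. \<Sum>m\<in>\<Lambda>. (c l * c m) * (phi l r * phi m r / D_fun \<rho> W r))
      (\<Sum>l\<in>\<Lambda>. \<Sum>m\<in>\<Lambda>. (c l * c m) * G_mat \<rho> W l m)"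
      unfolding G_mat_def
      by (intro has_bochner_integral_sum has_bochner_integral_mult_right has_bochner_integral_integrable integrable_div_D integrable_phi_phi)
    then have "(\<integral>r. (\<Sum>l\<in>\<Lambda>. c l * phi l r)\<^sup>2 / D_fun \<rho> W r \<partial>nu) = (\<Sum>l\<in>\<Lambda>. \<Sum>m\<in>\<Lambda>. (c l * c m) * G_mat \<rho> W l m)"
      unfolding e by (rule has_bochner_integral_integral_eq)
    moreover have "0 \<le> (\<integral>r. (\<Sum>l\<in>\<Lambda>. c l * phi l r)\<^sup>2 / D_fun \<rho> W r \<partial>nu)"
      by (rule Bochner_Integration.integral_nonneg) (use D_gt in \<open>simp add: less_imp_le\<close>)
    ultimately show ?thesis by (simp add: mult.assoc mult.commute mult.left_commute)
  qed
  \<comment> \<open>Strict positivity comes from the penalty; the Gram part only has to be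
    nonnegative.\<close>
  have qpos: "0 < ?q c c" if nz: "\<exists>i\<in>\<Lambda>. c i \<noteq> 0" for c
  proof -
    obtain i where i: "i \<in> \<Lambda>" "c i \<noteq> 0" using nz by blast
    have "0 < (\<Sum>l\<in>\<Lambda>. (c l)\<^sup>2 / \<beta> l)"
      by (rule sum_pos2[OF fin i(1)]) (use i \<beta> in \<open>auto simp: less_imp_le\<close>)
    then show ?thesis using qA[of c] Gpos[of c] by linarith
  qed
  have qnn: "0 \<le> ?q c c" for c
    using qpos[of c] by (cases "\<exists>i\<in>\<Lambda>. c i \<noteq> 0") (auto intro!: less_imp_le sum_nonneg)
  define N where "N = inverse_on \<Lambda> A"
  have N: "is_inverse_on \<Lambda> A N"
    unfolding N_def by (rule pd_inverse[OF fin]) (use symA qpos in auto)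
  define y where "y l = (\<Sum>m\<in>\<Lambda>. N l m * b_vec \<rho> W m)" for l
  have Ay: "(\<Sum>m\<in>\<Lambda>. A l m * y m) = b_vec \<rho> W l" if l: "l \<in> \<Lambda>" for l
  proof -
    have "(\<Sum>m\<in>\<Lambda>. A l m * y m) = (\<Sum>m\<in>\<Lambda>. \<Sum>k\<in>\<Lambda>. A l m * N m k * b_vec \<rho> W k)"
      by (simp add: y_def sum_distrib_left mult.assoc)
    also have "\<dots> = (\<Sum>k\<in>\<Lambda>. (\<Sum>m\<in>\<Lambda>. A l m * N m k) * b_vec \<rho> W k)"
      unfolding sum_distrib_right by (rule sum.swap)
    also have "\<dots> = (\<Sum>k\<in>\<Lambda>. id_mat l k * b_vec \<rho> W k)"
      using N l by (intro sum.cong refl) (simp add: is_inverse_on_def)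
    also have "\<dots> = b_vec \<rho> W l"
      using fin l by (simp add: id_mat_def diag_mat_def if_distrib[of "\<lambda>z. z * _"] cong: if_cong)
    finally show ?thesis .
  qed
  have S: "S_val \<Lambda> \<rho> \<beta> W = R_val \<rho> W - (\<Sum>l\<in>\<Lambda>. b_vec \<rho> W l * y l)"
    unfolding S_val_def Let_def y_def N_def A_def by (simp add: sum_distrib_left mult.assoc)
  have qy: "?q c y = (\<Sum>l\<in>\<Lambda>. c l * b_vec \<rho> W l)" for c
    using Ay by (simp add: mult.assoc flip: sum_distrib_left)
  have Q: "Qf \<Lambda> \<beta> c = R_val \<rho> W - 2 * ?q c y + ?q c c" for c
    unfolding Qf_expand[OF fin] qA qy by simp
  have sym2: "?q y c = ?q c y" for c
    by (subst sum.swap) (intro sum.cong refl, simp add: symA mult.commute mult.left_commute)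
  have "S_val \<Lambda> \<rho> \<beta> W = Qf \<Lambda> \<beta> y"
    unfolding S Q using qy[of y] by (simp add: mult.commute)
  moreover have "Qf \<Lambda> \<beta> y \<le> Qf \<Lambda> \<beta> c" for c
  proof -
    have "0 \<le> ?q (\<lambda>l. c l - y l) (\<lambda>l. c l - y l)" by (rule qnn)
    also have "\<dots> = ?q c c - ?q c y - ?q y c + ?q y y"
      unfolding sum_subtractf[symmetric] sum.distrib[symmetric]
      by (intro sum.cong refl) (simp add: algebra_simps)
    finally show ?thesis using Q[of c] Q[of y] sym2[of c] by linarith
  qed
  ultimately show ?thesis by metis
qed

text \<open>Completing squares with a free test function \<open>g\<close> is the dual form of the constraint on \<open>S\<close>.\<close>

lemma S_val_ge:
  assumes fin: "finite \<Lambda>" and \<beta>: "\<And>l. l \<in> \<Lambda> \<Longrightarrow> 0 < \<beta> l"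
    and g [measurable]: "g \<in> borel_measurable nu" and g2: "integrable nu (\<lambda>r. (g r)\<^sup>2)"
    and gW: "integrable nu (\<lambda>r. W (r\<^sup>2) * (g r)\<^sup>2)"
  shows "2 * (\<integral>r. r * g r \<partial>nu) - 2 * \<rho> * (\<integral>r. (g r)\<^sup>2 \<partial>nu) - (\<integral>r. W (r\<^sup>2) * (g r)\<^sup>2 \<partial>nu)
    - (\<Sum>l\<in>\<Lambda>. \<beta> l * (\<integral>r. phi l r * g r \<partial>nu)\<^sup>2) \<le> S_val \<Lambda> \<rho> \<beta> W"
proof -
  have "\<exists>y. S_val \<Lambda> \<rho> \<beta> W = Qf \<Lambda> \<beta> y \<and> (\<forall>c. S_val \<Lambda> \<rho> \<beta> W \<le> Qf \<Lambda> \<beta> c)"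
    by (rule S_val_variational) (use fin \<beta> in auto)
  then obtain y where y: "S_val \<Lambda> \<rho> \<beta> W = Qf \<Lambda> \<beta> y" by blast
  have rg: "integrable nu (\<lambda>r. r * g r)"
    by (rule integrable_mult_sq) (use g2 integrable_r_sq in auto)
  have pg: "integrable nu (\<lambda>r. phi l r * g r)" for l
    by (rule integrable_mult_sq) (use g2 integrable_phi_sq in auto)
  define h where "h r = r - (\<Sum>l\<in>\<Lambda>. y l * phi l r)" for r
  have h [measurable]: "h \<in> borel_measurable nu" unfolding h_def by measurable
  have hD: "integrable nu (\<lambda>r. (h r)\<^sup>2 / D_fun \<rho> W r)"
  proof (rule integrable_div_D)
    have "(h r)\<^sup>2 = r\<^sup>2 - (\<Sum>l\<in>\<Lambda>. (2 * y l) * (r * phi l r)) + (\<Sum>l\<in>\<Lambda>. \<Sum>m\<in>\<Lambda>. (y l * y m) * (phi l r * phi m r))" for r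
    proof -
      have "(h r)\<^sup>2 = r\<^sup>2 - 2 * r * (\<Sum>l\<in>\<Lambda>. y l * phi l r) + (\<Sum>l\<in>\<Lambda>. y l * phi l r) * (\<Sum>l\<in>\<Lambda>. y l * phi l r)"
        by (simp add: h_def power2_eq_square algebra_simps)
      also have "(\<Sum>l\<in>\<Lambda>. y l * phi l r) * (\<Sum>l\<in>\<Lambda>. y l * phi l r) = (\<Sum>l\<in>\<Lambda>. \<Sum>m\<in>\<Lambda>. y l * phi l r * (y m * phi m r))"
        by (rule sum_product)
      finally show ?thesis by (simp add: sum_distrib_left mult.assoc mult.left_commute)
    qed
    then show "integrable nu (\<lambda>r. (h r)\<^sup>2)"
      by (simp add: integrable_r_sq integrable_r_phi integrable_phi_phi)
  qed
  have I: "has_bochner_integral nu (\<lambda>r. 2 * (r * g r) - (\<Sum>l\<in>\<Lambda>. (2 * y l) * (phi l r * g r)) - 2 * \<rho> * (g r)\<^sup>2 - W (r\<^sup>2) * (g r)\<^sup>2)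
    (2 * (\<integral>r. r * g r \<partial>nu) - (\<Sum>l\<in>\<Lambda>. (2 * y l) * (\<integral>r. phi l r * g r \<partial>nu)) - 2 * \<rho> * (\<integral>r. (g r)\<^sup>2 \<partial>nu) - (\<integral>r. W (r\<^sup>2) * (g r)\<^sup>2 \<partial>nu))"
    by (intro has_bochner_integral_diff has_bochner_integral_mult_right has_bochner_integral_sum
        has_bochner_integral_integrable rg pg g2 gW)
  have "2 * (\<integral>r. r * g r \<partial>nu) - (\<Sum>l\<in>\<Lambda>. (2 * y l) * (\<integral>r. phi l r * g r \<partial>nu)) - 2 * \<rho> * (\<integral>r. (g r)\<^sup>2 \<partial>nu) - (\<integral>r. W (r\<^sup>2) * (g r)\<^sup>2 \<partial>nu)
    \<le> (\<integral>r. (h r)\<^sup>2 / D_fun \<rho> W r \<partial>nu)"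
    unfolding has_bochner_integral_integral_eq[OF I, symmetric]
  proof (rule integral_mono[OF integrable.intros[OF I] hD])
    fix r :: real
    have D: "0 < D_fun \<rho> W r" by (rule D_gt)
    have "0 \<le> (h r - D_fun \<rho> W r * g r)\<^sup>2 / D_fun \<rho> W r" using D by simp
    also have "\<dots> = (h r)\<^sup>2 / D_fun \<rho> W r - 2 * (h r * g r) + D_fun \<rho> W r * (g r)\<^sup>2"
      using D by (simp add: field_simps power2_eq_square)
    finally have "2 * (h r * g r) - D_fun \<rho> W r * (g r)\<^sup>2 \<le> (h r)\<^sup>2 / D_fun \<rho> W r" by simp
    moreover have "2 * (h r * g r) = 2 * (r * g r) - (\<Sum>l\<in>\<Lambda>. (2 * y l) * (phi l r * g r))"
      by (simp add: h_def algebra_simps sum_distrib_left sum_distrib_right)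
    moreover have "D_fun \<rho> W r * (g r)\<^sup>2 = 2 * \<rho> * (g r)\<^sup>2 + W (r\<^sup>2) * (g r)\<^sup>2"
      by (simp add: D_fun_def algebra_simps)
    ultimately show "2 * (r * g r) - (\<Sum>l\<in>\<Lambda>. (2 * y l) * (phi l r * g r)) - 2 * \<rho> * (g r)\<^sup>2 - W (r\<^sup>2) * (g r)\<^sup>2
      \<le> (h r)\<^sup>2 / D_fun \<rho> W r" by linarith
  qed
  moreover have "(\<Sum>l\<in>\<Lambda>. (2 * y l) * (\<integral>r. phi l r * g r \<partial>nu)) - (\<Sum>l\<in>\<Lambda>. \<beta> l * (\<integral>r. phi l r * g r \<partial>nu)\<^sup>2)
    \<le> (\<Sum>l\<in>\<Lambda>. (y l)\<^sup>2 / \<beta> l)"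
    unfolding sum_subtractf[symmetric]
  proof (rule sum_mono)
    fix l assume "l \<in> \<Lambda>"
    then have b: "0 < \<beta> l" by (rule \<beta>)
    have "(2 * y l) * z - \<beta> l * z\<^sup>2 \<le> (y l)\<^sup>2 / \<beta> l" for z
    proof -
      have "0 \<le> (y l - \<beta> l * z)\<^sup>2 / \<beta> l" using b by simp
      also have "\<dots> = (y l)\<^sup>2 / \<beta> l - (2 * y l) * z + \<beta> l * z\<^sup>2"
        using b by (simp add: field_simps power2_eq_square)
      finally show ?thesis by simp
    qed
    then show "(2 * y l) * (\<integral>r. phi l r * g r \<partial>nu) - \<beta> l * (\<integral>r. phi l r * g r \<partial>nu)\<^sup>2 \<le> (y l)\<^sup>2 / \<beta> l" .
  qed
  ultimately show ?thesis unfolding y Qf_def h_def by linarith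
qed

text \<open>A Bessel inequality in a weighted space. With \<open>V\<close> the \<beta>-weighted
  expansion built from the coefficients of \<open>f\<close>, integrate 2 f V \<le> W f^2 + V^2 / W;
  the matrix bound says that the integral of V^2 / W is at most the sum to be estimated, which
  therefore cancels once.\<close>

lemma M_mat_test:
  assumes fin: "finite I" and \<beta>: "\<And>l. l \<in> I \<Longrightarrow> 0 < \<beta> l"
    and int: "\<And>l m. l \<in> I \<Longrightarrow> m \<in> I \<Longrightarrow> integrable nu (M_integrand W p q l m)"
    and le: "loewner_le_on I (M_mat \<beta> W p q) id_mat"
    and f [measurable]: "f \<in> borel_measurable nu" and f2: "integrable nu (\<lambda>r. (f r)\<^sup>2)"
    and fW: "integrable nu (\<lambda>r. W (r\<^sup>2) * (f r)\<^sup>2)"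
  shows "(\<Sum>l\<in>I. \<beta> l * (\<integral>r. f r * e_fun (l + 1 - p) (l - q) r \<partial>nu)\<^sup>2) \<le> (\<integral>r. W (r\<^sup>2) * (f r)\<^sup>2 \<partial>nu)"
proof -
  define v where "v l = e_fun (l + 1 - p) (l - q)" for l
  define y where "y l = (\<integral>r. f r * v l r \<partial>nu)" for l
  have v [measurable]: "v l \<in> borel_measurable nu" for l unfolding v_def by measurable
  have fv: "integrable nu (\<lambda>r. f r * v l r)" for l
    by (rule integrable_mult_sq) (use f2 integrable_e_fun_sq in \<open>auto simp: v_def\<close>)
  define V where "V r = (\<Sum>l\<in>I. (\<beta> l * y l) * v l r)" for r
  have V [measurable]: "V \<in> borel_measurable nu" unfolding V_def by measurable
  define J where "J l m = (\<integral>r. M_integrand W p q l m r \<partial>nu)" for l m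
  have J: "has_bochner_integral nu (M_integrand W p q l m) (J l m)" if "l \<in> I" "m \<in> I" for l m
    unfolding J_def by (intro has_bochner_integral_integrable int that)
  have VW: "(V r)\<^sup>2 / W (r\<^sup>2) = (\<Sum>l\<in>I. \<Sum>m\<in>I. (\<beta> l * y l * (\<beta> m * y m)) * M_integrand W p q l m r)" for r
    unfolding V_def power2_eq_square sum_product sum_divide_distrib M_integrand_def v_def
    by (intro sum.cong refl) simp
  have IV: "has_bochner_integral nu (\<lambda>r. (V r)\<^sup>2 / W (r\<^sup>2)) (\<Sum>l\<in>I. \<Sum>m\<in>I. (\<beta> l * y l * (\<beta> m * y m)) * J l m)"
    unfolding VW by (intro has_bochner_integral_sum has_bochner_integral_mult_right J)
  have If: "has_bochner_integral nu (\<lambda>r. f r * V r) (\<Sum>l\<in>I. (\<beta> l * y l) * y l)"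
  proof -
    have "has_bochner_integral nu (\<lambda>r. \<Sum>l\<in>I. (\<beta> l * y l) * (f r * v l r)) (\<Sum>l\<in>I. (\<beta> l * y l) * y l)"
      unfolding y_def by (intro has_bochner_integral_sum has_bochner_integral_mult_right has_bochner_integral_integrable fv)
    then show ?thesis by (simp add: V_def sum_distrib_left mult.left_commute)
  qed
  have "2 * (\<Sum>l\<in>I. (\<beta> l * y l) * y l) \<le> (\<integral>r. W (r\<^sup>2) * (f r)\<^sup>2 \<partial>nu) + (\<Sum>l\<in>I. \<Sum>m\<in>I. (\<beta> l * y l * (\<beta> m * y m)) * J l m)"
  proof -
    have "(\<integral>r. 2 * (f r * V r) \<partial>nu) \<le> (\<integral>r. W (r\<^sup>2) * (f r)\<^sup>2 + (V r)\<^sup>2 / W (r\<^sup>2) \<partial>nu)"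
    proof (rule integral_mono)
      show "integrable nu (\<lambda>r. 2 * (f r * V r))" using If by (simp add: has_bochner_integral_iff)
      show "integrable nu (\<lambda>r. W (r\<^sup>2) * (f r)\<^sup>2 + (V r)\<^sup>2 / W (r\<^sup>2))" using IV fW by (simp add: has_bochner_integral_iff)
      fix r :: real
      have w: "0 < W (r\<^sup>2)" by (rule W_pos) simp
      have "0 \<le> (V r - W (r\<^sup>2) * f r)\<^sup>2 / W (r\<^sup>2)" using w by simp
      also have "\<dots> = W (r\<^sup>2) * (f r)\<^sup>2 + (V r)\<^sup>2 / W (r\<^sup>2) - 2 * (f r * V r)"
        using w by (simp add: field_simps power2_eq_square)
      finally show "2 * (f r * V r) \<le> W (r\<^sup>2) * (f r)\<^sup>2 + (V r)\<^sup>2 / W (r\<^sup>2)" by simp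
    qed
    then show ?thesis using If IV fW by (simp add: has_bochner_integral_iff)
  qed
  also have "(\<Sum>l\<in>I. \<Sum>m\<in>I. (\<beta> l * y l * (\<beta> m * y m)) * J l m) \<le> (\<Sum>l\<in>I. \<beta> l * (y l)\<^sup>2)"
  proof -
    \<comment> \<open>The square roots already contained in \<open>M_mat\<close> and those of
      \<open>x\<close> combine to the weights \<beta> of \<open>V\<close>.\<close>
    define x where "x l = sqrt (\<beta> l) * y l" for l
    have x: "x l * M_mat \<beta> W p q l m * x m = (\<beta> l * y l * (\<beta> m * y m)) * J l m" if "l \<in> I" "m \<in> I" for l m
    proof -
      have s: "sqrt (\<beta> l) * sqrt (\<beta> l) = \<beta> l" "sqrt (\<beta> m) * sqrt (\<beta> m) = \<beta> m"
        using \<beta>[OF that(1)] \<beta>[OF that(2)] by simp_all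
      have "x l * M_mat \<beta> W p q l m * x m = (sqrt (\<beta> l) * sqrt (\<beta> l)) * (sqrt (\<beta> m) * sqrt (\<beta> m)) * y l * y m * J l m"
        by (simp add: x_def M_mat_def J_def real_sqrt_mult)
      then show ?thesis unfolding s by simp
    qed
    have "0 \<le> (\<Sum>i\<in>I. \<Sum>j\<in>I. x i * (id_mat i j - M_mat \<beta> W p q i j) * x j)"
      using le by (simp add: loewner_le_on_def psd_on_def)
    also have "\<dots> = (\<Sum>i\<in>I. \<Sum>j\<in>I. (if i = j then \<beta> i * (y i)\<^sup>2 else 0) - (\<beta> i * y i * (\<beta> j * y j)) * J i j)"
    proof (intro sum.cong refl)
      fix i j assume ij: "i \<in> I" "j \<in> I"
      have "x i * id_mat i j * x j = (if i = j then \<beta> i * (y i)\<^sup>2 else 0)"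
        using \<beta>[OF ij(1)] by (auto simp: id_mat_def diag_mat_def x_def power2_eq_square)
      then show "x i * (id_mat i j - M_mat \<beta> W p q i j) * x j
        = (if i = j then \<beta> i * (y i)\<^sup>2 else 0) - (\<beta> i * y i * (\<beta> j * y j)) * J i j"
        using x[OF ij] by (simp add: algebra_simps)
    qed
    also have "\<dots> = (\<Sum>i\<in>I. \<beta> i * (y i)\<^sup>2) - (\<Sum>l\<in>I. \<Sum>m\<in>I. (\<beta> l * y l * (\<beta> m * y m)) * J l m)"
      using fin by (simp add: sum_subtractf)
    finally show ?thesis by simp
  qed
  finally show ?thesis unfolding y_def[symmetric] v_def[symmetric]
    by (simp add: power2_eq_square mult.assoc)
qed

end

text \<open>Weak duality: the constraint on S is tested with a multiple of \<open>g\<close>, the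
  matrix constraint with \<open>f\<close>, and the terms with \<beta> cancel by the comparison of
  coefficients.\<close>

theorem upper_bound_by_test_functions:
  fixes g f :: "real \<Rightarrow> real"
  assumes adm: "admissible \<Lambda> \<rho> \<beta> W"
    and g [measurable]: "g \<in> borel_measurable nu" and f [measurable]: "f \<in> borel_measurable nu"
    and gf: "\<And>r. 0 \<le> r \<Longrightarrow> (g r)\<^sup>2 + (f r)\<^sup>2 \<le> 1"
    and df: "\<And>l. 1 \<le> l \<Longrightarrow> (\<integral>r. phi l r * g r \<partial>nu)\<^sup>2 \<le> (\<integral>r. f r * e_fun (l - 1) (l - 1) r \<partial>nu)\<^sup>2"
    and m: "m = (\<integral>r. r * g r \<partial>nu)" "0 < m"
    and n: "2 * (\<integral>r. (g r)\<^sup>2 \<partial>nu) \<le> 1 + m\<^sup>2"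
  shows "(1 - \<rho>) / (\<rho> + mu_val W) \<le> 1 / m\<^sup>2"
proof -
  have fin: "finite \<Lambda>" and l1: "\<And>l. l \<in> \<Lambda> \<Longrightarrow> 1 \<le> l" and rho01: "0 < \<rho>" "\<rho> < 1"
    and \<beta>: "\<And>l. l \<in> \<Lambda> \<Longrightarrow> 0 < \<beta> l" and Wp: "\<And>t. 0 \<le> t \<Longrightarrow> 0 < W t" and Wi: "integrable nu (\<lambda>r. W (r\<^sup>2))"
    and Mi: "\<And>p q l m. l \<in> idx \<Lambda> p q \<Longrightarrow> m \<in> idx \<Lambda> p q \<Longrightarrow> integrable nu (M_integrand W p q l m)"
    and Ml: "\<And>p q. idx \<Lambda> p q \<noteq> {} \<Longrightarrow> loewner_le_on (idx \<Lambda> p q) (M_mat \<beta> W p q) id_mat"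
    and S: "S_val \<Lambda> \<rho> \<beta> W \<le> 1"
    using adm unfolding admissible_def by auto
  interpret weight \<rho> W by unfold_locales (use rho01 Wp Wi in auto)
  have b1: "integrable nu (\<lambda>r. w r * (k r)\<^sup>2)"
    if w: "integrable nu w" and k: "k \<in> borel_measurable nu" "\<And>r. 0 \<le> r \<Longrightarrow> (k r)\<^sup>2 \<le> 1" for w k :: "real \<Rightarrow> real"
  proof (rule Bochner_Integration.integrable_bound[OF w])
    show "(\<lambda>r. w r * (k r)\<^sup>2) \<in> borel_measurable nu"
      using k(1) borel_measurable_integrable[OF w] by measurable
    show "AE r in nu. norm (w r * (k r)\<^sup>2) \<le> norm (w r)"
      by (rule AE_I2) (use k(2) in \<open>simp add: abs_mult mult_left_le\<close>)
  qed
  have g1: "(g r)\<^sup>2 \<le> 1" and f1: "(f r)\<^sup>2 \<le> 1" if "0 \<le> r" for r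
    using gf[OF that] zero_le_power2[of "g r"] zero_le_power2[of "f r"] by linarith+
  have one: "integrable nu (\<lambda>r. 1 :: real)"
    using nu_moment[of 0 0] by (simp add: has_bochner_integral_iff)
  have g2: "integrable nu (\<lambda>r. (g r)\<^sup>2)" and f2: "integrable nu (\<lambda>r. (f r)\<^sup>2)"
    using b1[OF one g] b1[OF one f] g1 f1 by auto
  have gW: "integrable nu (\<lambda>r. W (r\<^sup>2) * (g r)\<^sup>2)" and fW: "integrable nu (\<lambda>r. W (r\<^sup>2) * (f r)\<^sup>2)"
    using b1[OF W_int g] b1[OF W_int f] g1 f1 by auto
  define n where "n = (\<integral>r. (g r)\<^sup>2 \<partial>nu)"
  define d where "d l = (\<integral>r. phi l r * g r \<partial>nu)" for l
  define a where "a = (\<integral>r. W (r\<^sup>2) * (g r)\<^sup>2 \<partial>nu)"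
  define b where "b = (\<integral>r. W (r\<^sup>2) * (f r)\<^sup>2 \<partial>nu)"
  have ab: "a + b \<le> mu_val W"
    unfolding a_def b_def mu_val_def Bochner_Integration.integral_add[OF gW fW, symmetric]
  proof (rule integral_mono)
    fix r assume "r \<in> space nu"
    then have r: "0 \<le> r" by simp
    have "W (r\<^sup>2) * ((g r)\<^sup>2 + (f r)\<^sup>2) \<le> W (r\<^sup>2) * 1"
      using gf[OF r] W_pos[of "r\<^sup>2"] by (intro mult_left_mono) auto
    then show "W (r\<^sup>2) * (g r)\<^sup>2 + W (r\<^sup>2) * (f r)\<^sup>2 \<le> W (r\<^sup>2)" by (simp add: algebra_simps)
  qed (use gW fW W_int in auto)
  \<comment> \<open>For p = 2 and q = 1 both conditions of \<open>idx\<close> say 1 \<le> l.\<close>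
  have idx: "idx \<Lambda> 2 1 = \<Lambda>" using l1 by (auto simp: idx_def)
  have \<beta>d: "(\<Sum>l\<in>\<Lambda>. \<beta> l * (d l)\<^sup>2) \<le> b"
  proof (cases "\<Lambda> = {}")
    case True
    have "0 \<le> b" unfolding b_def by (rule Bochner_Integration.integral_nonneg) (simp add: W_pos less_imp_le)
    then show ?thesis using True by simp
  next
    case False
    have "(\<Sum>l\<in>\<Lambda>. \<beta> l * (d l)\<^sup>2) \<le> (\<Sum>l\<in>\<Lambda>. \<beta> l * (\<integral>r. f r * e_fun (l + 1 - 2) (l - 1) r \<partial>nu)\<^sup>2)"
      using df l1 \<beta> unfolding d_def by (intro sum_mono mult_left_mono) (auto simp: less_imp_le)
    also have "\<dots> \<le> b"
      unfolding b_def
      by (rule M_mat_test[OF fin \<beta> _ _ f f2 fW]) (use Mi[of _ 2 1] Ml[of 2 1] idx False in auto)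
    finally show ?thesis .
  qed
  \<comment> \<open>Division by \<open>m\<close> makes the linear term equal to 2. The best multiple
    of \<open>g\<close> would lead to the same inequality below.\<close>
  have "2 * (\<integral>r. r * (g r / m) \<partial>nu) - 2 * \<rho> * (\<integral>r. (g r / m)\<^sup>2 \<partial>nu) - (\<integral>r. W (r\<^sup>2) * (g r / m)\<^sup>2 \<partial>nu)
    - (\<Sum>l\<in>\<Lambda>. \<beta> l * (\<integral>r. phi l r * (g r / m) \<partial>nu)\<^sup>2) \<le> S_val \<Lambda> \<rho> \<beta> W"
    by (rule S_val_ge[OF fin \<beta>]) (use g2 gW in \<open>auto simp: power_divide\<close>)
  also have "\<dots> \<le> 1" by (rule S)
  finally have "2 - 2 * \<rho> * (n / m\<^sup>2) - a / m\<^sup>2 - (\<Sum>l\<in>\<Lambda>. \<beta> l * (d l)\<^sup>2) / m\<^sup>2 \<le> 1"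
    using m by (simp add: power_divide n_def a_def d_def sum_divide_distrib)
  then have "1 \<le> (2 * \<rho> * n + a + (\<Sum>l\<in>\<Lambda>. \<beta> l * (d l)\<^sup>2)) / m\<^sup>2"
    by (simp add: add_divide_distrib)
  then have "m\<^sup>2 \<le> 2 * \<rho> * n + a + (\<Sum>l\<in>\<Lambda>. \<beta> l * (d l)\<^sup>2)"
    using m(2) by (simp add: pos_le_divide_eq)
  then have mu: "m\<^sup>2 - 2 * \<rho> * n \<le> mu_val W" using ab \<beta>d by linarith
  \<comment> \<open>Here \<rho> separates: the inequality becomes (1 - \<rho>) m^2 \<le> \<rho> +
    \<mu>.\<close>
  have "2 * n * \<rho> \<le> (1 + m\<^sup>2) * \<rho>" using n rho01 by (intro mult_right_mono) (auto simp: n_def)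
  then have "(1 - \<rho>) * m\<^sup>2 \<le> \<rho> + mu_val W" using mu by (simp add: algebra_simps)
  moreover have "0 < (1 - \<rho>) * m\<^sup>2" by (intro mult_pos_pos) (use rho01 m(2) in auto)
  ultimately have "0 < \<rho> + mu_val W" "(1 - \<rho>) \<le> (\<rho> + mu_val W) / m\<^sup>2"
    using m(2) by (auto simp: pos_le_divide_eq)
  then show ?thesis by (simp add: pos_divide_le_eq)
qed

section \<open>Sums of exponentials as test functions\<close>

definition expsum :: "'j set \<Rightarrow> ('j \<Rightarrow> real) \<Rightarrow> ('j \<Rightarrow> real) \<Rightarrow> real \<Rightarrow> real" where
  "expsum J a s t = (\<Sum>j\<in>J. a j * exp (- (s j * t)))"

lemma expsum_phi:
  assumes "\<And>j. j \<in> J \<Longrightarrow> 0 \<le> s j"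
  shows "has_bochner_integral nu (\<lambda>r. phi l r * (r * expsum J a s (r\<^sup>2)))
    ((-1) ^ l * sqrt (real (l + 1)) * (\<Sum>j\<in>J. a j * (1 / (1 + s j))\<^sup>2 * (s j / (1 + s j)) ^ l))"
proof -
  have f: "fact (l + 1) / fact l = (sqrt (real (l + 1)))\<^sup>2" by simp
  have "has_bochner_integral nu
      (\<lambda>r. \<Sum>j\<in>J. ((-1) ^ l / sqrt (real (l + 1)) * a j) * ((r\<^sup>2) ^ 1 * lag 1 l (r\<^sup>2) * exp (- (s j * r\<^sup>2))))
      (\<Sum>j\<in>J. ((-1) ^ l / sqrt (real (l + 1)) * a j) * (fact (l + 1) / fact l * (1 / (1 + s j)) ^ Suc 1 * (s j / (1 + s j)) ^ l))"
    by (intro has_bochner_integral_sum has_bochner_integral_mult_right nu_lag) (use assms in force)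
  also have "(\<lambda>r. \<Sum>j\<in>J. ((-1) ^ l / sqrt (real (l + 1)) * a j) * ((r\<^sup>2) ^ 1 * lag 1 l (r\<^sup>2) * exp (- (s j * r\<^sup>2))))
    = (\<lambda>r. phi l r * (r * expsum J a s (r\<^sup>2)))"
    unfolding phi_lag expsum_def sum_distrib_left
    by (intro ext sum.cong refl) (simp add: power2_eq_square)
  also have "(\<Sum>j\<in>J. ((-1) ^ l / sqrt (real (l + 1)) * a j) * (fact (l + 1) / fact l * (1 / (1 + s j)) ^ Suc 1 * (s j / (1 + s j)) ^ l))
    = (-1) ^ l * sqrt (real (l + 1)) * (\<Sum>j\<in>J. a j * (1 / (1 + s j))\<^sup>2 * (s j / (1 + s j)) ^ l)"
    unfolding f sum_distrib_left
  proof (intro sum.cong refl)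
    fix j
    have "u / c * x * (c\<^sup>2 * y ^ Suc 1 * z) = u * c * (x * y\<^sup>2 * z)" if "c \<noteq> 0" for u c x y z :: real
      using that by (simp add: power2_eq_square)
    note * = this
    show "((-1) ^ l / sqrt (real (l + 1)) * a j) * ((sqrt (real (l + 1)))\<^sup>2 * (1 / (1 + s j)) ^ Suc 1 * (s j / (1 + s j)) ^ l)
      = (-1) ^ l * sqrt (real (l + 1)) * (a j * (1 / (1 + s j))\<^sup>2 * (s j / (1 + s j)) ^ l)"
      by (rule *) simp
  qed
  finally show ?thesis .
qed

lemma expsum_e_fun:
  assumes "\<And>j. j \<in> J \<Longrightarrow> 0 \<le> s j"
  shows "has_bochner_integral nu (\<lambda>r. expsum J a s (r\<^sup>2) * e_fun n n r)
    ((-1) ^ n * (\<Sum>j\<in>J. a j * (1 / (1 + s j)) * (s j / (1 + s j)) ^ n))"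
proof -
  have "has_bochner_integral nu
      (\<lambda>r. \<Sum>j\<in>J. ((-1) ^ n * a j) * ((r\<^sup>2) ^ 0 * lag 0 n (r\<^sup>2) * exp (- (s j * r\<^sup>2))))
      (\<Sum>j\<in>J. ((-1) ^ n * a j) * (fact (n + 0) / fact n * (1 / (1 + s j)) ^ Suc 0 * (s j / (1 + s j)) ^ n))"
    by (intro has_bochner_integral_sum has_bochner_integral_mult_right nu_lag) (use assms in force)
  also have "(\<lambda>r. \<Sum>j\<in>J. ((-1) ^ n * a j) * ((r\<^sup>2) ^ 0 * lag 0 n (r\<^sup>2) * exp (- (s j * r\<^sup>2))))
    = (\<lambda>r. expsum J a s (r\<^sup>2) * e_fun n n r)"
    unfolding e_fun_eq_lag expsum_def sum_distrib_right by (intro ext sum.cong refl) simp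
  also have "(\<Sum>j\<in>J. ((-1) ^ n * a j) * (fact (n + 0) / fact n * (1 / (1 + s j)) ^ Suc 0 * (s j / (1 + s j)) ^ n))
    = (-1) ^ n * (\<Sum>j\<in>J. a j * (1 / (1 + s j)) * (s j / (1 + s j)) ^ n)"
    unfolding sum_distrib_left by (intro sum.cong refl) simp
  finally show ?thesis .
qed

lemma expsum_sq:
  "(expsum J a s t)\<^sup>2 = (\<Sum>i\<in>J. \<Sum>j\<in>J. (a i * a j) * exp (- ((s i + s j) * t)))"
  unfolding expsum_def power2_eq_square sum_product
  by (intro sum.cong refl) (simp add: algebra_simps flip: exp_add)

lemma expsum_sq_moment:
  assumes "\<And>j. j \<in> J \<Longrightarrow> 0 \<le> s j"
  shows "has_bochner_integral nu (\<lambda>r. (r\<^sup>2) ^ k * (expsum J a s (r\<^sup>2))\<^sup>2)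
    (\<Sum>i\<in>J. \<Sum>j\<in>J. (a i * a j) * (fact k / (1 + (s i + s j)) ^ Suc k))"
proof -
  have pos: "- 1 < s i + s j" if "i \<in> J" "j \<in> J" for i j
    using assms[OF that(1)] assms[OF that(2)] by linarith
  have "has_bochner_integral nu
      (\<lambda>r. \<Sum>i\<in>J. \<Sum>j\<in>J. (a i * a j) * ((r\<^sup>2) ^ k * exp (- ((s i + s j) * r\<^sup>2))))
      (\<Sum>i\<in>J. \<Sum>j\<in>J. (a i * a j) * (fact k / (1 + (s i + s j)) ^ Suc k))"
    by (intro has_bochner_integral_sum has_bochner_integral_mult_right nu_moment pos)
  then show ?thesis unfolding expsum_sq by (simp add: sum_distrib_left mult.left_commute)
qed

text \<open>The bridge between geometric series and moments: summing powers of the product of two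
  ratios produces the factor 1 / (1 + s + t) of the integral of a product of exponentials.\<close>

lemma geometric_product:
  assumes "0 \<le> (s :: real)" "0 \<le> t"
  shows "1 - s / (1 + s) * (t / (1 + t)) = (1 + (s + t)) * (1 / (1 + s)) * (1 / (1 + t))"
    and "norm (s / (1 + s) * (t / (1 + t))) < 1"
proof -
  have p: "1 + s \<noteq> 0" "1 + t \<noteq> 0" using assms by auto
  then show "1 - s / (1 + s) * (t / (1 + t)) = (1 + (s + t)) * (1 / (1 + s)) * (1 / (1 + t))"
    by (simp add: divide_simps) (simp add: algebra_simps)
  have "s / (1 + s) * (t / (1 + t)) < 1 * 1"
    by (intro mult_strict_mono) (use assms in auto)
  moreover have "0 \<le> s / (1 + s) * (t / (1 + t))" using assms by simp
  ultimately show "norm (s / (1 + s) * (t / (1 + t))) < 1" by (simp only: real_norm_def abs_of_nonneg)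
qed

text \<open>For exponential sums Parseval's identity is the explicit summation of a geometric series.\<close>

lemma expsum_parseval_0:
  assumes s: "\<And>j. j \<in> J \<Longrightarrow> 0 \<le> s j"
  shows "(\<lambda>n. (\<Sum>j\<in>J. a j * (1 / (1 + s j)) * (s j / (1 + s j)) ^ n)\<^sup>2)
    sums (\<integral>r. (expsum J a s (r\<^sup>2))\<^sup>2 \<partial>nu)"
proof -
  have i: "(\<integral>r. (expsum J a s (r\<^sup>2))\<^sup>2 \<partial>nu) = (\<Sum>i\<in>J. \<Sum>j\<in>J. (a i * a j) * (1 / (1 + (s i + s j))))"
    using has_bochner_integral_integral_eq[OF expsum_sq_moment[of J s 0 a, OF s]] by simp
  have "(\<lambda>n. \<Sum>i\<in>J. \<Sum>j\<in>J. (a i * (1 / (1 + s i)) * (a j * (1 / (1 + s j)))) * (s i / (1 + s i) * (s j / (1 + s j))) ^ n)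
    sums (\<Sum>i\<in>J. \<Sum>j\<in>J. (a i * (1 / (1 + s i)) * (a j * (1 / (1 + s j)))) * (1 / (1 - s i / (1 + s i) * (s j / (1 + s j)))))"
    by (intro sums_sum sums_mult geometric_sums geometric_product) (use s in auto)
  also have "(\<Sum>i\<in>J. \<Sum>j\<in>J. (a i * (1 / (1 + s i)) * (a j * (1 / (1 + s j)))) * (1 / (1 - s i / (1 + s i) * (s j / (1 + s j)))))
    = (\<Sum>i\<in>J. \<Sum>j\<in>J. (a i * a j) * (1 / (1 + (s i + s j))))"
  proof (intro sum.cong refl)
    fix i j assume "i \<in> J" "j \<in> J"
    then have p: "0 \<le> s i" "0 \<le> s j" using s by auto
    then have "1 + s i \<noteq> 0" "1 + s j \<noteq> 0" "1 + (s i + s j) \<noteq> 0" by auto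
    then show "(a i * (1 / (1 + s i)) * (a j * (1 / (1 + s j)))) * (1 / (1 - s i / (1 + s i) * (s j / (1 + s j))))
      = (a i * a j) * (1 / (1 + (s i + s j)))"
      unfolding geometric_product(1)[OF p] by simp
  qed
  also have "(\<lambda>n. \<Sum>i\<in>J. \<Sum>j\<in>J. (a i * (1 / (1 + s i)) * (a j * (1 / (1 + s j)))) * (s i / (1 + s i) * (s j / (1 + s j))) ^ n)
    = (\<lambda>n. (\<Sum>j\<in>J. a j * (1 / (1 + s j)) * (s j / (1 + s j)) ^ n)\<^sup>2)"
    unfolding power2_eq_square sum_product
    by (intro ext sum.cong refl) (simp only: power_mult_distrib ac_simps)
  finally show ?thesis unfolding i .
qed

text \<open>The squared coefficients in the system \<open>phi\<close> carry a factor
  \<open>n + 1\<close>, so the derivative of the geometric series appears; it matches the first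
  moment, which has a squared denominator.\<close>

lemma expsum_parseval_1:
  assumes s: "\<And>j. j \<in> J \<Longrightarrow> 0 \<le> s j"
  shows "(\<lambda>n. real (n + 1) * (\<Sum>j\<in>J. a j * (1 / (1 + s j))\<^sup>2 * (s j / (1 + s j)) ^ n)\<^sup>2)
    sums (\<integral>r. (r * expsum J a s (r\<^sup>2))\<^sup>2 \<partial>nu)"
proof -
  have i: "(\<integral>r. (r * expsum J a s (r\<^sup>2))\<^sup>2 \<partial>nu) = (\<Sum>i\<in>J. \<Sum>j\<in>J. (a i * a j) * (1 / (1 + (s i + s j)))\<^sup>2)"
  proof -
    have "(\<lambda>r. (r * expsum J a s (r\<^sup>2))\<^sup>2) = (\<lambda>r. (r\<^sup>2) ^ 1 * (expsum J a s (r\<^sup>2))\<^sup>2)"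
      by (simp add: power_mult_distrib)
    then show ?thesis
      using has_bochner_integral_integral_eq[OF expsum_sq_moment[of J s 1 a, OF s]]
      by (simp add: power_divide numeral_2_eq_2)
  qed
  have "(\<lambda>n. \<Sum>i\<in>J. \<Sum>j\<in>J. (a i * (1 / (1 + s i))\<^sup>2 * (a j * (1 / (1 + s j))\<^sup>2)) * (of_nat (Suc n) * (s i / (1 + s i) * (s j / (1 + s j))) ^ n))
    sums (\<Sum>i\<in>J. \<Sum>j\<in>J. (a i * (1 / (1 + s i))\<^sup>2 * (a j * (1 / (1 + s j))\<^sup>2)) * (1 / (1 - s i / (1 + s i) * (s j / (1 + s j)))\<^sup>2))"
    by (intro sums_sum sums_mult geometric_deriv_sums geometric_product) (use s in auto)
  also have "(\<Sum>i\<in>J. \<Sum>j\<in>J. (a i * (1 / (1 + s i))\<^sup>2 * (a j * (1 / (1 + s j))\<^sup>2)) * (1 / (1 - s i / (1 + s i) * (s j / (1 + s j)))\<^sup>2))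
    = (\<Sum>i\<in>J. \<Sum>j\<in>J. (a i * a j) * (1 / (1 + (s i + s j)))\<^sup>2)"
  proof (intro sum.cong refl)
    fix i j assume "i \<in> J" "j \<in> J"
    then have p: "0 \<le> s i" "0 \<le> s j" using s by auto
    then have "1 + s i \<noteq> 0" "1 + s j \<noteq> 0" "1 + (s i + s j) \<noteq> 0" by auto
    then show "(a i * (1 / (1 + s i))\<^sup>2 * (a j * (1 / (1 + s j))\<^sup>2)) * (1 / (1 - s i / (1 + s i) * (s j / (1 + s j)))\<^sup>2)
      = (a i * a j) * (1 / (1 + (s i + s j)))\<^sup>2"
      unfolding geometric_product(1)[OF p] by (simp add: power_mult_distrib power_divide)
  qed
  also have "(\<lambda>n. \<Sum>i\<in>J. \<Sum>j\<in>J. (a i * (1 / (1 + s i))\<^sup>2 * (a j * (1 / (1 + s j))\<^sup>2)) * (of_nat (Suc n) * (s i / (1 + s i) * (s j / (1 + s j))) ^ n))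
    = (\<lambda>n. real (n + 1) * (\<Sum>j\<in>J. a j * (1 / (1 + s j))\<^sup>2 * (s j / (1 + s j)) ^ n)\<^sup>2)"
  proof
    fix n
    have "(\<Sum>j\<in>J. a j * (1 / (1 + s j))\<^sup>2 * (s j / (1 + s j)) ^ n)\<^sup>2
      = (\<Sum>i\<in>J. \<Sum>j\<in>J. a i * (1 / (1 + s i))\<^sup>2 * (s i / (1 + s i)) ^ n * (a j * (1 / (1 + s j))\<^sup>2 * (s j / (1 + s j)) ^ n))"
      unfolding power2_eq_square[of "sum _ _"] by (rule sum_product)
    then show "(\<Sum>i\<in>J. \<Sum>j\<in>J. (a i * (1 / (1 + s i))\<^sup>2 * (a j * (1 / (1 + s j))\<^sup>2)) * (of_nat (Suc n) * (s i / (1 + s i) * (s j / (1 + s j))) ^ n))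
      = real (n + 1) * (\<Sum>j\<in>J. a j * (1 / (1 + s j))\<^sup>2 * (s j / (1 + s j)) ^ n)\<^sup>2"
      by (simp only: sum_distrib_left) (intro sum.cong refl, simp only: power_mult_distrib Suc_eq_plus1 ac_simps)
  qed
  finally show ?thesis unfolding i .
qed

text \<open>The coefficient of order l + 1 of \<open>g\<close> is compared with that of order
  \<open>l\<close> of \<open>f\<close>. Through the two Parseval identities this comparison also
  yields the norm condition on \<open>g\<close>, so only it and the pointwise inequality need
  certification.\<close>

theorem upper_bound_by_expsums:
  assumes adm: "admissible \<Lambda> \<rho> \<beta> W"
    and s: "\<And>j. j \<in> J \<Longrightarrow> 0 \<le> s j" and u: "\<And>j. j \<in> I \<Longrightarrow> 0 \<le> u j"
    and le1: "\<And>t. 0 \<le> t \<Longrightarrow> t * (expsum J a s t)\<^sup>2 + (expsum I b u t)\<^sup>2 \<le> 1"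
    and coeff: "\<And>l. real (l + 2) * (\<Sum>j\<in>J. a j * (1 / (1 + s j))\<^sup>2 * (s j / (1 + s j)) ^ (l + 1))\<^sup>2
      \<le> (\<Sum>j\<in>I. b j * (1 / (1 + u j)) * (u j / (1 + u j)) ^ l)\<^sup>2"
    and m: "m = (\<Sum>j\<in>J. a j * (1 / (1 + s j))\<^sup>2)" "0 < m"
  shows "(1 - \<rho>) / (\<rho> + mu_val W) \<le> 1 / m\<^sup>2"
proof -
  define g where "g r = r * expsum J a s (r\<^sup>2)" for r
  define f where "f r = expsum I b u (r\<^sup>2)" for r
  have [measurable]: "g \<in> borel_measurable borel" "f \<in> borel_measurable borel"
    unfolding g_def f_def expsum_def by measurable
  have gn: "g \<in> borel_measurable nu" and fn: "f \<in> borel_measurable nu" by (rule measurable_nu_borel; measurable)+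
  have le: "(g r)\<^sup>2 + (f r)\<^sup>2 \<le> 1" for r
    using le1[of "r\<^sup>2"] by (simp add: g_def f_def power_mult_distrib)
  have pg: "(\<integral>r. phi l r * g r \<partial>nu) = (-1) ^ l * sqrt (real (l + 1)) * (\<Sum>j\<in>J. a j * (1 / (1 + s j))\<^sup>2 * (s j / (1 + s j)) ^ l)" for l
    unfolding g_def by (rule has_bochner_integral_integral_eq[OF expsum_phi[OF s]])
  have fe: "(\<integral>r. f r * e_fun n n r \<partial>nu) = (-1) ^ n * (\<Sum>j\<in>I. b j * (1 / (1 + u j)) * (u j / (1 + u j)) ^ n)" for n
    unfolding f_def by (rule has_bochner_integral_integral_eq[OF expsum_e_fun[OF u]])
  have phi0: "phi 0 r = r" for r by (simp add: phi_def e_fun_def)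
  have mg: "m = (\<integral>r. r * g r \<partial>nu)" using pg[of 0] by (simp add: phi0 m)
  have df: "(\<integral>r. phi l r * g r \<partial>nu)\<^sup>2 \<le> (\<integral>r. f r * e_fun (l - 1) (l - 1) r \<partial>nu)\<^sup>2" if l: "1 \<le> l" for l
  proof -
    obtain k where k: "l = Suc k" using l by (cases l) auto
    have "(\<integral>r. phi l r * g r \<partial>nu)\<^sup>2 = real (k + 2) * (\<Sum>j\<in>J. a j * (1 / (1 + s j))\<^sup>2 * (s j / (1 + s j)) ^ (k + 1))\<^sup>2"
      unfolding pg k power_mult_distrib by (simp flip: power_mult)
    also note coeff[of k]
    also have "(\<Sum>j\<in>I. b j * (1 / (1 + u j)) * (u j / (1 + u j)) ^ k)\<^sup>2 = (\<integral>r. f r * e_fun (l - 1) (l - 1) r \<partial>nu)\<^sup>2"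
      unfolding fe k power_mult_distrib by (simp flip: power_mult)
    finally show ?thesis .
  qed
  define Dl where "Dl n = real (n + 1) * (\<Sum>j\<in>J. a j * (1 / (1 + s j))\<^sup>2 * (s j / (1 + s j)) ^ n)\<^sup>2" for n
  define Fl where "Fl n = (\<Sum>j\<in>I. b j * (1 / (1 + u j)) * (u j / (1 + u j)) ^ n)\<^sup>2" for n
  have D: "Dl sums (\<integral>r. (g r)\<^sup>2 \<partial>nu)" unfolding Dl_def g_def by (rule expsum_parseval_1[OF s])
  have F: "Fl sums (\<integral>r. (f r)\<^sup>2 \<partial>nu)" unfolding Fl_def f_def by (rule expsum_parseval_0[OF u])
  \<comment> \<open>The term of order 0 is m^2, since \<open>phi 0 r = r\<close>; the rest of the
    series is dominated termwise by that of \<open>f\<close>.\<close>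
  have "(\<lambda>n. Dl (Suc n)) sums ((\<integral>r. (g r)\<^sup>2 \<partial>nu) - Dl 0)" using D by (subst sums_Suc_iff) simp
  moreover have "Dl 0 = m\<^sup>2" by (simp add: Dl_def m)
  moreover have "Dl (Suc n) \<le> Fl n" for n using coeff[of n] by (simp add: Dl_def Fl_def add.commute)
  ultimately have c: "(\<integral>r. (g r)\<^sup>2 \<partial>nu) - m\<^sup>2 \<le> (\<integral>r. (f r)\<^sup>2 \<partial>nu)"
    using F by (metis sums_le)
  have g2: "integrable nu (\<lambda>r. (g r)\<^sup>2)"
    using expsum_sq_moment[of J s 1 a, OF s] by (simp add: g_def has_bochner_integral_iff power_mult_distrib)
  have f2: "integrable nu (\<lambda>r. (f r)\<^sup>2)"
    using expsum_sq_moment[of I u 0 b, OF u] by (simp add: f_def has_bochner_integral_iff)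
  have one: "has_bochner_integral nu (\<lambda>r. 1 :: real) 1" using nu_moment[of 0 0] by simp
  have "(\<integral>r. (g r)\<^sup>2 \<partial>nu) + (\<integral>r. (f r)\<^sup>2 \<partial>nu) = (\<integral>r. (g r)\<^sup>2 + (f r)\<^sup>2 \<partial>nu)" using g2 f2 by simp
  also have "\<dots> \<le> (\<integral>r. 1 \<partial>nu)" using le g2 f2 one by (intro integral_mono) (auto simp: has_bochner_integral_iff)
  also have "\<dots> = 1" using one by (simp add: has_bochner_integral_iff)
  finally have n: "2 * (\<integral>r. (g r)\<^sup>2 \<partial>nu) \<le> 1 + m\<^sup>2" using c by linarith
  show ?thesis by (rule upper_bound_by_test_functions[OF adm gn fn le df mg m(2) n])
qed

section \<open>Certifying the upper bound\<close>

text \<open>Fixed-point numbers: an integer \<open>x\<close> stands for \<open>x / 2 ^ 48\<close> here and for \<open>x / 2 ^ 60\<close>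
  in the evaluation of the base \<open>exp (- X / 2 ^ 16)\<close>.\<close>

fun squares :: "nat \<Rightarrow> int \<Rightarrow> int list" where
  "squares 0 e = []"
| "squares (Suc n) e = e # squares n (drop_bit 48 (e * e))"

fun horner :: "int \<Rightarrow> int list \<Rightarrow> int" where
  "horner u [] = 0"
| "horner u (x # xs) = x + u * horner u xs"

fun exp_horner :: "int list \<Rightarrow> int \<Rightarrow> int \<Rightarrow> int" where
  "exp_horner [] X acc = acc"
| "exp_horner (c # cs) X acc = exp_horner cs X (c * 2 ^ 60 - drop_bit 19 (acc * X))"

text \<open>The numbers 14! / k! for k from 14 down to 0, which keep Horner's scheme
  integral.\<close>

definition fact14 :: "int list" where
  "fact14 = [1, 14, 182, 2184, 24024, 240240, 2162160, 17297280, 121080960, 726485760, 3632428800, 14529715200, 43589145600, 87178291200, 87178291200]"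

definition sq60 :: "int \<Rightarrow> int" where "sq60 v = drop_bit 60 (v * v)"

text \<open>The Taylor polynomial is evaluated at an eighth of the argument and squared three times;
  87178291200 is 14!.\<close>

definition exp_base :: "int \<Rightarrow> int" where
  "exp_base X = drop_bit 12 (sq60 (sq60 (sq60 (exp_horner fact14 X 0 div 87178291200))))"

fun scale_down :: "nat \<Rightarrow> int \<Rightarrow> int \<Rightarrow> int" where
  "scale_down 0 H x = x"
| "scale_down (Suc k) H x = scale_down k H (drop_bit 16 (x * H))"

text \<open>A parameter \<open>(k, 2 ^ k, 3 ^ k, fact 9 / fact k)\<close> yields the coefficient of order \<open>k\<close>, scaled by \<open>fact 9 * 2 ^ 21\<close>;
  the lists \<open>w1\<close> and \<open>w3\<close> belong to the exponents \<open>2 ^ j\<close> and \<open>3 * 2 ^ j\<close>.\<close>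

fun taylor_coeff :: "int \<Rightarrow> int list \<Rightarrow> int list \<Rightarrow> nat \<times> int \<times> int \<times> int \<Rightarrow> int" where
  "taylor_coeff H w1 w3 (k, u, v, f) = drop_bit 33 (scale_down k H (drop_bit 30 (horner u w1 + v * horner u w3)) * f)"

definition taylor_params :: "(nat \<times> int \<times> int \<times> int) list" where
  "taylor_params = [(0, 1, 1, 362880), (1, 2, 3, 362880), (2, 4, 9, 181440), (3, 8, 27, 60480), (4, 16, 81, 15120), (5, 32, 243, 3024), (6, 64, 729, 504), (7, 128, 2187, 72), (8, 256, 6561, 9), (9, 512, 19683, 1)]"

fun padd :: "int list \<Rightarrow> int list \<Rightarrow> int list" where
  "padd [] q = q"
| "padd (a # p) [] = a # p"
| "padd (a # p) (b # q) = (a + b) # padd p q"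

fun pmul :: "int list \<Rightarrow> int list \<Rightarrow> int list" where
  "pmul [] q = []"
| "pmul (a # p) q = padd (map ((*) a) q) (0 # pmul p q)"

fun psup :: "int list \<Rightarrow> int" where
  "psup [] = 0"
| "psup (a # p) = a + sum_list (map abs p)"

text \<open>Coefficients of \<open>exp (- i * t / 16)\<close> in the test functions, rounded to multiples of \<open>2 ^ -36\<close>;
  suffix 1 for \<open>i = 2 ^ j\<close> and suffix 3 for \<open>i = 3 * 2 ^ j\<close>.\<close>

definition A1 :: "int list" where "A1 = [112298850097, -355130598937, -522827946944, -54657145053, 33319192107, 29283509894, 24859798555, 17334474721, 11573999828, 0]"
definition A3 :: "int list" where "A3 = [661976388847, 218257966560, 0, 0, 13361425153, 20557816398, 12326280700, 2039576719]"
definition B1 :: "int list" where "B1 = [0, 2396679701, -637620029, 6548708820, 6145441809, 14982267390, 14591506659, 20557487959, 11642086369, 91904322]"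
definition B3 :: "int list" where "B3 = [0, 0, 0, 0, 0, 0, -8148723867, 549732104]"

definition psq :: "int list \<Rightarrow> int list" where "psq p = pmul p p"

text \<open>With 4096 t = X - H \<theta> this is 4096 (t P + Q) as a polynomial in \<theta>.\<close>

definition combine :: "int \<Rightarrow> int \<Rightarrow> int list \<Rightarrow> int list \<Rightarrow> int list" where
  "combine X H P Q = padd (padd (map ((*) X) P) (0 # map ((*) (- H)) P)) (map ((*) 4096) Q)"

definition taylor_poly :: "int \<Rightarrow> int list \<Rightarrow> int list \<Rightarrow> int list" where
  "taylor_poly H w1 w3 = map (taylor_coeff H w1 w3) taylor_params"

definition enclosure :: "int \<Rightarrow> int \<Rightarrow> int list \<Rightarrow> int list \<Rightarrow> int" where
  "enclosure X H e1 e3 = psup (combine X H (psq (taylor_poly H (map2 (*) A1 e1) (map2 (*) A3 e3)))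
     (psq (taylor_poly H (map2 (*) B1 e1) (map2 (*) B3 e3))))"

definition cube48 :: "int \<Rightarrow> int" where "cube48 y = drop_bit 48 (y * drop_bit 48 (y * y))"

definition enc :: "nat \<Rightarrow> nat \<Rightarrow> int \<Rightarrow> int \<Rightarrow> int \<Rightarrow> int" where
  "enc n1 n3 X H y = enclosure X H (squares n1 y) (squares n3 (cube48 y))"

text \<open>The interval consists of the \<open>t\<close> with \<open>\<bar>4096 * t - X\<bar> \<le> H\<close>. Only the first \<open>n1\<close> and \<open>n3\<close> exponents are expanded;
  the remaining exponentials are below \<open>exp (- 33)\<close> there.\<close>

definition interval_ok :: "int \<Rightarrow> int \<Rightarrow> nat \<Rightarrow> nat \<Rightarrow> bool" where
  "interval_ok X H n1 n3 \<longleftrightarrow> 0 < H \<and> H \<le> X \<and> (14 * H \<le> X \<or> H \<le> 9) \<and> H \<le> 2 ^ 14 \<and> X \<le> 188000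
     \<and> n1 \<le> 10 \<and> 2 ^ n1 * X \<le> 4718592 \<and> (n1 = 10 \<or> 2162688 \<le> 2 ^ n1 * (X - H))
     \<and> n3 \<le> 8 \<and> 3 * 2 ^ n3 * X \<le> 4718592 \<and> (n3 = 8 \<or> 2162688 \<le> 3 * 2 ^ n3 * (X - H))
     \<and> enc n1 n3 X H (exp_base X) \<le> 2372170074761721571688009284"

fun covered :: "int \<Rightarrow> (int \<times> int \<times> nat \<times> nat) list \<Rightarrow> int \<Rightarrow> bool" where
  "covered lo [] hi \<longleftrightarrow> hi \<le> lo"
| "covered lo ((X, H, n1, n3) # xs) hi \<longleftrightarrow> X - H \<le> lo \<and> interval_ok X H n1 n3 \<and> covered (X + H) xs hi"

text \<open>\<open>KL\<close> and \<open>RL\<close> are multiples of \<open>2 ^ -40\<close>, \<open>ZL\<close> of \<open>2 ^ -56\<close>. For large \<open>l\<close> the last exponent of \<open>RL\<close> dominates: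
  \<open>RN\<close> keeps it together with the negative entries of \<open>RL\<close>, and \<open>KA\<close> consists of the absolute values of \<open>KL\<close>.\<close>

definition up_exps :: "nat list" where "up_exps = [1, 2, 4, 8, 16, 32, 64, 128, 256, 512, 3, 6, 12, 24, 48, 96, 192, 384]"
definition KL :: "int list" where "KL = [1591612768154, -4489552263101, -5353758176707, -388673031490, 133276768429, 52059573145, 15910271075, 3424093772, 640775077, 0, 7510956478446, 1847075683950, 0, 0, 13361425153, 6712756375, 1166985155, 52213164]"
definition RL :: "int list" where "RL = [0, 306775001755, -40807681864, 209558682253, 98327068944, 119858139119, 58366026635, 41114975918, 11642086369, 45952161, 0, 0, 0, 0, 0, 0, -10864965156, 366488069]"
definition RN :: "int list" where "RN = [0, 0, -40807681864, 0, 0, 0, 0, 0, 0, 45952161, 0, 0, 0, 0, 0, 0, -10864965156, 0]"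
definition KA :: "int list" where "KA = [1591612768154, 4489552263101, 5353758176707, 388673031490, 133276768429, 52059573145, 15910271075, 3424093772, 640775077, 0, 7510956478446, 1847075683950, 0, 0, 13361425153, 6712756375, 1166985155, 52213164]"
definition ZL :: "int list" where "ZL = [4238682002231055, 8006399337547548, 14411518807585587, 24019198012642645, 36028797018963968, 48038396025285290, 57646075230342348, 64051194700380387, 67818912035696880, 69874030582233150, 11377514848093884, 19652071101253073, 30881826016254829, 43234556422756761, 54043195528445952, 61763652032509659, 66514702188856556, 69175290276410818]"

fun dot :: "int list \<Rightarrow> int list \<Rightarrow> int" where
  "dot (x # xs) (y # ys) = x * y + dot xs ys"
| "dot _ _ = 0"

fun advance :: "int list \<Rightarrow> int list \<Rightarrow> int list" where
  "advance (z # zs) (x # xs) = drop_bit 56 (x * z) # advance zs xs"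
| "advance _ _ = []"

definition sq_le :: "int \<Rightarrow> int \<Rightarrow> int \<Rightarrow> bool" where
  "sq_le l d f \<longleftrightarrow> 0 \<le> f \<and> l * (d * d) \<le> f * f"

text \<open>The multiples of \<open>l\<close> are the accumulated rounding errors of the two scalar
  products: twice the sum of the absolute values of the list, per step. They are charged against the
  inequality on either side.\<close>

definition coeff_ok :: "int \<Rightarrow> int list \<Rightarrow> bool" where
  "coeff_ok l xs \<longleftrightarrow> sq_le (l + 1) (drop_bit 40 (\<bar>dot KL xs\<bar> + 2 * 21408233263193 * l) + 1) (drop_bit 40 (dot RL xs - 2 * 897727068243 * l))"

definition tail_ok :: "int \<Rightarrow> int list \<Rightarrow> bool" where
  "tail_ok l xs \<longleftrightarrow> sq_le (l + 1) (drop_bit 40 (dot KA xs + 2 * 21408233263193 * l) + 1) (drop_bit 40 (dot RN xs - 2 * 51718599181 * l))"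

fun coeffs_ok :: "nat \<Rightarrow> int \<Rightarrow> int list \<Rightarrow> bool" where
  "coeffs_ok 0 l xs \<longleftrightarrow> tail_ok l xs"
| "coeffs_ok (Suc n) l xs \<longleftrightarrow> coeff_ok l xs \<and> coeffs_ok n (l + 1) (advance ZL xs)"

section \<open>Rounding errors of the fixed-point evaluation\<close>

lemma drop_bit_bounds:
  "real_of_int x / 2 ^ n - 1 \<le> real_of_int (drop_bit n x)" "real_of_int (drop_bit n x) \<le> real_of_int x / 2 ^ n"
  using real_of_int_div3[of x "2 ^ n"] real_of_int_div4[of x "2 ^ n"] by (simp_all add: drop_bit_eq_div)

text \<open>One factor is at most 1 in its exact value, the other in its rounded value, so the
  errors simply add, with one more unit for the truncation.\<close>

lemma drop_bit_mult_error:
  assumes a: "\<bar>real_of_int a / 2 ^ n - A\<bar> \<le> d" "0 \<le> a" "a \<le> 2 ^ n"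
    and b: "\<bar>real_of_int b / 2 ^ n - B\<bar> \<le> e" "0 \<le> b" "b \<le> 2 ^ n" and A: "0 \<le> A" "A \<le> 1"
  shows "\<bar>real_of_int (drop_bit n (a * b)) / 2 ^ n - A * B\<bar> \<le> d + e + 1 / 2 ^ n"
    and "0 \<le> drop_bit n (a * b)" "drop_bit n (a * b) \<le> 2 ^ n"
proof -
  let ?a = "real_of_int a / 2 ^ n" and ?b = "real_of_int b / 2 ^ n"
  have "0 \<le> ?b" "?b \<le> 1" using b by (auto simp: divide_le_eq)
  then have "\<bar>(?a - A) * ?b\<bar> \<le> d * 1" using a(1) unfolding abs_mult by (intro mult_mono; linarith)
  moreover have "\<bar>A * (?b - B)\<bar> \<le> 1 * e" using b(1) A unfolding abs_mult by (intro mult_mono) auto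
  moreover have "?a * ?b - A * B = (?a - A) * ?b + A * (?b - B)" by (simp add: algebra_simps)
  ultimately have "\<bar>?a * ?b - A * B\<bar> \<le> d + e" by linarith
  moreover have "\<bar>real_of_int (drop_bit n (a * b)) / 2 ^ n - ?a * ?b\<bar> \<le> 1 / 2 ^ n"
  proof -
    have "\<bar>real_of_int (drop_bit n (a * b)) - real_of_int (a * b) / 2 ^ n\<bar> \<le> 1"
      using drop_bit_bounds[where x = "a * b" and n = n] by linarith
    then have "\<bar>(real_of_int (drop_bit n (a * b)) - real_of_int (a * b) / 2 ^ n) / 2 ^ n\<bar> \<le> 1 / 2 ^ n"
      by (simp add: divide_right_mono)
    then show ?thesis by (simp add: diff_divide_distrib)
  qed
  ultimately show "\<bar>real_of_int (drop_bit n (a * b)) / 2 ^ n - A * B\<bar> \<le> d + e + 1 / 2 ^ n" by linarith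
  show "0 \<le> drop_bit n (a * b)" using a b by simp
  have "a * b \<le> 2 ^ n * 2 ^ n" using a b by (intro mult_mono) auto
  then have "a * b div 2 ^ n \<le> 2 ^ n * 2 ^ n div 2 ^ n" by (intro zdiv_mono1) auto
  then show "drop_bit n (a * b) \<le> 2 ^ n" by (simp add: drop_bit_eq_div)
qed

text \<open>The bound 3 m - 1 is invariant under squaring: doubling it and adding one unit gives 3
  (2 m) - 1.\<close>

lemma squares_sound:
  assumes "\<bar>real_of_int e / 2 ^ 48 - E\<bar> \<le> (3 * real m - 1) / 2 ^ 48" "0 \<le> e" "e \<le> 2 ^ 48" "0 \<le> E" "E \<le> 1" "j < n"
  shows "\<bar>real_of_int (squares n e ! j) / 2 ^ 48 - E ^ (2 ^ j)\<bar> \<le> (3 * real (m * 2 ^ j) - 1) / 2 ^ 48"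
  using assms
proof (induction n e arbitrary: E m j rule: squares.induct)
  case (2 n e)
  show ?case
  proof (cases j)
    case (Suc i)
    have s: "\<bar>real_of_int (drop_bit 48 (e * e)) / 2 ^ 48 - E\<^sup>2\<bar> \<le> (3 * real (m * 2) - 1) / 2 ^ 48"
      "0 \<le> drop_bit 48 (e * e)" "drop_bit 48 (e * e) \<le> 2 ^ 48"
      using drop_bit_mult_error[OF 2(2,3,4,2,3,4,5,6)] by (simp_all add: power2_eq_square field_simps)
    have "\<bar>real_of_int (squares n (drop_bit 48 (e * e)) ! i) / 2 ^ 48 - (E\<^sup>2) ^ (2 ^ i)\<bar> \<le> (3 * real (m * 2 * 2 ^ i) - 1) / 2 ^ 48"
      by (rule 2(1)[OF s]) (use 2 Suc in \<open>auto simp: power_le_one\<close>)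
    then show ?thesis by (simp add: Suc mult.assoc flip: power_mult)
  qed (use 2 in simp)
qed simp

lemma length_squares [simp]: "length (squares n e) = n"
  by (induction n e rule: squares.induct) auto

text \<open>The ratio is at most 1 / 2, so an error of 2 is halved before the truncation adds 1: the
  bound reproduces itself.\<close>

lemma exp_horner_sound:
  assumes "0 \<le> X" "X \<le> 2 ^ 18" "\<bar>real_of_int acc - A\<bar> \<le> 2"
  shows "\<bar>real_of_int (exp_horner cs X acc) - fold (\<lambda>c a. real_of_int c * 2 ^ 60 - a * (real_of_int X / 2 ^ 19)) cs A\<bar> \<le> 2"
  using assms
proof (induction cs arbitrary: acc A)
  case (Cons c cs)
  let ?u = "real_of_int X / 2 ^ 19"
  have u: "0 \<le> ?u" "?u \<le> 1 / 2" using Cons(2,3) by auto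
  have "\<bar>(real_of_int acc - A) * ?u\<bar> \<le> 2 * (1 / 2)"
    unfolding abs_mult using Cons(4) u by (intro mult_mono) auto
  moreover have "\<bar>real_of_int (drop_bit 19 (acc * X)) - real_of_int acc * ?u\<bar> \<le> 1"
    using drop_bit_bounds[where x = "acc * X" and n = 19] by (simp add: abs_le_iff)
  ultimately have "\<bar>real_of_int (c * 2 ^ 60 - drop_bit 19 (acc * X)) - (real_of_int c * 2 ^ 60 - A * ?u)\<bar> \<le> 2"
    by (simp add: algebra_simps)
  then show ?case using Cons.IH[OF Cons(2,3)] by simp
qed simp

lemma power_div_fact_le_exp:
  assumes "0 \<le> (v::real)" shows "v ^ n / fact n \<le> exp v"
proof -
  obtain t where t: "exp v = (\<Sum>m<Suc n. v ^ m / fact m) + exp t / fact (Suc n) * v ^ Suc n"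
    using Maclaurin_exp_le by blast
  have "v ^ n / fact n \<le> (\<Sum>m<Suc n. v ^ m / fact m)" using assms by (intro member_le_sum) auto
  moreover have "0 \<le> exp t / fact (Suc n) * v ^ Suc n" using assms by simp
  ultimately show ?thesis using t by linarith
qed

lemma exp_taylor_error:
  assumes "\<bar>u\<bar> \<le> (l::real)"
  shows "\<bar>exp u - (\<Sum>k<n. u ^ k / fact k)\<bar> \<le> exp l * l ^ n / fact n"
proof -
  obtain t where t: "\<bar>t\<bar> \<le> \<bar>u\<bar>" "exp u = (\<Sum>m<n. u ^ m / fact m) + exp t / fact n * u ^ n"
    using Maclaurin_exp_le by blast
  then have "\<bar>exp u - (\<Sum>k<n. u ^ k / fact k)\<bar> = exp t * \<bar>u\<bar> ^ n / fact n"
    by (simp add: abs_mult power_abs)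
  also have "\<dots> \<le> exp l * l ^ n / fact n"
    using t assms by (intro divide_right_mono mult_mono power_mono) auto
  finally show ?thesis .
qed

lemma exp_base_sound:
  assumes "1 \<le> X" "X \<le> 188000"
  shows "\<bar>real_of_int (exp_base X) / 2 ^ 48 - exp (- (real_of_int X / 2 ^ 16))\<bar> \<le> 2 / 2 ^ 48"
    and "0 \<le> exp_base X" "exp_base X \<le> 2 ^ 48"
proof -
  let ?u = "real_of_int X / 2 ^ 19"
  define acc where "acc = exp_horner fact14 X 0"
  define v where "v = acc div 87178291200"
  have u: "0 \<le> ?u" "?u \<le> 9 / 25" using assms by auto
  have "fold (\<lambda>c a. real_of_int c * 2 ^ 60 - a * y) fact14 0 = 87178291200 * 2 ^ 60 * (\<Sum>k<15. (- y) ^ k / fact k)" for y :: real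
    by (simp add: fact14_def eval_nat_numeral fact_numeral algebra_simps)
  then have acc: "\<bar>real_of_int acc - 87178291200 * 2 ^ 60 * (\<Sum>k<15. (- ?u) ^ k / fact k)\<bar> \<le> 2"
    using exp_horner_sound[of X 0 0 fact14] assms unfolding acc_def by (simp only:) simp
  have "\<bar>exp (- ?u) - (\<Sum>k<15. (- ?u) ^ k / fact k)\<bar> \<le> exp (9 / 25) * (9 / 25) ^ 15 / fact 15"
    by (rule exp_taylor_error) (use u in auto)
  also have "\<dots> \<le> 2 * (9 / 25) ^ 15 / fact 15"
  proof -
    have "exp (9 / 25 :: real) \<le> 2"
      using exp_ge_add_one_self[of "- (9 / 25) :: real"] by (simp add: exp_minus field_simps)
    then show ?thesis by (intro divide_right_mono mult_right_mono) auto
  qed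
  also have "\<dots> \<le> 1 / 2 / 2 ^ 60" by (simp add: fact_numeral power_divide)
  finally have t: "\<bar>exp (- ?u) - (\<Sum>k<15. (- ?u) ^ k / fact k)\<bar> \<le> 1 / 2 / 2 ^ 60" .
  have vb: "real_of_int acc / 87178291200 - 1 \<le> real_of_int v" "real_of_int v \<le> real_of_int acc / 87178291200"
    unfolding v_def using real_of_int_div3[of acc 87178291200] real_of_int_div4[of acc 87178291200] by simp_all
  have v: "\<bar>real_of_int v / 2 ^ 60 - exp (- ?u)\<bar> \<le> 2 / 2 ^ 60"
    using acc vb abs_le_D1[OF t] abs_le_D2[OF t] by (simp add: abs_le_iff field_simps)
  let ?E = "exp (- ?u)"
  have e: "0 \<le> ?E" "?E \<le> 1" using u by auto
  have "16 / 25 \<le> ?E" using u exp_ge_add_one_self[of "- ?u"] by linarith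
  moreover have "2 / 2 ^ 60 \<le> (1 / 2 :: real)" by simp
  ultimately have "0 < real_of_int v / 2 ^ 60" using abs_le_D2[OF v] by linarith
  then have v0: "0 \<le> v" by (simp add: zero_less_divide_iff)
  \<comment> \<open>As X \<ge> 1, the exact value stays below 1 by much more than its error, so the
    rounded value cannot exceed 2^60.\<close>
  have "?E \<le> 1 / (1 + ?u)" using exp_ge_add_one_self[of ?u] u by (simp add: exp_minus field_simps)
  also have "\<dots> \<le> 1 / (1 + 1 / 2 ^ 19)" using assms by (intro divide_left_mono) auto
  finally have "real_of_int v / 2 ^ 60 \<le> 1" using abs_le_D1[OF v] by simp
  then have v1: "v \<le> 2 ^ 60" by (simp add: divide_le_eq)
  note 1 = drop_bit_mult_error[OF v v0 v1 v v0 v1 e, folded sq60_def]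
  have e2: "0 \<le> ?E * ?E" "?E * ?E \<le> 1" using e by (auto intro: mult_le_one)
  note 2 = drop_bit_mult_error[OF 1 1 e2, folded sq60_def]
  have e4: "0 \<le> (?E * ?E) * (?E * ?E)" "(?E * ?E) * (?E * ?E) \<le> 1" using e2 by (auto intro: mult_le_one)
  note 3 = drop_bit_mult_error[OF 2 2 e4, folded sq60_def]
  define w where "w = sq60 (sq60 (sq60 v))"
  have ex: "exp (- (real_of_int X / 2 ^ 16)) = (?E * ?E) * (?E * ?E) * ((?E * ?E) * (?E * ?E))"
    by (simp flip: exp_add)
  \<comment> \<open>The error in units of 2^-60 runs through 2, 5, 11, 23 in the three
    squarings.\<close>
  have w: "\<bar>real_of_int w / 2 ^ 60 - exp (- (real_of_int X / 2 ^ 16))\<bar> \<le> 23 / 2 ^ 60" "0 \<le> w" "w \<le> 2 ^ 60"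
    unfolding ex w_def using 3 by simp_all
  have b: "exp_base X = drop_bit 12 w" unfolding exp_base_def w_def v_def acc_def by simp
  show "\<bar>real_of_int (exp_base X) / 2 ^ 48 - exp (- (real_of_int X / 2 ^ 16))\<bar> \<le> 2 / 2 ^ 48"
    unfolding b using drop_bit_bounds[where x = w and n = 12] abs_le_D1[OF w(1)] abs_le_D2[OF w(1)]
    unfolding abs_le_iff by (simp add: field_simps)
  show "0 \<le> exp_base X" unfolding b using w by simp
  have "w div 2 ^ 12 \<le> 2 ^ 60 div 2 ^ 12" using w(3) by (rule zdiv_mono1) simp
  then show "exp_base X \<le> 2 ^ 48" unfolding b drop_bit_eq_div by simp
qed

text \<open>With y = x - l the remainder is at most exp(-y) l^10 / 10!. It is below 13^-10 if l
  \<le> 1 / 13, but also if l is at most y / 13, because y^10 / 10! \<le> exp(y). Interval widths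
  may therefore grow in proportion to t. The constant 21 bounds e^3, hence the Taylor sum.\<close>

lemma exp_term_error:
  assumes l: "0 \<le> (l::real)" "l \<le> 3" "l \<le> x" "l \<le> (x - l) / 13 \<or> l \<le> 1 / 13"
    and u: "\<bar>u\<bar> \<le> l" and z: "\<bar>z - exp (- x)\<bar> \<le> d"
  shows "\<bar>exp (u - x) - z * (\<Sum>k<10. u ^ k / fact k)\<bar> \<le> (1 / 13) ^ 10 + 21 * d"
proof -
  let ?T = "\<Sum>k<10. u ^ k / fact k"
  have "exp (u - x) - z * ?T = exp (- x) * (exp u - ?T) - (z - exp (- x)) * ?T"
    by (simp add: exp_diff exp_minus algebra_simps divide_inverse)
  then have "\<bar>exp (u - x) - z * ?T\<bar> \<le> \<bar>exp (- x) * (exp u - ?T)\<bar> + \<bar>(z - exp (- x)) * ?T\<bar>" by linarith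
  moreover have "\<bar>exp (- x) * (exp u - ?T)\<bar> \<le> (1 / 13) ^ 10"
  proof -
    have "\<bar>exp (- x) * (exp u - ?T)\<bar> \<le> exp (- x) * (exp l * l ^ 10 / fact 10)"
      unfolding abs_mult abs_exp_cancel by (intro mult_left_mono exp_taylor_error[OF u]) simp
    also have "\<dots> = exp (- (x - l)) * (l ^ 10 / fact 10)" by (simp add: exp_diff exp_minus field_simps)
    also have "\<dots> \<le> (1 / 13) ^ 10"
      using l(4)
    proof
      assume "l \<le> 1 / 13"
      have "exp (- (x - l)) * (l ^ 10 / fact 10) \<le> 1 * ((1 / 13) ^ 10 / 1)"
        using l \<open>l \<le> 1 / 13\<close> by (intro mult_mono frac_le power_mono) auto
      then show ?thesis by simp
    next
      assume a: "l \<le> (x - l) / 13"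
      have "l ^ 10 / fact 10 \<le> ((x - l) / 13) ^ 10 / fact 10"
        using a l by (intro divide_right_mono power_mono) auto
      also have "\<dots> = (1 / 13) ^ 10 * ((x - l) ^ 10 / fact 10)" by (simp add: power_divide)
      also have "\<dots> \<le> (1 / 13) ^ 10 * exp (x - l)"
        using l by (intro mult_left_mono power_div_fact_le_exp) auto
      finally have "exp (- (x - l)) * (l ^ 10 / fact 10) \<le> exp (- (x - l)) * ((1 / 13) ^ 10 * exp (x - l))"
        by (intro mult_left_mono) auto
      also have "\<dots> = (1 / 13) ^ 10 * (exp (- (x - l)) * exp (x - l))" by (simp only: ac_simps)
      also have "exp (- (x - l)) * exp (x - l) = 1" by (simp flip: exp_add)
      finally show ?thesis by simp
    qed
    finally show ?thesis .
  qed
  moreover have "\<bar>(z - exp (- x)) * ?T\<bar> \<le> 21 * d"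
  proof -
    have "\<bar>?T\<bar> \<le> (\<Sum>k<10. \<bar>u ^ k / fact k\<bar>)" by (rule sum_abs)
    also have "\<dots> \<le> (\<Sum>k<10. l ^ k / fact k)"
      using u by (intro sum_mono) (auto simp: power_abs intro!: divide_right_mono power_mono)
    also have "\<dots> \<le> exp l"
    proof -
      obtain t where "exp l = (\<Sum>m<10. l ^ m / fact m) + exp t / fact 10 * l ^ 10"
        using Maclaurin_exp_le by blast
      moreover have "0 \<le> exp t / fact 10 * l ^ 10" using l by simp
      ultimately show ?thesis by linarith
    qed
    also have "\<dots> \<le> exp (3 * 1)" using l by simp
    also have "\<dots> = exp 1 ^ 3" using exp_of_nat_mult[of 3 "1::real"] by simp
    also have "\<dots> \<le> 21" using power_mono[OF less_imp_le[OF e_less_272], of 3] by (simp add: power3_eq_cube)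
    finally have "\<bar>z - exp (- x)\<bar> * \<bar>?T\<bar> \<le> d * 21" using z by (intro mult_mono) auto
    then show ?thesis by (simp add: abs_mult)
  qed
  ultimately show ?thesis by linarith
qed

lemma horner_eq_sum: "real_of_int (horner u xs) = (\<Sum>j<length xs. real_of_int (xs ! j) * real_of_int u ^ j)"
  by (induction u xs rule: horner.induct)
    (simp_all add: sum.lessThan_Suc_shift sum_distrib_left mult_ac del: sum.lessThan_Suc)

lemma scale_down_sound:
  assumes "0 \<le> H" "H \<le> 2 ^ 14" "\<bar>real_of_int x - y\<bar> \<le> 2"
  shows "\<bar>real_of_int (scale_down k H x) - y * (real_of_int H / 2 ^ 16) ^ k\<bar> \<le> 2"
  using assms
proof (induction k H x arbitrary: y rule: scale_down.induct)
  case (2 k H x)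
  let ?h = "real_of_int H / 2 ^ 16"
  have u: "0 \<le> ?h" "?h \<le> 1 / 4" using 2(2,3) by auto
  have "\<bar>(real_of_int x - y) * ?h\<bar> \<le> 2 * (1 / 4)"
    unfolding abs_mult using 2(4) u by (intro mult_mono) auto
  moreover have "\<bar>real_of_int (drop_bit 16 (x * H)) - real_of_int x * ?h\<bar> \<le> 1"
    using drop_bit_bounds[where x = "x * H" and n = 16] by (simp add: abs_le_iff)
  ultimately have "\<bar>real_of_int (drop_bit 16 (x * H)) - y * ?h\<bar> \<le> 2" by (simp add: algebra_simps)
  then show ?case using 2(1)[of "y * ?h"] 2(2,3) by (simp add: mult.assoc)
qed simp

definition pval :: "int list \<Rightarrow> real \<Rightarrow> real" where
  "pval p x = (\<Sum>k<length p. real_of_int (p ! k) * x ^ k)"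

lemma pval_Nil [simp]: "pval [] x = 0" by (simp add: pval_def)

lemma pval_Cons [simp]: "pval (a # p) x = real_of_int a + x * pval p x"
  by (simp add: pval_def sum.lessThan_Suc_shift sum_distrib_left mult_ac del: sum.lessThan_Suc)

lemma pval_padd: "pval (padd p q) x = pval p x + pval q x"
  by (induction p q rule: padd.induct) (simp_all add: algebra_simps)

lemma pval_scale: "pval (map ((*) c) p) x = real_of_int c * pval p x"
  by (induction p) (simp_all add: algebra_simps)

lemma pval_pmul: "pval (pmul p q) x = pval p x * pval q x"
  by (induction p q rule: pmul.induct) (simp_all add: pval_padd pval_scale algebra_simps)

lemma pval_abs_le:
  assumes "\<bar>x\<bar> \<le> 1" shows "\<bar>pval p x\<bar> \<le> real_of_int (sum_list (map abs p))"
proof (induction p)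
  case (Cons a p)
  have "\<bar>x * pval p x\<bar> \<le> 1 * real_of_int (sum_list (map abs p))"
    unfolding abs_mult using assms Cons by (intro mult_mono) auto
  then show ?case using abs_triangle_ineq[of "real_of_int a" "x * pval p x"] by simp
qed simp

lemma pval_le_psup:
  assumes "\<bar>x\<bar> \<le> 1" shows "pval p x \<le> real_of_int (psup p)"
proof (cases p)
  case (Cons a q)
  have "\<bar>x * pval q x\<bar> \<le> 1 * real_of_int (sum_list (map abs q))"
    unfolding abs_mult using assms pval_abs_le[OF assms, of q] by (intro mult_mono) auto
  then show ?thesis by (simp add: Cons abs_le_iff)
qed simp
text \<open>One doubling chain of exponents: the first \<open>n\<close> exponentials are expanded
  from repeated squares, the others are replaced by 0, at a cost of at most exp(-33) each.\<close>

lemma exp_family_error: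
  fixes C :: "int list" and m N n :: nat
  assumes N: "length C = N" "n \<le> N" "0 < m" "m * 2 ^ N \<le> 1024"
    and e: "\<bar>real_of_int e / 2 ^ 48 - exp (- (real m * x))\<bar> \<le> (3 * real m - 1) / 2 ^ 48" "0 \<le> e" "e \<le> 2 ^ 48"
    and h: "0 \<le> h" "h \<le> x" "14 * h \<le> x \<or> 512 * h \<le> 1 / 13" and \<theta>: "\<bar>\<theta>\<bar> \<le> 1"
    and n: "real m * 2 ^ n * x \<le> 72" "n = N \<or> 33 \<le> real m * 2 ^ n * (x - h)"
  shows "\<bar>(\<Sum>j<N. real_of_int (C ! j) * exp (- (real (m * 2 ^ j) * (x - h * \<theta>))))
      - (\<Sum>k<10. (h * \<theta>) ^ k / fact k * (real m ^ k * real_of_int (horner (2 ^ k) (map2 (*) C (squares n e))) / 2 ^ 48))\<bar>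
    \<le> (\<Sum>j<N. \<bar>real_of_int (C ! j)\<bar> * ((1 / 13) ^ 10 + 63 * real (m * 2 ^ j) / 2 ^ 48))"
proof -
  define z where "z j = (if j < n then real_of_int (squares n e ! j) / 2 ^ 48 else 0)" for j
  define u where "u j = real (m * 2 ^ j) * (h * \<theta>)" for j
  \<comment> \<open>Since (m 2^j)^k = m^k (2^k)^j, the Taylor coefficient of order k of the whole
    chain is a polynomial evaluated at 2^k.\<close>
  have hor: "real m ^ k * real_of_int (horner (2 ^ k) (map2 (*) C (squares n e))) / 2 ^ 48
    = (\<Sum>j<N. real_of_int (C ! j) * z j * real (m * 2 ^ j) ^ k)" for k
  proof -
    have "real m ^ k * real_of_int (horner (2 ^ k) (map2 (*) C (squares n e))) / 2 ^ 48
      = (\<Sum>j<n. real_of_int (C ! j) * z j * real (m * 2 ^ j) ^ k)"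
      using N unfolding horner_eq_sum sum_distrib_left sum_divide_distrib
      by (intro sum.cong) (auto simp: z_def power_mult_distrib mult_ac simp flip: power_mult)
    also have "\<dots> = (\<Sum>j<N. real_of_int (C ! j) * z j * real (m * 2 ^ j) ^ k)"
      using N by (intro sum.mono_neutral_left) (auto simp: z_def)
    finally show ?thesis .
  qed
  have eq: "(\<Sum>k<10. (h * \<theta>) ^ k / fact k * (real m ^ k * real_of_int (horner (2 ^ k) (map2 (*) C (squares n e))) / 2 ^ 48))
    = (\<Sum>j<N. real_of_int (C ! j) * (z j * (\<Sum>k<10. u j ^ k / fact k)))"
    unfolding hor sum_distrib_left
    by (subst sum.swap) (intro sum.cong refl, simp add: u_def power_mult_distrib mult_ac)
  have hx: "h * \<theta> \<le> h" "- h \<le> h * \<theta>"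
    using h(1) \<theta> mult_left_mono[of \<theta> 1 h] mult_left_mono[of "- 1" \<theta> h] by auto
  have term_le: "\<bar>exp (- (real (m * 2 ^ j) * (x - h * \<theta>))) - z j * (\<Sum>k<10. u j ^ k / fact k)\<bar>
    \<le> (1 / 13) ^ 10 + 63 * real (m * 2 ^ j) / 2 ^ 48" if j: "j < N" for j
  proof -
    define M where "M = real (m * 2 ^ j)"
    have M: "0 < M" using N(3) by (simp add: M_def)
    have E: "exp (- (M * (x - h * \<theta>))) = exp (u j - M * x)" by (simp add: u_def M_def algebra_simps)
    show ?thesis
    proof (cases "j < n")
      case True
      \<comment> \<open>For j < n the exponent is at most half of m 2^n, which turns 72 into 36; the
        factor 14 then keeps M h below 3.\<close>
      have "2 * 2 ^ j \<le> (2 ^ n :: nat)" using True power_increasing[of "Suc j" n "2::nat"] by simp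
      then have "2 * (m * 2 ^ j) \<le> m * 2 ^ n" using mult_le_mono2[of "2 * 2 ^ j" "2 ^ n" m] by (simp add: mult_ac)
      then have "real (2 * (m * 2 ^ j)) \<le> real (m * 2 ^ n)" by (simp only: of_nat_le_iff)
      then have "2 * M \<le> real m * 2 ^ n" by (simp add: M_def)
      then have "2 * M * x \<le> real m * 2 ^ n * x" using h by (intro mult_right_mono) auto
      then have Mx: "M * x \<le> 36" using n(1) by linarith
      have "2 * 2 ^ j \<le> (2 ^ N :: nat)" using j power_increasing[of "Suc j" N "2::nat"] by simp
      then have "2 * (m * 2 ^ j) \<le> m * 2 ^ N" using mult_le_mono2[of "2 * 2 ^ j" "2 ^ N" m] by (simp add: mult_ac)
      then have "m * 2 ^ j \<le> 512" using N(4) by linarith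
      then have "real (m * 2 ^ j) \<le> real 512" by (simp only: of_nat_le_iff)
      then have M512: "M \<le> 512" by (simp add: M_def)
      have d: "\<bar>real_of_int (squares n e ! j) / 2 ^ 48 - exp (- (real m * x)) ^ (2 ^ j)\<bar> \<le> (3 * real (m * 2 ^ j) - 1) / 2 ^ 48"
        by (rule squares_sound) (use e True h in auto)
      have "exp (- (real m * x)) ^ (2 ^ j) = exp (- (M * x))"
        unfolding exp_of_nat_mult[symmetric] M_def by (simp add: mult_ac)
      then have d': "\<bar>z j - exp (- (M * x))\<bar> \<le> 3 * M / 2 ^ 48"
        using d True unfolding z_def M_def by (simp add: diff_divide_distrib)
      have "M * h \<le> (M * x - M * h) / 13 \<or> M * h \<le> 1 / 13"
        using h(3)
      proof
        assume "14 * h \<le> x"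
        then have "M * (14 * h) \<le> M * x" using M by (intro mult_left_mono) auto
        then show ?thesis by simp
      next
        assume "512 * h \<le> 1 / 13"
        moreover have "M * h \<le> 512 * h" using M512 h by (intro mult_right_mono) auto
        ultimately show ?thesis by simp
      qed
      moreover from this have "M * h \<le> 3" using Mx by (auto simp: field_simps)
      moreover have "M * h \<le> M * x" using h M by auto
      moreover have "\<bar>u j\<bar> \<le> M * h"
        using M hx unfolding u_def M_def[symmetric] abs_mult by (intro mult_mono) auto
      ultimately have "\<bar>exp (u j - M * x) - z j * (\<Sum>k<10. u j ^ k / fact k)\<bar> \<le> (1 / 13) ^ 10 + 21 * (3 * M / 2 ^ 48)"
        using M h by (intro exp_term_error[OF _ _ _ _ _ d']) simp_all
      then show ?thesis unfolding E[symmetric] M_def[symmetric] by simp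
    next
      case False
      then have nN: "33 \<le> real m * 2 ^ n * (x - h)" using j n(2) by auto
      have "m * 2 ^ n \<le> m * 2 ^ j" using False by (intro mult_le_mono2 power_increasing) auto
      then have "real (m * 2 ^ n) \<le> M" unfolding M_def by (simp only: of_nat_le_iff)
      then have "real m * 2 ^ n \<le> M" by simp
      then have "real m * 2 ^ n * (x - h) \<le> M * (x - h * \<theta>)" using h hx M by (intro mult_mono) auto
      then have "exp (- (M * (x - h * \<theta>))) \<le> exp (- 33)" using nN by simp
      also have "\<dots> \<le> (1 / 13) ^ 10"
      proof -
        have "(5 / 2) ^ 33 \<le> exp (1::real) ^ 33" using exp_lower_Taylor_quadratic[of 1] by (intro power_mono) auto
        then have "(5 / 2) ^ 33 \<le> exp (33::real)" using exp_of_nat_mult[of 33 "1::real"] by simp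
        moreover have "13 ^ 10 \<le> (5 / 2 :: real) ^ 33" by (simp add: power_divide)
        ultimately have "13 ^ 10 \<le> exp (33::real)" by linarith
        then show ?thesis by (simp add: exp_minus field_simps)
      qed
      finally show ?thesis using False M unfolding z_def M_def[symmetric] by simp
    qed
  qed
  have "\<bar>(\<Sum>j<N. real_of_int (C ! j) * exp (- (real (m * 2 ^ j) * (x - h * \<theta>))))
      - (\<Sum>j<N. real_of_int (C ! j) * (z j * (\<Sum>k<10. u j ^ k / fact k)))\<bar>
    \<le> (\<Sum>j<N. \<bar>real_of_int (C ! j) * (exp (- (real (m * 2 ^ j) * (x - h * \<theta>))) - z j * (\<Sum>k<10. u j ^ k / fact k))\<bar>)"
    unfolding sum_subtractf[symmetric] right_diff_distrib[symmetric] by (rule sum_abs)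
  also have "\<dots> \<le> (\<Sum>j<N. \<bar>real_of_int (C ! j)\<bar> * ((1 / 13) ^ 10 + 63 * real (m * 2 ^ j) / 2 ^ 48))"
    unfolding abs_mult by (intro sum_mono mult_left_mono term_le) auto
  finally show ?thesis unfolding eq .
qed

lemma taylor_params_nth:
  assumes "k < 10" shows "taylor_params ! k = (k, 2 ^ k, 3 ^ k, fact 9 div fact k)"
proof -
  have "taylor_params = map (\<lambda>k. (k, 2 ^ k, 3 ^ k, fact 9 div fact k)) [0..<10]"
    by (simp add: taylor_params_def upt_conv_Cons fact_numeral)
  from this show ?thesis using assms by (subst \<open>taylor_params = _\<close>, subst nth_map_upt) simp_all
qed

text \<open>Coefficients at scale 2^36 times exponentials at scale 2^48 give 2^84, which is
  exchanged for the scale 9! 2^21. Each of the ten coefficients is off by at most 2.\<close>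

lemma taylor_poly_sound:
  assumes H: "0 \<le> H" "H \<le> 2 ^ 14" and \<theta>: "\<bar>\<theta>\<bar> \<le> 1"
  shows "\<bar>pval (taylor_poly H w1 w3) \<theta> - 362880 * 2 ^ 21 / 2 ^ 84 * (\<Sum>k<10. (real_of_int H / 2 ^ 16 * \<theta>) ^ k / fact k *
    (real_of_int (horner (2 ^ k) w1) + 3 ^ k * real_of_int (horner (2 ^ k) w3)))\<bar> \<le> 20"
proof -
  let ?h = "real_of_int H / 2 ^ 16"
  define M where "M k = horner (2 ^ k) w1 + 3 ^ k * horner (2 ^ k) w3" for k
  define c where "c k = taylor_coeff H w1 w3 (taylor_params ! k)" for k
  have len: "length taylor_params = 10" by (simp add: taylor_params_def)
  have p: "pval (taylor_poly H w1 w3) \<theta> = (\<Sum>k<10. real_of_int (c k) * \<theta> ^ k)"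
    unfolding pval_def taylor_poly_def c_def by (intro sum.cong) (auto simp: len)
  have ck: "\<bar>real_of_int (c k) - 362880 * 2 ^ 21 / 2 ^ 84 * (?h ^ k / fact k * real_of_int (M k))\<bar> \<le> 2" if k: "k < 10" for k
  proof -
    define g where "g = scale_down k H (drop_bit 30 (M k))"
    define f :: int where "f = fact 9 div fact k"
    have kd: "(fact k :: int) dvd fact 9" using k by (intro fact_dvd) auto
    have f: "real_of_int f = 362880 / fact k"
      unfolding f_def using real_of_int_div[OF kd] by (simp add: fact_numeral)
    have fb: "0 \<le> real_of_int f" "real_of_int f \<le> 362880" unfolding f by (auto simp: divide_le_eq fact_ge_1)
    have "\<bar>real_of_int g - real_of_int (M k) / 2 ^ 30 * ?h ^ k\<bar> \<le> 2"
      unfolding g_def by (rule scale_down_sound[OF H])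
        (use drop_bit_bounds[where x = "M k" and n = 30] in \<open>simp add: abs_le_iff\<close>)
    then have "\<bar>(real_of_int g - real_of_int (M k) / 2 ^ 30 * ?h ^ k) * real_of_int f\<bar> \<le> 2 * 362880"
      unfolding abs_mult using fb by (intro mult_mono) auto
    moreover define Y where "Y = real_of_int (M k) / 2 ^ 30 * ?h ^ k * real_of_int f"
    ultimately have Y: "\<bar>real_of_int (g * f) - Y\<bar> \<le> 725760" by (simp add: left_diff_distrib)
    have eq: "362880 * 2 ^ 21 / 2 ^ 84 * (?h ^ k / fact k * real_of_int (M k)) = Y / 2 ^ 33"
      unfolding Y_def f by simp
    have "c k = drop_bit 33 (g * f)"
      unfolding c_def taylor_params_nth[OF k] by (simp add: g_def f_def M_def)
    then show ?thesis
      using drop_bit_bounds[where x = "g * f" and n = 33] Y unfolding eq abs_le_iff by (simp; linarith)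
  qed
  have "\<bar>(\<Sum>k<10. real_of_int (c k) * \<theta> ^ k) - 362880 * 2 ^ 21 / 2 ^ 84 * (\<Sum>k<10. (?h * \<theta>) ^ k / fact k * real_of_int (M k))\<bar>
    = \<bar>\<Sum>k<10. (real_of_int (c k) - 362880 * 2 ^ 21 / 2 ^ 84 * (?h ^ k / fact k * real_of_int (M k))) * \<theta> ^ k\<bar>"
    unfolding sum_distrib_left sum_subtractf[symmetric]
    by (intro arg_cong[where f = abs] sum.cong refl) (simp only: power_mult_distrib left_diff_distrib, simp add: mult_ac)
  also have "\<dots> \<le> (\<Sum>k<10. \<bar>(real_of_int (c k) - 362880 * 2 ^ 21 / 2 ^ 84 * (?h ^ k / fact k * real_of_int (M k))) * \<theta> ^ k\<bar>)"
    by (rule sum_abs)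
  also have "\<dots> \<le> (\<Sum>k<(10::nat). 2 * 1)"
    unfolding abs_mult power_abs using ck \<theta> by (intro sum_mono mult_mono) (auto intro: power_le_one)
  finally show ?thesis unfolding p M_def by simp
qed

definition two_exp :: "(nat \<Rightarrow> real) \<Rightarrow> (nat \<Rightarrow> real) \<Rightarrow> real \<Rightarrow> real" where
  "two_exp c1 c3 x = (\<Sum>j<10. c1 j * exp (- (real (1 * 2 ^ j) * x))) + (\<Sum>j<8. c3 j * exp (- (real (3 * 2 ^ j) * x)))"

lemma two_exp_diff:
  assumes "\<And>j. j < 10 \<Longrightarrow> \<bar>c1 j - d1 j\<bar> \<le> 1" "\<And>j. j < 8 \<Longrightarrow> \<bar>c3 j - d3 j\<bar> \<le> 1" "0 \<le> x"
  shows "\<bar>two_exp c1 c3 x - two_exp d1 d3 x\<bar> \<le> 18"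
proof -
  have *: "\<bar>(\<Sum>j<N. c j * exp (- (real (m * 2 ^ j) * x))) - (\<Sum>j<N. d j * exp (- (real (m * 2 ^ j) * x)))\<bar> \<le> real N"
    if "\<And>j. j < N \<Longrightarrow> \<bar>c j - d j\<bar> \<le> 1" for c d :: "nat \<Rightarrow> real" and m N :: nat
  proof -
    have "\<bar>(\<Sum>j<N. c j * exp (- (real (m * 2 ^ j) * x))) - (\<Sum>j<N. d j * exp (- (real (m * 2 ^ j) * x)))\<bar>
      \<le> (\<Sum>j<N. \<bar>(c j - d j) * exp (- (real (m * 2 ^ j) * x))\<bar>)"
      unfolding sum_subtractf[symmetric] left_diff_distrib[symmetric] by (rule sum_abs)
    also have "\<dots> \<le> (\<Sum>j<N. 1 * 1)"
      unfolding abs_mult using that assms(3) by (intro sum_mono mult_mono) auto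
    finally show ?thesis by simp
  qed
  show ?thesis using *[of 10 c1 d1 1] *[of 8 c3 d3 3] assms unfolding two_exp_def by fastforce
qed

section \<open>From polynomial enclosures to the pointwise inequality\<close>

lemma cube48_sound:
  assumes "\<bar>real_of_int y / 2 ^ 48 - E\<bar> \<le> 2 / 2 ^ 48" "0 \<le> y" "y \<le> 2 ^ 48" "0 \<le> E" "E \<le> 1"
  shows "\<bar>real_of_int (cube48 y) / 2 ^ 48 - E ^ 3\<bar> \<le> 8 / 2 ^ 48" "0 \<le> cube48 y" "cube48 y \<le> 2 ^ 48"
proof -
  note 2 = drop_bit_mult_error[OF assms(1-3) assms(1-3) assms(4,5)]
  note 3 = drop_bit_mult_error[OF assms(1-3) 2 assms(4,5), folded cube48_def]
  show "\<bar>real_of_int (cube48 y) / 2 ^ 48 - E ^ 3\<bar> \<le> 8 / 2 ^ 48" using 3(1) by (simp add: power3_eq_cube mult.assoc)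
  show "0 \<le> cube48 y" "cube48 y \<le> 2 ^ 48" using 3 by simp_all
qed

definition ecoeff :: "int list \<Rightarrow> int list \<Rightarrow> nat \<Rightarrow> nat \<Rightarrow> int \<Rightarrow> int \<Rightarrow> int list" where
  "ecoeff C1 C3 n1 n3 X H = taylor_poly H (map2 (*) C1 (squares n1 (exp_base X))) (map2 (*) C3 (squares n3 (cube48 (exp_base X))))"

text \<open>In units of 2^-36 the expansion costs 45 and the rounded coefficients cost 18; with the
  20 units of 1 / (9! 2^21) from the integer polynomial the total stays below 10^-9.\<close>

lemma two_exp_poly:
  fixes c1 c3 :: "nat \<Rightarrow> real"
  assumes ok: "interval_ok X H n1 n3" and \<theta>: "\<bar>\<theta>\<bar> \<le> 1"
    and len: "length C1 = 10" "length C3 = 8"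
    and c: "\<And>j. j < 10 \<Longrightarrow> \<bar>2 ^ 36 * c1 j - real_of_int (C1 ! j)\<bar> \<le> 1" "\<And>j. j < 8 \<Longrightarrow> \<bar>2 ^ 36 * c3 j - real_of_int (C3 ! j)\<bar> \<le> 1"
    and b: "(\<Sum>j<10. \<bar>real_of_int (C1 ! j)\<bar> * ((1 / 13) ^ 10 + 63 * real (1 * 2 ^ j) / 2 ^ 48))
      + (\<Sum>j<8. \<bar>real_of_int (C3 ! j)\<bar> * ((1 / 13) ^ 10 + 63 * real (3 * 2 ^ j) / 2 ^ 48)) \<le> 45"
  shows "\<bar>pval (ecoeff C1 C3 n1 n3 X H) \<theta> / (362880 * 2 ^ 21)
    - two_exp c1 c3 (real_of_int X / 2 ^ 16 - real_of_int H / 2 ^ 16 * \<theta>)\<bar> \<le> 1 / 10 ^ 9"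
proof -
  define x where "x = real_of_int X / 2 ^ 16"
  define h where "h = real_of_int H / 2 ^ 16"
  define y where "y = exp_base X"
  define w1 where "w1 = map2 (*) C1 (squares n1 y)"
  define w3 where "w3 = map2 (*) C3 (squares n3 (cube48 y))"
  have io: "0 < H" "H \<le> X" "14 * H \<le> X \<or> H \<le> 9" "H \<le> 2 ^ 14" "X \<le> 188000" "n1 \<le> 10" "2 ^ n1 * X \<le> 4718592"
    "n1 = 10 \<or> 2162688 \<le> 2 ^ n1 * (X - H)" "n3 \<le> 8" "3 * 2 ^ n3 * X \<le> 4718592" "n3 = 8 \<or> 2162688 \<le> 3 * 2 ^ n3 * (X - H)"
    using ok unfolding interval_ok_def by auto
  \<comment> \<open>\<open>14 * H \<le> X\<close> means h \<le> (x - h) / 13, and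
    \<open>H \<le> 9\<close> gives 512 h \<le> 1 / 13 for the largest exponent 512.\<close>
  have h: "0 \<le> h" "h \<le> x" "14 * h \<le> x \<or> 512 * h \<le> 1 / 13"
    using io(1,2,3) by (auto simp: h_def x_def)
  have pos: "0 \<le> x" "0 \<le> x - h * \<theta>"
  proof -
    show "0 \<le> x" using h by simp
    have "h * \<theta> \<le> h * 1" using h \<theta> by (intro mult_left_mono) auto
    then show "0 \<le> x - h * \<theta>" using h by simp
  qed
  have X1: "1 \<le> X" using io by simp
  note y = exp_base_sound[OF X1 io(5), folded y_def x_def]
  have ex: "0 \<le> exp (- x)" "exp (- x) \<le> 1" using pos by auto
  note y3 = cube48_sound[OF y ex]
  have ex3: "exp (- x) ^ 3 = exp (- (real 3 * x))" by (simp flip: exp_of_nat_mult)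
  have real_le: "real_of_int a / 2 ^ 16 * r \<le> s" if "real_of_int a * r \<le> s * 2 ^ 16" for a r s using that by simp
  \<comment> \<open>The integers are 72 * 2^16 and 33 * 2^16.\<close>
  have n1: "real 1 * 2 ^ n1 * x \<le> 72" "n1 = 10 \<or> 33 \<le> real 1 * 2 ^ n1 * (x - h)"
  proof -
    have "real_of_int (2 ^ n1 * X) \<le> real_of_int 4718592" using io by (simp only: of_int_le_iff)
    then show "real 1 * 2 ^ n1 * x \<le> 72" by (simp add: x_def)
    have "real_of_int 2162688 \<le> real_of_int (2 ^ n1 * (X - H))" if "n1 \<noteq> 10" using io that by (simp only: of_int_le_iff) simp
    then show "n1 = 10 \<or> 33 \<le> real 1 * 2 ^ n1 * (x - h)" by (cases "n1 = 10") (simp_all add: x_def h_def field_simps)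
  qed
  have n3: "real 3 * 2 ^ n3 * x \<le> 72" "n3 = 8 \<or> 33 \<le> real 3 * 2 ^ n3 * (x - h)"
  proof -
    have "real_of_int (3 * 2 ^ n3 * X) \<le> real_of_int 4718592" using io by (simp only: of_int_le_iff)
    then show "real 3 * 2 ^ n3 * x \<le> 72" by (simp add: x_def)
    have "real_of_int 2162688 \<le> real_of_int (3 * 2 ^ n3 * (X - H))" if "n3 \<noteq> 8" using io that by (simp only: of_int_le_iff) simp
    then show "n3 = 8 \<or> 33 \<le> real 3 * 2 ^ n3 * (x - h)" by (cases "n3 = 8") (simp_all add: x_def h_def field_simps)
  qed
  have f1: "\<bar>(\<Sum>j<10. real_of_int (C1 ! j) * exp (- (real (1 * 2 ^ j) * (x - h * \<theta>))))
      - (\<Sum>k<10. (h * \<theta>) ^ k / fact k * (real 1 ^ k * real_of_int (horner (2 ^ k) w1) / 2 ^ 48))\<bar>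
    \<le> (\<Sum>j<10. \<bar>real_of_int (C1 ! j)\<bar> * ((1 / 13) ^ 10 + 63 * real (1 * 2 ^ j) / 2 ^ 48))"
    unfolding w1_def by (rule exp_family_error[OF len(1) io(6) _ _ _ y(2,3) h \<theta> n1]) (use y(1) in simp_all)
  have f3: "\<bar>(\<Sum>j<8. real_of_int (C3 ! j) * exp (- (real (3 * 2 ^ j) * (x - h * \<theta>))))
      - (\<Sum>k<10. (h * \<theta>) ^ k / fact k * (real 3 ^ k * real_of_int (horner (2 ^ k) w3) / 2 ^ 48))\<bar>
    \<le> (\<Sum>j<8. \<bar>real_of_int (C3 ! j)\<bar> * ((1 / 13) ^ 10 + 63 * real (3 * 2 ^ j) / 2 ^ 48))"
    unfolding w3_def by (rule exp_family_error[OF len(2) io(9) _ _ _ y3(2,3) h \<theta> n3]) (use y3(1) in \<open>simp_all add: ex3\<close>)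
  define Q where "Q = (\<Sum>k<10. (h * \<theta>) ^ k / fact k * (real_of_int (horner (2 ^ k) w1) + 3 ^ k * real_of_int (horner (2 ^ k) w3)))"
  have Q: "(\<Sum>k<10. (h * \<theta>) ^ k / fact k * (real 1 ^ k * real_of_int (horner (2 ^ k) w1) / 2 ^ 48))
    + (\<Sum>k<10. (h * \<theta>) ^ k / fact k * (real 3 ^ k * real_of_int (horner (2 ^ k) w3) / 2 ^ 48)) = Q / 2 ^ 48"
    unfolding Q_def sum.distrib[symmetric] sum_divide_distrib by (intro sum.cong refl) (simp add: field_simps)
  define T where "T = two_exp (\<lambda>j. real_of_int (C1 ! j)) (\<lambda>j. real_of_int (C3 ! j)) (x - h * \<theta>)"
  define T' where "T' = two_exp c1 c3 (x - h * \<theta>)"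
  have "\<bar>T - Q / 2 ^ 48\<bar> \<le> 45"
    using f1 f3 b unfolding Q[symmetric] T_def two_exp_def by linarith
  moreover have "\<bar>2 ^ 36 * T' - T\<bar> \<le> 18"
  proof -
    have "2 ^ 36 * T' = two_exp (\<lambda>j. 2 ^ 36 * c1 j) (\<lambda>j. 2 ^ 36 * c3 j) (x - h * \<theta>)"
      unfolding T'_def two_exp_def distrib_left sum_distrib_left by (simp only: mult.assoc)
    then show ?thesis unfolding T_def using two_exp_diff[OF c pos(2)] by simp
  qed
  moreover have "\<bar>pval (ecoeff C1 C3 n1 n3 X H) \<theta> - 362880 * 2 ^ 21 / 2 ^ 84 * Q\<bar> \<le> 20"
    using taylor_poly_sound[of H \<theta> w1 w3] io \<theta> unfolding ecoeff_def Q_def h_def w1_def w3_def y_def by simp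
  ultimately have "\<bar>pval (ecoeff C1 C3 n1 n3 X H) \<theta> / (362880 * 2 ^ 21) - T'\<bar> \<le> 1 / 10 ^ 9"
    unfolding abs_le_iff by (simp add: field_simps)
  then show ?thesis unfolding T'_def x_def h_def .
qed

text \<open>The product (1 + 1 / 10^8) (1 - 2 / 10^8) leaves about 1 / 10^8, of which the 51
  perturbations of about 1 / 10^10 use half.\<close>

lemma perturbed_sum_le_1:
  fixes x y z P Q :: real
  assumes "P + Q \<le> 1 - 2 / 10 ^ 8" "x \<le> (1 + 1 / 10 ^ 8) * P + z" "y \<le> (1 + 1 / 10 ^ 8) * Q + (1 + 10 ^ 8) / 10 ^ 18"
    "z \<le> 50 * ((1 + 10 ^ 8) / 10 ^ 18)"
  shows "x + y \<le> 1"
  using assms by simp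

lemma interval_ok_sound:
  fixes a1 a3 b1 b3 :: "nat \<Rightarrow> real"
  assumes ok: "interval_ok X H n1 n3" and t: "\<bar>4096 * t - real_of_int X\<bar> \<le> real_of_int H" "0 \<le> t"
    and a: "\<And>j. j < 10 \<Longrightarrow> \<bar>2 ^ 36 * a1 j - real_of_int (A1 ! j)\<bar> \<le> 1" "\<And>j. j < 8 \<Longrightarrow> \<bar>2 ^ 36 * a3 j - real_of_int (A3 ! j)\<bar> \<le> 1"
    and b: "\<And>j. j < 10 \<Longrightarrow> \<bar>2 ^ 36 * b1 j - real_of_int (B1 ! j)\<bar> \<le> 1" "\<And>j. j < 8 \<Longrightarrow> \<bar>2 ^ 36 * b3 j - real_of_int (B3 ! j)\<bar> \<le> 1"
  shows "t * (two_exp a1 a3 (t / 16))\<^sup>2 + (two_exp b1 b3 (t / 16))\<^sup>2 \<le> 1"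
proof -
  have H: "0 < H" "H \<le> 2 ^ 14" "X \<le> 188000" using ok unfolding interval_ok_def by auto
  \<comment> \<open>The local variable of the interval, in [-1, 1], on which the enclosing
    polynomials depend.\<close>
  define \<theta> where "\<theta> = (real_of_int X - 4096 * t) / real_of_int H"
  have \<theta>: "\<bar>\<theta>\<bar> \<le> 1" using t H by (simp add: \<theta>_def abs_divide abs_minus_commute)
  have tt: "4096 * t = real_of_int X - real_of_int H * \<theta>" using H by (simp add: \<theta>_def)
  have t16: "real_of_int X / 2 ^ 16 - real_of_int H / 2 ^ 16 * \<theta> = t / 16" using tt by (simp add: field_simps)
  have s10: "sum f {..<10} = f 0 + f 1 + f 2 + f 3 + f 4 + f 5 + f 6 + f 7 + f 8 + f 9"
    and s8: "sum f {..<8} = f 0 + f 1 + f 2 + f 3 + f 4 + f 5 + f 6 + f 7" for f :: "nat \<Rightarrow> real"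
    by (simp_all add: eval_nat_numeral)
  define p where "p = pval (ecoeff A1 A3 n1 n3 X H) \<theta>"
  define q where "q = pval (ecoeff B1 B3 n1 n3 X H) \<theta>"
  define K where "K = (362880 * 2 ^ 21 :: real)"
  have pA: "\<bar>p / K - two_exp a1 a3 (t / 16)\<bar> \<le> 1 / 10 ^ 9"
    unfolding p_def K_def t16[symmetric]
    by (rule two_exp_poly[OF ok \<theta> _ _ a]) (simp_all add: A1_def A3_def s10 s8 power_divide)
  have qB: "\<bar>q / K - two_exp b1 b3 (t / 16)\<bar> \<le> 1 / 10 ^ 9"
    unfolding q_def K_def t16[symmetric]
    by (rule two_exp_poly[OF ok \<theta> _ _ b]) (simp_all add: B1_def B3_def s10 s8 power_divide)
  have "4096 * t * p\<^sup>2 + 4096 * q\<^sup>2 = pval (combine X H (psq (ecoeff A1 A3 n1 n3 X H)) (psq (ecoeff B1 B3 n1 n3 X H))) \<theta>"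
    unfolding combine_def pval_padd pval_Cons pval_scale psq_def pval_pmul p_def[symmetric] q_def[symmetric] tt
    by (simp add: power2_eq_square algebra_simps)
  also have "\<dots> \<le> real_of_int (enc n1 n3 X H (exp_base X))"
    using pval_le_psup[OF \<theta>] unfolding enc_def enclosure_def ecoeff_def by simp
  \<comment> \<open>The threshold is chosen just below (1 - 2 / 10^8) * 4096 * K^2.\<close>
  also have "\<dots> \<le> real_of_int 2372170074761721571688009284"
    using ok unfolding interval_ok_def of_int_le_iff by blast
  finally have PQ: "t * (p / K)\<^sup>2 + (q / K)\<^sup>2 \<le> 1 - 2 / 10 ^ 8"
    by (simp add: K_def power_divide field_simps)
  \<comment> \<open>Young's inequality u^2 \<le> (1 + e) v^2 + (1 + 1 / e) (u - v)^2 with e =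
    10^-8.\<close>
  have ab: "u\<^sup>2 \<le> (1 + 1 / 10 ^ 8) * v\<^sup>2 + (1 + 10 ^ 8) / 10 ^ 18" if "\<bar>v - u\<bar> \<le> 1 / 10 ^ 9" for u v :: real
  proof -
    have "\<bar>v - u\<bar>\<^sup>2 \<le> (1 / 10 ^ 9)\<^sup>2" using that by (intro power_mono) auto
    then have "(v - u)\<^sup>2 * (1 + 10 ^ 8) \<le> (1 + 10 ^ 8) / 10 ^ 18" by (simp add: power_divide)
    moreover have "0 \<le> (v / 10 ^ 4 + (v - u) * 10 ^ 4)\<^sup>2" by simp
    ultimately show ?thesis by (simp add: power2_eq_square algebra_simps)
  qed
  have "t \<le> 50" using t H by (simp add: abs_le_iff)
  have "t * (two_exp a1 a3 (t / 16))\<^sup>2 \<le> t * ((1 + 1 / 10 ^ 8) * (p / K)\<^sup>2 + (1 + 10 ^ 8) / 10 ^ 18)"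
    using t(2) by (intro mult_left_mono ab pA)
  also have "\<dots> = (1 + 1 / 10 ^ 8) * (t * (p / K)\<^sup>2) + t * ((1 + 10 ^ 8) / 10 ^ 18)"
    by (simp only: distrib_left mult.left_commute)
  finally have a': "t * (two_exp a1 a3 (t / 16))\<^sup>2 \<le> \<dots>" .
  have c: "t * ((1 + 10 ^ 8) / 10 ^ 18) \<le> 50 * ((1 + 10 ^ 8) / 10 ^ 18)" using \<open>t \<le> 50\<close> by (intro mult_right_mono) auto
  show ?thesis by (rule perturbed_sum_le_1[OF PQ a' ab[OF qB] c])
qed

lemma covered_sound:
  fixes a1 a3 b1 b3 :: "nat \<Rightarrow> real"
  assumes "covered lo xs hi" "real_of_int lo \<le> 4096 * t" "4096 * t < real_of_int hi" "0 \<le> t"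
    and a: "\<And>j. j < 10 \<Longrightarrow> \<bar>2 ^ 36 * a1 j - real_of_int (A1 ! j)\<bar> \<le> 1" "\<And>j. j < 8 \<Longrightarrow> \<bar>2 ^ 36 * a3 j - real_of_int (A3 ! j)\<bar> \<le> 1"
    and b: "\<And>j. j < 10 \<Longrightarrow> \<bar>2 ^ 36 * b1 j - real_of_int (B1 ! j)\<bar> \<le> 1" "\<And>j. j < 8 \<Longrightarrow> \<bar>2 ^ 36 * b3 j - real_of_int (B3 ! j)\<bar> \<le> 1"
  shows "t * (two_exp a1 a3 (t / 16))\<^sup>2 + (two_exp b1 b3 (t / 16))\<^sup>2 \<le> 1"
  using assms(1-4)
proof (induction lo xs hi rule: covered.induct)
  case (1 lo hi)
  then have "real_of_int hi \<le> real_of_int lo" by (simp only: covered.simps of_int_le_iff)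
  then show ?case using 1 by linarith
next
  case (2 lo X H n1 n3 xs hi)
  have c: "real_of_int (X - H) \<le> real_of_int lo" "interval_ok X H n1 n3" "covered (X + H) xs hi"
    using 2(2) by (simp_all only: covered.simps of_int_le_iff)
  show ?case
  proof (cases "real_of_int (X + H) \<le> 4096 * t")
    case True
    then show ?thesis using 2 c by blast
  next
    case False
    then have "\<bar>4096 * t - real_of_int X\<bar> \<le> real_of_int H" using c(1) 2(3) by simp
    then show ?thesis by (rule interval_ok_sound[OF c(2) _ 2(5) a b])
  qed
qed

text \<open>Centres and half-widths are in units of 1 / 4096, so that the four lists together reach
  from 0 to 184320, that is t = 45. The widths are nearly proportional to t over long stretches; the
  narrow intervals of the last list lie around t = 11.4.\<close>

lemma covered_1: "covered 0 [(8, 8, 10, 8), (17, 1, 10, 8), (19, 1, 10, 8), (21, 1, 10, 8), (23, 1, 10, 8), (25, 1, 10, 8), (28, 2, 10, 8), (32, 2, 10, 8), (36, 2, 10, 8), (40, 2, 10, 8), (45, 3, 10, 8), (51, 3, 10, 8), (58, 4, 10, 8), (66, 4, 10, 8), (75, 5, 10, 8), (86, 6, 10, 8), (99, 7, 10, 8), (114, 8, 10, 8), (131, 9, 10, 8), (150, 10, 10, 8)] 160"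
  by code_simp

lemma covered_2: "covered 160 [(172, 12, 10, 8), (198, 14, 10, 8), (228, 16, 10, 8), (262, 18, 10, 8), (301, 21, 10, 8), (346, 24, 10, 8), (398, 28, 10, 8), (458, 32, 10, 8), (527, 37, 10, 8), (607, 43, 10, 8), (700, 50, 10, 8), (807, 57, 10, 8), (930, 66, 10, 8), (1072, 76, 10, 8), (1236, 88, 10, 8), (1425, 101, 10, 8), (1643, 117, 10, 8), (1895, 135, 10, 8), (2186, 156, 10, 8), (2522, 180, 10, 8)] 2702"
  by code_simp

lemma covered_3: "covered 2702 [(2909, 207, 10, 8), (3355, 239, 10, 8), (3870, 276, 10, 8), (4464, 318, 10, 8), (5149, 367, 9, 8), (5940, 424, 9, 8), (6853, 489, 9, 7), (7906, 564, 9, 7), (9121, 651, 9, 7), (10523, 751, 8, 7), (12141, 867, 8, 7), (14008, 1000, 8, 6), (16162, 1154, 8, 6), (18448, 1132, 7, 6), (21086, 1506, 7, 6), (24329, 1737, 7, 6), (27111, 1045, 7, 5), (28848, 692, 7, 5), (30395, 855, 7, 5), (33292, 2042, 7, 5)] 35334"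
  by code_simp

lemma covered_4: "covered 35334 [(38052, 2718, 6, 5), (43035, 2265, 6, 5), (45719, 419, 6, 5), (46359, 221, 6, 5), (46803, 223, 6, 5), (47251, 225, 6, 5), (47915, 439, 6, 5), (49084, 730, 6, 5), (51040, 1226, 6, 4), (54048, 1782, 6, 4), (58465, 2635, 6, 4), (65095, 3995, 6, 4), (74404, 5314, 5, 4), (85850, 6132, 5, 4), (99057, 7075, 5, 3), (114296, 8164, 5, 3), (131880, 9420, 5, 3), (152169, 10869, 4, 3), (175579, 12541, 4, 3)] 184320"
  by code_simp

lemma sum_lessThan_numeral:
  fixes f :: "nat \<Rightarrow> real"
  shows "sum f {..<10} = f 0 + f 1 + f 2 + f 3 + f 4 + f 5 + f 6 + f 7 + f 8 + f 9"
    and "sum f {..<8} = f 0 + f 1 + f 2 + f 3 + f 4 + f 5 + f 6 + f 7"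
  by (simp_all add: eval_nat_numeral)

text \<open>One factor \<open>exp (- x)\<close> is split off every term and its remaining powers are
  bounded at 1 / 16. It also absorbs the linear factor in t, since x exp(-2 x) decreases beyond 45 /
  16.\<close>

lemma two_exp_tail:
  assumes x: "45 / 16 \<le> x"
    and c: "(\<Sum>j<10. \<bar>c1 j\<bar> * (1 / 16) ^ (1 * 2 ^ j - 1)) + (\<Sum>j<8. \<bar>c3 j\<bar> * (1 / 16) ^ (3 * 2 ^ j - 1)) \<le> s"
  shows "\<bar>two_exp c1 c3 x\<bar> \<le> exp (- x) * s" and "exp (- x) \<le> 1 / 16" "x * (exp (- x))\<^sup>2 \<le> 45 / 16 * (1 / 16)\<^sup>2"
proof -
  have "(1 + 45 / 256 + (45 / 256)\<^sup>2 / 2) ^ 16 \<le> exp (45 / 256 :: real) ^ 16"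
    using exp_lower_Taylor_quadratic[of "45 / 256"] by (intro power_mono) auto
  moreover have "exp (45 / 256 :: real) ^ 16 = exp (45 / 16)"
    using exp_of_nat_mult[of 16 "45 / 256 :: real"] by simp
  moreover have "16 \<le> (1 + 45 / 256 + (45 / 256)\<^sup>2 / 2 :: real) ^ 16" by (simp add: power_divide)
  ultimately have "16 \<le> exp (45 / 16 :: real)" by linarith
  then have e: "exp (- (45 / 16)) \<le> (1 / 16 :: real)" by (simp add: exp_minus field_simps)
  moreover have "exp (- x) \<le> exp (- (45 / 16))" using x by simp
  ultimately show E: "exp (- x) \<le> 1 / 16" by linarith
  show "x * (exp (- x))\<^sup>2 \<le> 45 / 16 * (1 / 16)\<^sup>2"
  proof -
    have "1 + 2 * (x - 45 / 16) \<le> exp (2 * (x - 45 / 16))" by (rule exp_ge_add_one_self)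
    then have "45 / 16 * (1 + 2 * (x - 45 / 16)) \<le> 45 / 16 * exp (2 * (x - 45 / 16))" by (rule mult_left_mono) simp
    moreover have "x \<le> 45 / 16 * (1 + 2 * (x - 45 / 16))" using x by simp
    ultimately have "x \<le> 45 / 16 * exp (2 * (x - 45 / 16))" by (rule order_trans[rotated])
    then have "x * (exp (- x))\<^sup>2 \<le> 45 / 16 * exp (2 * (x - 45 / 16)) * (exp (- x))\<^sup>2" by (rule mult_right_mono) simp
    also have "\<dots> = 45 / 16 * (exp (- (45 / 16)))\<^sup>2"
      by (simp add: power2_eq_square flip: exp_add)
    also have "\<dots> \<le> 45 / 16 * (1 / 16)\<^sup>2" using e by (intro mult_left_mono power_mono) auto
    finally show ?thesis .
  qed
  have *: "\<bar>\<Sum>j<N. c j * exp (- (real (m * 2 ^ j) * x))\<bar> \<le> exp (- x) * (\<Sum>j<N. \<bar>c j\<bar> * (1 / 16) ^ (m * 2 ^ j - 1))"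
    if "0 < m" for c :: "nat \<Rightarrow> real" and m N :: nat
  proof -
    have "\<bar>\<Sum>j<N. c j * exp (- (real (m * 2 ^ j) * x))\<bar> \<le> (\<Sum>j<N. \<bar>c j * exp (- (real (m * 2 ^ j) * x))\<bar>)" by (rule sum_abs)
    also have "\<dots> \<le> (\<Sum>j<N. \<bar>c j\<bar> * (exp (- x) * (1 / 16) ^ (m * 2 ^ j - 1)))"
    proof (rule sum_mono)
      fix j
      have "0 < m * 2 ^ j" using that by simp
      then obtain k where k: "m * 2 ^ j = Suc k" using gr0_implies_Suc by blast
      have "exp (- (real (m * 2 ^ j) * x)) = exp (- x) ^ Suc k"
        unfolding k exp_of_nat_mult[symmetric] by simp
      also have "\<dots> \<le> exp (- x) * (1 / 16) ^ k" using E by (simp add: power_mono)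
      finally have "\<bar>c j\<bar> * exp (- (real (m * 2 ^ j) * x)) \<le> \<bar>c j\<bar> * (exp (- x) * (1 / 16) ^ k)"
        by (rule mult_left_mono) simp
      then show "\<bar>c j * exp (- (real (m * 2 ^ j) * x))\<bar> \<le> \<bar>c j\<bar> * (exp (- x) * (1 / 16) ^ (m * 2 ^ j - 1))"
        by (simp add: abs_mult k)
    qed
    finally show ?thesis by (simp add: sum_distrib_left mult.left_commute)
  qed
  have "\<bar>two_exp c1 c3 x\<bar> \<le> exp (- x) * (\<Sum>j<10. \<bar>c1 j\<bar> * (1 / 16) ^ (1 * 2 ^ j - 1)) + exp (- x) * (\<Sum>j<8. \<bar>c3 j\<bar> * (1 / 16) ^ (3 * 2 ^ j - 1))"
    unfolding two_exp_def using *[where m = 1 and N = 10 and c = c1] *[where m = 3 and N = 8 and c = c3] by linarith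
  also have "\<dots> = exp (- x) * ((\<Sum>j<10. \<bar>c1 j\<bar> * (1 / 16) ^ (1 * 2 ^ j - 1)) + (\<Sum>j<8. \<bar>c3 j\<bar> * (1 / 16) ^ (3 * 2 ^ j - 1)))"
    by (simp only: distrib_left)
  also have "\<dots> \<le> exp (- x) * s" using c by (intro mult_left_mono) auto
  finally show "\<bar>two_exp c1 c3 x\<bar> \<le> exp (- x) * s" .
qed

section \<open>Comparison of the Laguerre coefficients for all l\<close>

definition geo :: "int list \<Rightarrow> nat \<Rightarrow> real" where
  "geo C l = (\<Sum>j<18. real_of_int (C ! j) * (real (up_exps ! j) / (16 + real (up_exps ! j))) ^ l)"

text \<open>The scaling makes \<open>geo KL\<close> and \<open>geo RL\<close> the Laguerre coefficients of the two test functions.\<close>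

definition up_s :: "nat \<Rightarrow> real" where "up_s j = real (up_exps ! j) / 16"
definition up_a :: "nat \<Rightarrow> real" where "up_a j = real_of_int (KL ! j) * (1 + up_s j)\<^sup>2 / 2 ^ 40"
definition up_b :: "nat \<Rightarrow> real" where "up_b j = real_of_int (RL ! j) * up_s j / 2 ^ 40"

lemma up_exps_nth: "j < 10 \<Longrightarrow> up_exps ! j = 2 ^ j" "j < 8 \<Longrightarrow> up_exps ! (10 + j) = 3 * 2 ^ j"
proof -
  have "up_exps = map (\<lambda>j. 2 ^ j) [0..<10] @ map (\<lambda>j. 3 * 2 ^ j) [0..<8]"
    by (simp add: up_exps_def upt_conv_Cons)
  note * = this
  show "j < 10 \<Longrightarrow> up_exps ! j = 2 ^ j" "j < 8 \<Longrightarrow> up_exps ! (10 + j) = 3 * 2 ^ j"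
    unfolding * by (simp_all add: nth_append del: upt_rec_numeral)
qed

lemma expsum_two_exp:
  "expsum {..<18} c up_s t = two_exp c (\<lambda>j. c (10 + j)) (t / 16)"
proof -
  have "{..<18::nat} = {..<10} \<union> (\<lambda>j. 10 + j) ` {..<8}"
  proof (intro set_eqI iffI)
    fix x :: nat assume "x \<in> {..<18}"
    then show "x \<in> {..<10} \<union> (\<lambda>j. 10 + j) ` {..<8}" by (cases "x < 10") (auto intro!: image_eqI[where x = "x - 10"])
  qed auto
  then have "expsum {..<18} c up_s t = (\<Sum>j<10. c j * exp (- (up_s j * t))) + (\<Sum>j\<in>(\<lambda>j. 10 + j) ` {..<8}. c j * exp (- (up_s j * t)))"
    unfolding expsum_def by (simp only:) (subst sum.union_disjoint, auto)
  also have "(\<Sum>j\<in>(\<lambda>j. 10 + j) ` {..<8}. c j * exp (- (up_s j * t))) = (\<Sum>j<8. c (10 + j) * exp (- (up_s (10 + j) * t)))"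
    by (subst sum.reindex) (auto simp: inj_on_def)
  also have "\<dots> = (\<Sum>j<8. c (10 + j) * exp (- (real (3 * 2 ^ j) * (t / 16))))"
    by (intro sum.cong refl) (simp add: up_s_def up_exps_nth)
  also have "(\<Sum>j<10. c j * exp (- (up_s j * t))) = (\<Sum>j<10. c j * exp (- (real (1 * 2 ^ j) * (t / 16))))"
    by (intro sum.cong refl) (simp add: up_s_def up_exps_nth)
  finally show ?thesis unfolding two_exp_def .
qed

lemma all_less_numeral:
  "(\<forall>j<10. P j) \<longleftrightarrow> P 0 \<and> P 1 \<and> P 2 \<and> P 3 \<and> P 4 \<and> P 5 \<and> P 6 \<and> P 7 \<and> P 8 \<and> P (9::nat)"
  "(\<forall>j<8. P j) \<longleftrightarrow> P 0 \<and> P 1 \<and> P 2 \<and> P 3 \<and> P 4 \<and> P 5 \<and> P 6 \<and> P (7::nat)"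
  by (simp_all add: eval_nat_numeral less_Suc_eq all_conj_distrib)

text \<open>The test functions are defined exactly through \<open>KL\<close> and \<open>RL\<close>;
  the lists \<open>A1\<close>, \<open>A3\<close>, \<open>B1\<close>, \<open>B3\<close> are the
  roundings used in the interval evaluation.\<close>

lemma up_coeffs:
  "\<forall>j<10. \<bar>2 ^ 36 * up_a j - real_of_int (A1 ! j)\<bar> \<le> 1" "\<forall>j<8. \<bar>2 ^ 36 * up_a (10 + j) - real_of_int (A3 ! j)\<bar> \<le> 1"
  "\<forall>j<10. \<bar>2 ^ 36 * up_b j - real_of_int (B1 ! j)\<bar> \<le> 1" "\<forall>j<8. \<bar>2 ^ 36 * up_b (10 + j) - real_of_int (B3 ! j)\<bar> \<le> 1"
  unfolding all_less_numeral
  by (simp_all add: up_a_def up_b_def up_s_def KL_def RL_def up_exps_def A1_def A3_def B1_def B3_def power2_eq_square)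

lemma up_pointwise:
  assumes t: "0 \<le> t"
  shows "t * (expsum {..<18} up_a up_s t)\<^sup>2 + (expsum {..<18} up_b up_s t)\<^sup>2 \<le> 1"
proof (cases "t < 45")
  case True
  note c = covered_sound[OF _ _ _ t up_coeffs[rule_format]]
  consider "4096 * t < 160" | "160 \<le> 4096 * t" "4096 * t < 2702" | "2702 \<le> 4096 * t" "4096 * t < 35334" | "35334 \<le> 4096 * t"
    by linarith
  then show ?thesis unfolding expsum_two_exp
    using c[OF covered_1] c[OF covered_2] c[OF covered_3] c[OF covered_4] t True by cases simp_all
next
  case False
  then have x: "45 / 16 \<le> t / 16" by simp
  have a: "(\<Sum>j<10. \<bar>up_a j\<bar> * (1 / 16) ^ (1 * 2 ^ j - 1)) + (\<Sum>j<8. \<bar>up_a (10 + j)\<bar> * (1 / 16) ^ (3 * 2 ^ j - 1)) \<le> 21 / 10"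
    unfolding sum_lessThan_numeral
    by (simp add: up_a_def up_s_def KL_def up_exps_def power_divide power2_eq_square)
  have b: "(\<Sum>j<10. \<bar>up_b j\<bar> * (1 / 16) ^ (1 * 2 ^ j - 1)) + (\<Sum>j<8. \<bar>up_b (10 + j)\<bar> * (1 / 16) ^ (3 * 2 ^ j - 1)) \<le> 1"
    unfolding sum_lessThan_numeral
    by (simp add: up_b_def up_s_def RL_def up_exps_def power_divide)
  note A = two_exp_tail[OF x a] and B = two_exp_tail[OF x b]
  have "t * (expsum {..<18} up_a up_s t)\<^sup>2 \<le> t * (exp (- (t / 16)) * (21 / 10))\<^sup>2"
    unfolding expsum_two_exp using A(1) t by (intro mult_left_mono) (simp_all add: abs_le_square_iff[symmetric] abs_mult)
  also have "\<dots> = 16 * (21 / 10)\<^sup>2 * (t / 16 * (exp (- (t / 16)))\<^sup>2)" by (simp add: power2_eq_square)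
  also have "\<dots> \<le> 16 * (21 / 10)\<^sup>2 * (45 / 16 * (1 / 16)\<^sup>2)" by (intro mult_left_mono A(3)) auto
  finally have 1: "t * (expsum {..<18} up_a up_s t)\<^sup>2 \<le> 9 / 10" by (simp add: power2_eq_square)
  have "\<bar>expsum {..<18} up_b up_s t\<bar> \<le> 1 / 16" unfolding expsum_two_exp using B(1,2) by simp
  then have "\<bar>expsum {..<18} up_b up_s t\<bar>\<^sup>2 \<le> (1 / 16)\<^sup>2" by (intro power_mono) auto
  then show ?thesis using 1 by (simp add: power2_eq_square)
qed

lemma coeffs_ok: "coeffs_ok 300 1 ZL"
  by code_simp

definition up_z :: "nat \<Rightarrow> real" where "up_z j = real (up_exps ! j) / (16 + real (up_exps ! j))"

text \<open>All truncation is downward, so the entries never exceed the scaled powers. Each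
  multiplication costs at most two units, one for the rounding of \<open>ZL\<close> and one for the
  product.\<close>

definition near_powers :: "nat \<Rightarrow> int list \<Rightarrow> bool" where
  "near_powers l xs \<longleftrightarrow> length xs = 18 \<and> (\<forall>j<18. 0 \<le> real_of_int (xs ! j) \<and> real_of_int (xs ! j) \<le> 2 ^ 56 * up_z j ^ l
     \<and> 2 ^ 56 * up_z j ^ l \<le> real_of_int (xs ! j) + 2 * real l)"

lemma all_less_18: "(\<forall>j<18. P j) \<longleftrightarrow> (\<forall>j<10. P j) \<and> (\<forall>j<8. P (10 + j :: nat))"
proof -
  have "P j" if "\<forall>j<10. P j" "\<forall>j<8. P (10 + j)" "j < 18" for j
    using that(1,3) that(2)[rule_format, of "j - 10"] by (cases "j < 10") auto
  then show ?thesis by auto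
qed

lemma up_z_bounds: "0 \<le> up_z j" "up_z j < 1"
  by (simp_all add: up_z_def)

lemma ZL_bounds: "\<forall>j<18. 0 \<le> real_of_int (ZL ! j) \<and> real_of_int (ZL ! j) \<le> 2 ^ 56 * up_z j \<and> 2 ^ 56 * up_z j \<le> real_of_int (ZL ! j) + 1"
  unfolding all_less_18 all_less_numeral by (simp add: ZL_def up_z_def up_exps_def)

lemma length_ZL: "length ZL = 18" by (simp add: ZL_def)

lemma near_powers_ZL: "near_powers 1 ZL"
  using ZL_bounds unfolding near_powers_def by (force simp: length_ZL)

lemma advance_eq_map2: "advance zs xs = map2 (\<lambda>z x. drop_bit 56 (x * z)) zs xs"
  by (induction zs xs rule: advance.induct) auto

lemma near_powers_advance:
  assumes "near_powers l xs" shows "near_powers (Suc l) (advance ZL xs)"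
  unfolding near_powers_def
proof (intro conjI allI impI)
  have len: "length xs = 18" using assms by (simp add: near_powers_def)
  show "length (advance ZL xs) = 18" by (simp add: advance_eq_map2 len length_ZL)
  fix j :: nat assume j: "j < 18"
  define Z where "Z = real_of_int (ZL ! j)"
  define x where "x = real_of_int (xs ! j)"
  define w where "w = 2 ^ 56 * up_z j ^ l"
  define v where "v = 2 ^ 56 * up_z j"
  have e: "advance ZL xs ! j = drop_bit 56 (xs ! j * ZL ! j)" using j by (simp add: advance_eq_map2 len length_ZL)
  have b: "x * Z / 2 ^ 56 - 1 \<le> real_of_int (advance ZL xs ! j)" "real_of_int (advance ZL xs ! j) \<le> x * Z / 2 ^ 56"
    unfolding e using drop_bit_bounds[where x = "xs ! j * ZL ! j" and n = 56] by (simp_all add: x_def Z_def)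
  have x: "0 \<le> x" "x \<le> w" "w \<le> x + 2 * real l"
    using assms j unfolding near_powers_def x_def w_def by auto
  have Z: "0 \<le> Z" "Z \<le> v" "v \<le> Z + 1" using ZL_bounds j unfolding Z_def v_def by auto
  have v: "v \<le> 2 ^ 56" "w \<le> 2 ^ 56"
    using up_z_bounds[of j] power_le_one[of "up_z j" l] unfolding v_def w_def by auto
  have wv: "2 ^ 56 * up_z j ^ Suc l = w * v / 2 ^ 56" unfolding w_def v_def by simp
  have "x * Z \<le> w * v" using x Z by (intro mult_mono) auto
  then show "real_of_int (advance ZL xs ! j) \<le> 2 ^ 56 * up_z j ^ Suc l"
    unfolding wv using b(2) divide_right_mono[of "x * Z" "w * v" "2 ^ 56"] by simp
  have "0 \<le> xs ! j * ZL ! j" using x(1) Z(1) unfolding x_def Z_def by simp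
  then show "0 \<le> real_of_int (advance ZL xs ! j)" unfolding e by simp
  have "w * v \<le> (x + 2 * real l) * v" using x Z by (intro mult_right_mono) auto
  also have "\<dots> = x * v + 2 * real l * v" by (simp add: algebra_simps)
  also have "\<dots> \<le> x * (Z + 1) + 2 * real l * 2 ^ 56" using x Z v by (intro add_mono mult_left_mono) auto
  also have "\<dots> \<le> x * Z + 2 ^ 56 + 2 * real l * 2 ^ 56" using x v by (simp add: algebra_simps)
  finally have "w * v / 2 ^ 56 \<le> (x * Z + 2 ^ 56 + 2 * real l * 2 ^ 56) / 2 ^ 56" by (rule divide_right_mono) simp
  then show "2 ^ 56 * up_z j ^ Suc l \<le> real_of_int (advance ZL xs ! j) + 2 * real (Suc l)"
    unfolding wv using b(1) by (simp add: add_divide_distrib)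
qed

lemma dot_eq_sum: "length xs = length ys \<Longrightarrow> dot xs ys = (\<Sum>j<length xs. xs ! j * ys ! j)"
  by (induction xs ys rule: dot.induct) (simp_all add: sum.lessThan_Suc_shift del: sum.lessThan_Suc)

lemma geo_eq: "geo C l = (\<Sum>j<18. real_of_int (C ! j) * up_z j ^ l)"
  by (simp add: geo_def up_z_def)

lemma dot_sound:
  assumes xs: "near_powers l xs" and C: "length C = 18"
  shows "\<bar>real_of_int (dot C xs) - 2 ^ 56 * geo C l\<bar> \<le> 2 * real_of_int (sum_list (map abs C)) * real l"
proof -
  have d: "real_of_int (dot C xs) = (\<Sum>j<18. real_of_int (C ! j) * real_of_int (xs ! j))"
    using xs C by (simp add: dot_eq_sum near_powers_def)
  have "\<bar>real_of_int (dot C xs) - 2 ^ 56 * geo C l\<bar> = \<bar>\<Sum>j<18. real_of_int (C ! j) * (real_of_int (xs ! j) - 2 ^ 56 * up_z j ^ l)\<bar>"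
    unfolding d geo_eq sum_distrib_left sum_subtractf[symmetric]
    by (intro arg_cong[where f = abs] sum.cong refl) (simp add: algebra_simps)
  also have "\<dots> \<le> (\<Sum>j<18. \<bar>real_of_int (C ! j) * (real_of_int (xs ! j) - 2 ^ 56 * up_z j ^ l)\<bar>)" by (rule sum_abs)
  also have "\<dots> \<le> (\<Sum>j<18. \<bar>real_of_int (C ! j)\<bar> * (2 * real l))"
    unfolding abs_mult using xs by (intro sum_mono mult_left_mono) (auto simp: near_powers_def abs_le_iff)
  also have "\<dots> = 2 * real_of_int (sum_list (map abs C)) * real l"
    unfolding sum_distrib_right[symmetric] by (simp add: sum_list_sum_nth atLeast0LessThan C)
  finally show ?thesis .
qed

lemma sq_le_sound:
  assumes "sq_le l d f" "0 \<le> l" "\<bar>D\<bar> \<le> real_of_int d" "real_of_int f \<le> F"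
  shows "0 \<le> F" "real_of_int l * D\<^sup>2 \<le> F\<^sup>2"
proof -
  have f: "0 \<le> f" "l * (d * d) \<le> f * f" using assms(1) by (auto simp: sq_le_def)
  show "0 \<le> F" using f assms(4) by (meson of_int_0_le_iff order_trans)
  have "D\<^sup>2 \<le> (real_of_int d)\<^sup>2" using assms(3) by (simp flip: abs_le_square_iff)
  then have "real_of_int l * D\<^sup>2 \<le> real_of_int l * (real_of_int d)\<^sup>2" using assms(2) by (intro mult_left_mono) auto
  also have "\<dots> = real_of_int (l * (d * d))" by (simp add: power2_eq_square)
  also have "\<dots> \<le> real_of_int (f * f)" using f(2) by (simp only: of_int_le_iff)
  also have "\<dots> = (real_of_int f)\<^sup>2" by (simp add: power2_eq_square)
  also have "\<dots> \<le> F\<^sup>2" using f assms(4) by (intro power_mono) auto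
  finally show "real_of_int l * D\<^sup>2 \<le> F\<^sup>2" .
qed

lemma scaled_sq_le:
  assumes "0 \<le> (F::real)" "real (l + 1) * (2 ^ 16 * D)\<^sup>2 \<le> (2 ^ 16 * F)\<^sup>2"
  shows "real (l + 1) * D\<^sup>2 \<le> F\<^sup>2"
  using assms(2) by (simp add: power_mult_distrib)

text \<open>Shared by the individual tests and the tail test: in the latter the scalar product with
  \<open>KA\<close> is nonnegative and serves as its own bound \<open>u\<close>. Dropping 40 of the
  56 fractional bits keeps the squares short and leaves the factor 2^16.\<close>

lemma coeff_test:
  assumes ok: "sq_le (int l + 1) (drop_bit 40 (u + 2 * KS * int l) + 1) (drop_bit 40 (dot R xs - 2 * RS * int l))"
    and xs: "near_powers l xs" and len: "length K = 18" "length R = 18"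
    and s: "sum_list (map abs K) = KS" "sum_list (map abs R) = RS" and u: "\<bar>dot K xs\<bar> \<le> u"
  shows "real (l + 1) * (geo K l)\<^sup>2 \<le> (geo R l)\<^sup>2" "0 \<le> geo R l"
proof -
  have "real_of_int \<bar>dot K xs\<bar> \<le> real_of_int u" using u by (simp only: of_int_le_iff)
  then have "2 ^ 56 * \<bar>geo K l\<bar> \<le> real_of_int (u + 2 * KS * int l)"
    using dot_sound[OF xs len(1)] unfolding s by (simp add: abs_le_iff) (simp add: abs_if split: if_splits)
  moreover define V where "V = u + 2 * KS * int l"
  ultimately have "2 ^ 56 * \<bar>geo K l\<bar> \<le> real_of_int V" by (simp only:)
  then have "\<bar>2 ^ 16 * geo K l\<bar> \<le> real_of_int (drop_bit 40 V + 1)"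
    using drop_bit_bounds(1)[where x = V and n = 40] by (simp add: abs_mult)
  then have d: "\<bar>2 ^ 16 * geo K l\<bar> \<le> real_of_int (drop_bit 40 (u + 2 * KS * int l) + 1)" by (simp only: V_def)
  have f: "real_of_int (drop_bit 40 (dot R xs - 2 * RS * int l)) \<le> 2 ^ 16 * geo R l"
    using drop_bit_bounds(2)[where x = "dot R xs - 2 * RS * int l" and n = 40] dot_sound[OF xs len(2)] unfolding s by (simp add: abs_le_iff)
  have "0 \<le> int l + 1" by simp
  note r = sq_le_sound[OF ok this d f]
  show R: "0 \<le> geo R l" using r(1) by simp
  have "real_of_int (int l + 1) = real (l + 1)" by simp
  from R r(2)[unfolded this] show "real (l + 1) * (geo K l)\<^sup>2 \<le> (geo R l)\<^sup>2" by (rule scaled_sq_le)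
qed

lemma abs_sums:
  "sum_list (map abs KL) = 21408233263193" "sum_list (map abs RL) = 897727068243"
  "sum_list (map abs KA) = 21408233263193" "sum_list (map abs RN) = 51718599181"
  "length KL = 18" "length RL = 18" "length KA = 18" "length RN = 18"
  by (simp_all add: KL_def RL_def KA_def RN_def)

lemma coeffs_ok_sound:
  assumes "coeffs_ok n (int l) xs" "near_powers l xs"
  shows "(\<forall>k. l \<le> k \<and> k < l + n \<longrightarrow> real (k + 1) * (geo KL k)\<^sup>2 \<le> (geo RL k)\<^sup>2)
    \<and> real (l + n + 1) * (geo KA (l + n))\<^sup>2 \<le> (geo RN (l + n))\<^sup>2 \<and> 0 \<le> geo RN (l + n)"
  using assms
proof (induction n arbitrary: l xs)
  case 0
  have nn: "\<bar>dot KA xs\<bar> \<le> dot KA xs"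
  proof -
    have "0 \<le> real_of_int (KA ! j) * real_of_int (xs ! j)" if "j < 18" for j
    proof -
      have "\<forall>j<18. 0 \<le> KA ! j" unfolding all_less_18 all_less_numeral by (simp add: KA_def)
      then show ?thesis using that 0(2) by (intro mult_nonneg_nonneg) (auto simp: near_powers_def)
    qed
    then have "0 \<le> (\<Sum>j<18. real_of_int (KA ! j) * real_of_int (xs ! j))" by (intro sum_nonneg) simp
    also have "\<dots> = real_of_int (dot KA xs)" using 0(2) by (simp add: dot_eq_sum near_powers_def abs_sums)
    finally have "0 \<le> real_of_int (dot KA xs)" .
    then show ?thesis by simp
  qed
  show ?case using coeff_test[OF _ 0(2) abs_sums(7,8,3,4) nn] 0(1) by (simp add: tail_ok_def)
next
  case (Suc n)
  have ok: "coeff_ok (int l) xs" "coeffs_ok n (int (Suc l)) (advance ZL xs)" using Suc(2) by (simp_all add: add.commute)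
  have 1: "real (l + 1) * (geo KL l)\<^sup>2 \<le> (geo RL l)\<^sup>2"
    using coeff_test(1)[OF _ Suc(3) abs_sums(5,6,1,2) order_refl] ok(1) by (simp add: coeff_ok_def)
  note IH = Suc.IH[OF ok(2) near_powers_advance[OF Suc(3)]]
  have "real (k + 1) * (geo KL k)\<^sup>2 \<le> (geo RL k)\<^sup>2" if "l \<le> k" "k < l + Suc n" for k
    using 1 IH that by (cases "k = l") auto
  then show ?case using IH by simp
qed

text \<open>Per step \<open>geo KA\<close> shrinks at least by 24 / 25, the ratio of exponent 384,
  as the entry of exponent 512 is 0. In \<open>geo RN\<close> the only positive term shrinks by 32 /
  33 and the negative ones at least as fast. For l \<ge> 100 the growth of the square root fits
  between the two ratios.\<close>

lemma geo_tail:
  assumes l: "100 \<le> l" and b: "sqrt (real (l + 1)) * geo KA l \<le> geo RN l"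
  shows "sqrt (real (l + n + 1)) * geo KA (l + n) \<le> geo RN (l + n)"
proof (induction n)
  case (Suc n)
  define k where "k = l + n"
  have ka: "geo KA (Suc k) \<le> 24 / 25 * geo KA k" "0 \<le> geo KA k"
  proof -
    have "\<forall>j<18. 0 \<le> KA ! j \<and> (KA ! j = 0 \<or> up_z j \<le> 24 / 25)"
      unfolding all_less_18 all_less_numeral by (simp add: KA_def up_z_def up_exps_def)
    then have z: "0 \<le> KA ! j" "KA ! j = 0 \<or> up_z j \<le> 24 / 25" if "j < 18" for j using that by auto
    show "geo KA (Suc k) \<le> 24 / 25 * geo KA k"
      unfolding geo_eq sum_distrib_left
    proof (rule sum_mono)
      fix j :: nat assume "j \<in> {..<18}"
      then have "real_of_int (KA ! j) * up_z j ^ k * up_z j \<le> real_of_int (KA ! j) * up_z j ^ k * (24 / 25)"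
        using z[of j] up_z_bounds[of j] by (cases "KA ! j = 0") (auto intro!: mult_left_mono)
      then show "real_of_int (KA ! j) * up_z j ^ Suc k \<le> 24 / 25 * (real_of_int (KA ! j) * up_z j ^ k)" by (simp add: mult_ac)
    qed
    show "0 \<le> geo KA k" unfolding geo_eq using z up_z_bounds by (intro sum_nonneg mult_nonneg_nonneg) auto
  qed
  have rn: "32 / 33 * geo RN k \<le> geo RN (Suc k)"
  proof -
    have "\<forall>j<18. up_z j = 32 / 33 \<or> RN ! j \<le> 0 \<and> up_z j \<le> 32 / 33"
      unfolding all_less_18 all_less_numeral by (simp add: RN_def up_z_def up_exps_def)
    then have z: "up_z j = 32 / 33 \<or> RN ! j \<le> 0 \<and> up_z j \<le> 32 / 33" if "j < 18" for j using that by auto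
    show ?thesis
      unfolding geo_eq sum_distrib_left
    proof (rule sum_mono)
      fix j :: nat assume "j \<in> {..<18}"
      then have j: "j < 18" by simp
      have "real_of_int (RN ! j) * up_z j ^ k * (32 / 33) \<le> real_of_int (RN ! j) * up_z j ^ k * up_z j"
        using z[OF j]
      proof
        assume "RN ! j \<le> 0 \<and> up_z j \<le> 32 / 33"
        then show ?thesis using up_z_bounds[of j] by (intro mult_left_mono_neg mult_nonpos_nonneg) auto
      qed (simp only: order_refl)
      then show "32 / 33 * (real_of_int (RN ! j) * up_z j ^ k) \<le> real_of_int (RN ! j) * up_z j ^ Suc k" by (simp add: mult_ac)
    qed
  qed
  have s: "sqrt (real (k + 2)) * (24 / 25) \<le> 32 / 33 * sqrt (real (k + 1))"
  proof (rule power2_le_imp_le)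
    have "100 \<le> real k" using l by (simp add: k_def)
    then show "(sqrt (real (k + 2)) * (24 / 25))\<^sup>2 \<le> (32 / 33 * sqrt (real (k + 1)))\<^sup>2"
      by (simp add: power_mult_distrib power_divide)
  qed simp
  have "sqrt (real (k + 2)) * geo KA (Suc k) \<le> sqrt (real (k + 2)) * (24 / 25 * geo KA k)"
    using ka by (intro mult_left_mono) auto
  also have "\<dots> = sqrt (real (k + 2)) * (24 / 25) * geo KA k" by simp
  also have "\<dots> \<le> 32 / 33 * sqrt (real (k + 1)) * geo KA k" using s ka by (intro mult_right_mono) auto
  also have "\<dots> = 32 / 33 * (sqrt (real (k + 1)) * geo KA k)" by simp
  also have "\<dots> \<le> 32 / 33 * geo RN k" using Suc by (intro mult_left_mono) (auto simp: k_def)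
  also have "\<dots> \<le> geo RN (Suc k)" by (rule rn)
  finally show ?case by (simp add: k_def)
qed (use b in simp)

text \<open>The orders 1 to 300 are tested one by one. At 301 the stronger inequality between
  absolute values \<open>KA\<close> and the reduced list \<open>RN\<close> is tested, and it
  propagates.\<close>

lemma geo_KL_le_geo_RL:
  assumes "1 \<le> l" shows "real (l + 1) * (geo KL l)\<^sup>2 \<le> (geo RL l)\<^sup>2"
proof (cases "l < 301")
  case True
  then show ?thesis using coeffs_ok_sound[of 300 1 ZL] coeffs_ok near_powers_ZL assms by auto
next
  case False
  have t: "real (301 + 1) * (geo KA 301)\<^sup>2 \<le> (geo RN 301)\<^sup>2" "0 \<le> geo RN 301"
    using coeffs_ok_sound[of 300 1 ZL] coeffs_ok near_powers_ZL by auto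
  have "sqrt (real (301 + 1)) * geo KA 301 \<le> geo RN 301"
  proof (rule power2_le_imp_le)
    show "(sqrt (real (301 + 1)) * geo KA 301)\<^sup>2 \<le> (geo RN 301)\<^sup>2" using t(1) by (simp add: power_mult_distrib)
  qed (rule t(2))
  then have "sqrt (real (301 + (l - 301) + 1)) * geo KA (301 + (l - 301)) \<le> geo RN (301 + (l - 301))"
    by (intro geo_tail) simp_all
  then have r: "sqrt (real (l + 1)) * geo KA l \<le> geo RN l" using False by simp
  have "\<forall>j<18. KA ! j = \<bar>KL ! j\<bar> \<and> RN ! j \<le> RL ! j"
    unfolding all_less_18 all_less_numeral by (simp add: KA_def KL_def RN_def RL_def)
  then have c: "KA ! j = \<bar>KL ! j\<bar>" "RN ! j \<le> RL ! j" if "j < 18" for j using that by auto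
  have "\<bar>geo KL l\<bar> \<le> (\<Sum>j<18. \<bar>real_of_int (KL ! j) * up_z j ^ l\<bar>)" unfolding geo_eq by (rule sum_abs)
  also have "\<dots> = geo KA l" unfolding geo_eq using c up_z_bounds by (intro sum.cong) (auto simp: abs_mult)
  finally have k: "\<bar>geo KL l\<bar> \<le> geo KA l" .
  have "geo RN l \<le> geo RL l" unfolding geo_eq using c up_z_bounds by (intro sum_mono mult_right_mono) auto
  then have "sqrt (real (l + 1)) * \<bar>geo KL l\<bar> \<le> geo RL l"
    using r mult_left_mono[OF k real_sqrt_ge_zero[OF of_nat_0_le_iff[of "l + 1"]]] by linarith
  then have "(sqrt (real (l + 1)) * \<bar>geo KL l\<bar>)\<^sup>2 \<le> (geo RL l)\<^sup>2" by (intro power_mono) auto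
  then show ?thesis by (simp add: power_mult_distrib)
qed

theorem admissible_upper:
  assumes "admissible \<Lambda> \<rho> \<beta> W"
  shows "(1 - \<rho>) / (\<rho> + mu_val W) \<le> 1.35584691"
proof -
  have s: "0 \<le> up_s j" for j by (simp add: up_s_def)
  have z: "up_s j / (1 + up_s j) = up_z j" for j by (simp add: up_s_def up_z_def divide_simps)
  have a: "up_a j * (1 / (1 + up_s j))\<^sup>2 = real_of_int (KL ! j) / 2 ^ 40" for j
    using s[of j] by (simp add: up_a_def power_divide)
  \<comment> \<open>The factor \<open>up_s j\<close> in \<open>up_b\<close> supplies one extra power
    of the ratio: the coefficient of order l of the second function is \<open>geo RL\<close> at l +
    1, aligned with that of order l + 1 of the first.\<close>
  have b: "up_b j * (1 / (1 + up_s j)) = real_of_int (RL ! j) * up_z j / 2 ^ 40" for j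
    by (simp add: up_b_def flip: z)
  have g: "(\<Sum>j<18. up_a j * (1 / (1 + up_s j))\<^sup>2 * (up_s j / (1 + up_s j)) ^ l) = geo KL l / 2 ^ 40" for l
    unfolding a z geo_eq sum_divide_distrib by (intro sum.cong refl) simp
  have f: "(\<Sum>j<18. up_b j * (1 / (1 + up_s j)) * (up_s j / (1 + up_s j)) ^ l) = geo RL (Suc l) / 2 ^ 40" for l
    unfolding b z geo_eq sum_divide_distrib by (intro sum.cong refl) simp
  have m: "geo KL 0 / 2 ^ 40 = (\<Sum>j<18. up_a j * (1 / (1 + up_s j))\<^sup>2)" using g[of 0] by simp
  \<comment> \<open>The sum of the entries of \<open>KL\<close>; the resulting m is about
    0.8588.\<close>
  have m0: "geo KL 0 = 944266320597"
    unfolding geo_eq by (simp add: eval_nat_numeral KL_def)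
  have "(1 - \<rho>) / (\<rho> + mu_val W) \<le> 1 / (geo KL 0 / 2 ^ 40)\<^sup>2"
  proof (rule upper_bound_by_expsums[OF assms s s up_pointwise _ m])
    fix l
    have "real (Suc l + 1) * (geo KL (Suc l))\<^sup>2 \<le> (geo RL (Suc l))\<^sup>2" by (rule geo_KL_le_geo_RL) simp
    then show "real (l + 2) * (\<Sum>j<18. up_a j * (1 / (1 + up_s j))\<^sup>2 * (up_s j / (1 + up_s j)) ^ (l + 1))\<^sup>2
      \<le> (\<Sum>j<18. up_b j * (1 / (1 + up_s j)) * (up_s j / (1 + up_s j)) ^ l)\<^sup>2"
      unfolding g f by (simp add: power_divide divide_right_mono)
  qed (simp_all add: m0)
  also have "\<dots> \<le> 1.35584691" unfolding m0 by (simp add: power_divide)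
  finally show ?thesis .
qed

section \<open>An admissible family for the lower bound\<close>

text \<open>A list entry \<open>(i, c)\<close> stands for the function \<open>c * exp (- i / 8 * t)\<close>; lists are sorted by \<open>i\<close>.\<close>

fun sadd :: "(int \<times> int) list \<Rightarrow> (int \<times> int) list \<Rightarrow> (int \<times> int) list" where
  "sadd [] q = q"
| "sadd (x # p) [] = x # p"
| "sadd ((i, c) # p) ((j, d) # q) =
    (if i < j then (i, c) # sadd p ((j, d) # q)
     else if j < i then (j, d) # sadd ((i, c) # p) q
     else (i, c + d) # sadd p q)"

fun smono :: "int \<Rightarrow> int \<Rightarrow> (int \<times> int) list \<Rightarrow> (int \<times> int) list" where
  "smono i c [] = []"
| "smono i c ((j, d) # q) = (i + j, c * d) # smono i c q"

fun smul :: "(int \<times> int) list \<Rightarrow> (int \<times> int) list \<Rightarrow> (int \<times> int) list" where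
  "smul [] q = []"
| "smul ((i, c) # p) q = sadd (smono i c q) (smul p q)"

text \<open>The moment of order k of exp(-i t / 8) is k! (8 / (8 + i))^(k + 1). The starting list
  holds the terms for k = 0, scaled by a / b; \<open>mstep\<close> supplies one more factor of the
  power.\<close>

fun mstart :: "int \<Rightarrow> int \<Rightarrow> (int \<times> int) list \<Rightarrow> (int \<times> int) list" where
  "mstart a b [] = []"
| "mstart a b ((i, c) # p) = (i, a * c * 8 div ((8 + i) * b)) # mstart a b p"

fun mstep :: "(int \<times> int) list \<Rightarrow> (int \<times> int) list" where
  "mstep [] = []"
| "mstep ((i, x) # p) = (i, x * 8 div (8 + i)) # mstep p"

fun ssum :: "(int \<times> int) list \<Rightarrow> int" where
  "ssum [] = 0"
| "ssum ((i, x) # p) = x + ssum p"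

fun moms :: "nat \<Rightarrow> int \<Rightarrow> int \<Rightarrow> (int \<times> int) list \<Rightarrow> int list" where
  "moms 0 f k p = []"
| "moms (Suc n) f k p = f * ssum p # moms n (f * k) (k + 1) (mstep p)"

text \<open>Error bounds parallel to \<open>moms\<close>: a term of order j is off by at most j + 1
  before the factorial is applied, and \<open>b\<close> counts the terms. The argument
  \<open>k\<close> is the order plus one.\<close>

fun errs :: "nat \<Rightarrow> int \<Rightarrow> int \<Rightarrow> int \<Rightarrow> int list" where
  "errs 0 f k b = []"
| "errs (Suc n) f k b = f * (k * b) # errs n (f * k) (k + 1) b"

fun imean :: "int \<Rightarrow> (int \<times> int) list \<Rightarrow> int" where
  "imean s [] = 0"
| "imean s ((j, d) # q) = d * 8 div (8 + j + s) + imean s q"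

text \<open>An upper bound for the mean of a product of two sums with an extra factor exp(-s t / 8):
  each integer quotient in \<open>imean\<close> costs at most 1, weighted by the absolute
  coefficient.\<close>

fun bmean :: "int \<Rightarrow> (int \<times> int) list \<Rightarrow> (int \<times> int) list \<Rightarrow> int" where
  "bmean s [] q = 0"
| "bmean s ((i, c) # p) q = c * imean (s + i) q + \<bar>c\<bar> * int (length q) + bmean s p q"

fun pascal_step :: "int list \<Rightarrow> int list" where
  "pascal_step (a # b # xs) = (a + b) # pascal_step (b # xs)"
| "pascal_step xs = xs"

fun pascal :: "nat \<Rightarrow> int list" where
  "pascal 0 = [1]"
| "pascal (Suc n) = 1 # pascal_step (pascal n)"

fun cfact :: "nat \<Rightarrow> int" where
  "cfact 0 = 1"
| "cfact (Suc n) = (1 + int n) * cfact n"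

text \<open>The numbers (-1)^i 11! / i!, clearing the denominators of the Laguerre
  polynomials.\<close>

definition fact11 :: "int list" where "fact11 = [39916800, -39916800, 19958400, -6652800, 1663200, -332640, 55440, -7920, 990, -110, 11, -1]"

text \<open>The coefficients of \<open>lag k n\<close> times 11!: dropping \<open>k\<close> entries
  leaves n + k choose k + i, which equals n + k choose n - i.\<close>

definition lag_list :: "nat \<Rightarrow> nat \<Rightarrow> int list" where
  "lag_list k n = map2 (*) (drop k (pascal (n + k))) fact11"

fun lag_sum :: "nat \<Rightarrow> int list \<Rightarrow> int list" where
  "lag_sum l [] = []"
| "lag_sum l (e # es) = padd (map ((*) e) (lag_list 1 l)) (lag_sum (Suc l) es)"

text \<open>Scales: \<open>2 ^ 32\<close> for \<open>UL\<close>, \<open>2 ^ 20\<close> for \<open>YL\<close>, \<open>2 ^ 12\<close> for \<open>ZL7\<close>, \<open>2 ^ 34\<close> for \<open>EL\<close> and for \<open>GL\<close> (the list of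
  \<open>1 / \<beta> l\<close>), \<open>2 ^ 112\<close> for the moments \<open>UM\<close> of \<open>U\<close>, \<open>2 ^ 44\<close> for the Laguerre integrals \<open>TT\<close> and \<open>QT\<close> against \<open>U\<close>,
  and \<open>2 ^ 28\<close> for \<open>RT\<close>, a Cholesky factor of \<open>diag GL - QT\<close>.\<close>

definition UL :: "(int \<times> int) list" where "UL = [(1, 10093300619), (2, -58654462265), (3, 219410046170), (4, -455503095819), (5, 525653399756), (6, -275314429137), (8, 43760748164), (16, 2950283336), (32, 5987653513), (64, 4793395596), (128, 3113919233)]"
definition YL :: "(int \<times> int) list" where "YL = [(-1, 231073), (0, 5863657), (1, -9512691), (2, 5168928), (4, -1756563), (8, 346811), (16, -183059), (32, 38769), (64, -32698), (128, 7042)]"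
definition ZL7 :: "(int \<times> int) list" where "ZL7 = [(1, 4464), (2, -4359), (4, 6513), (8, -535), (16, 6942), (48, 6653), (128, 2428)]"
definition EL :: "int list" where "EL = [17179869184, -1710191513, -278321126, -88257405, -36623206, -17967402, -9239503, -5262508, -3473300, -1737851, -2008174]"
definition GL :: "int list" where "GL = [39987146241, 113188618661, 205316241117, 318945632819, 449639978985, 634373954454, 837193289404, 979600548923, 1544240688057, 1072337446940]"
definition UM :: "int list" where
  "UM = [10740161267404418785283281146256729, 5784404516179140002632961795214037, 7881767358195316147178570195083014, 18100777679946917783643232945154112, 59120156580795312040660024960408416, 251208300341491557800049179230175520, 1315853641242266627346169986066175200, 8197926392251064388139260630356944800, 59216875274087634823628072349927087360, 486540356072803620164266761093891939840, 4479408887123914850906357570839260806400, 45655304333761388258094103688848729075200, 509996418317549417846046698512988658508800, 6191032224455355835599100878294423621273600, 81083066708673564957781290276944286175488000, 1138568959794119032581233174355288437441280000, 17049464679211655436014564274696744474230784000, 270993251358394571167636648218967151951745024000, 4553492743685662870600011847345843996648267776000, 80600945367829170905639938357435777176004608000000, 1498340413764595903640501302663105550456585256960000, 29173361811373838307450395096621888415544574115840000]"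
definition UE :: "int list" where "UE = errs 22 1 1 11"
definition TT :: "int list list" where
  "TT = [[36389081809264, 23896898705601, 18939195165802, 16134959648863, 14267533255821, 12868611246957, 11752748154434, 10841645976891, 10089630402436, 9462820382750, 8934536166538],
    [19598324821801, 32903253390807, 43499430201427, 52481022409668, 60205553557446, 66799176984629, 72501269833190, 77571300641144, 82208269814186, 86542279384493, 90652664627518],
    [26704466539940, 72680159162357, 134440899912755, 209524122443427, 294962179336704, 388389461975152, 488747994941927, 595761599459078, 709406527492885, 829662664640630],
    [61327820263361, 229916897201230, 544018815316432, 1033378601767586, 1715806815662080, 2606250705310702, 3722155147170309, 5083255461181858, 6709979219878724],
    [200306881883067, 954689318143754, 2743496814214322, 6120294886243718, 11671725542096481, 20047232025460377, 31983893691680925, 48309284272408937],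
    [851126828051988, 4916794204436992, 16580498782668295, 42360215436599622, 91078651203765871, 174347785575413155, 307082937989740682],
    [4458285551586959, 30231399399639009, 116687697306013664, 335338587625955616, 801896131390308765, 1692070957498915948],
    [27775655013608930, 215951526922537591, 936293911433327260, 2986437931840479173, 7860021027532926105],
    [200634577562403014, 1755897182125087377, 8430355749038162766, 29536966134454249823],
    [1648462847050014298, 15995919726059176505, 84130161953901367289],
    [15176827646470700597, 161235087499179791087],
    [154686187950471758654]]"
definition QT :: "int list list" where
  "QT = [[36389081809264, 16790756987463, 10544665435632, 7429503776543, 5570088711432, 4344633452894, 3484087423878, 2852496561344, 2373397554282, 2000593646421],
    [16790756987463, 23896898705601, 13691363562029, 9337328493364, 6880472679185, 5308633571491, 4226227560239, 3440840542583, 2850954440021, 2395883219892],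
    [10544665435632, 13691363562029, 18939195165802, 11908581826414, 8519778522184, 6473013366270, 5095661100378, 4124322684752, 3401456802554, 2844964693501],
    [7429503776543, 9337328493364, 11908581826414, 16134959648863, 10719778229966, 7905837290864, 6163531689127, 4918791396796, 4026624402946, 3359791931236],
    [5570088711432, 6880472679185, 8519778522184, 10719778229966, 14267533255821, 9884423005581, 7399597521716, 5908604454707, 4779461029594, 3939718193974],
    [4344633452894, 5308633571491, 6473013366270, 7905837290864, 9884423005581, 12868611246957, 9282850474613, 6981215714667, 5676822706977, 4663595824208],
    [3484087423878, 4226227560239, 5095661100378, 6163531689127, 7399597521716, 9282850474613, 11752748154434, 8821108307650, 6643974457563, 5460824363121],
    [2852496561344, 3440840542583, 4124322684752, 4918791396796, 5908604454707, 6981215714667, 8821108307650, 10841645976891, 8439921665311, 6374615548658],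
    [2373397554282, 2850954440021, 3401456802554, 4026624402946, 4779461029594, 5676822706977, 6643974457563, 8439921665311, 10089630402436, 8108003839098],
    [2000593646421, 2395883219892, 2844964693501, 3359791931236, 3939718193974, 4663595824208, 5460824363121, 6374615548658, 8108003839098, 9462820382750]]"
definition RT :: "int list list" where
  "RT = [[136632916, 0, 0, 0, 0, 0, 0, 0, 0, 0],
    [-503355576, 351424142, 0, 0, 0, 0, 0, 0, 0, 0],
    [-316109402, -612351941, 555593123, 0, 0, 0, 0, 0, 0, 0],
    [-222722665, -427843097, -686064703, 753874163, 0, 0, 0, 0, 0, 0],
    [-166980870, -319366699, -509808424, -752776878, 933290722, 0, 0, 0, 0, 0],
    [-130244007, -248426901, -395630370, -582466400, -837613670, 1154114718, 0, 0, 0, 0],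
    [-104446442, -198860348, -316168151, -464933366, -666925046, -914595096, 1347386674, 0, 0, 0],
    [-85512526, -162586695, -258255208, -379286544, -543865041, -744091999, -1023202891, 1386949169, 0, 0],
    [-71150031, -135139476, -214503162, -314802298, -451036120, -617019390, -846698537, -1303717004, 1807353785, 0],
    [-59974066, -113827746, -180552960, -264886012, -379251477, -518645915, -711592462, -1093859583, -1490928023, 32367242]]"

text \<open>The constant is 11!^2 * 2^68: two Laguerre polynomials scaled by 11!, and the scale
  2^112 of \<open>UM\<close> against 2^44 of \<open>v\<close>. The errors of the moments are
  included, so \<open>v\<close> is correct up to one unit.\<close>

definition moment_near :: "int list \<Rightarrow> int \<Rightarrow> bool" where
  "moment_near P v \<longleftrightarrow> \<bar>dot P UM - v * 470274186914725897684007717437440000\<bar> + dot (map abs P) UE \<le> 470274186914725897684007717437440000"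

definition entry_ok :: "nat \<Rightarrow> nat \<Rightarrow> nat \<Rightarrow> int \<Rightarrow> bool" where
  "entry_ok k n m v \<longleftrightarrow> moment_near (replicate k 0 @ pmul (lag_list k n) (lag_list k m)) v"

fun diag_row_ok :: "nat \<Rightarrow> nat \<Rightarrow> int list \<Rightarrow> bool" where
  "diag_row_ok k n [] \<longleftrightarrow> True"
| "diag_row_ok k n (v # vs) \<longleftrightarrow> entry_ok k n n v \<and> diag_row_ok k (Suc n) vs"

fun diag_rows_ok :: "nat \<Rightarrow> int list list \<Rightarrow> bool" where
  "diag_rows_ok k [] \<longleftrightarrow> True"
| "diag_rows_ok k (r # rs) \<longleftrightarrow> diag_row_ok k 0 r \<and> diag_rows_ok (Suc k) rs"

fun gram_row_ok :: "nat \<Rightarrow> nat \<Rightarrow> int list \<Rightarrow> bool" where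
  "gram_row_ok n m [] \<longleftrightarrow> True"
| "gram_row_ok n m (v # vs) \<longleftrightarrow> (m < n \<or> entry_ok 0 n m v) \<and> gram_row_ok n (Suc m) vs"

fun gram_rows_ok :: "nat \<Rightarrow> int list list \<Rightarrow> bool" where
  "gram_rows_ok n [] \<longleftrightarrow> True"
| "gram_rows_ok n (r # rs) \<longleftrightarrow> gram_row_ok n 0 r \<and> gram_rows_ok (Suc n) rs"

text \<open>An upper bound at scale 2^44 for \<beta> times a diagonal Gram entry in sector
  \<open>k\<close>; the first \<open>+ 1\<close> covers the error of \<open>TT\<close>, the last one
  the integer division.\<close>

definition trace_entry :: "nat \<Rightarrow> nat \<Rightarrow> int \<Rightarrow> int" where
  "trace_entry k n g = (TT ! k ! n + 1) * cfact n * 2 ^ 34 div (cfact (n + k) * g) + 1"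

definition trace_val :: "nat \<Rightarrow> nat \<Rightarrow> nat \<Rightarrow> int \<Rightarrow> int" where
  "trace_val p q l g = (if p \<le> l + 1 \<and> q \<le> l
     then (if p + l - q \<le> l + 1 then trace_entry (l + 1 - p - (l - q)) (l - q) g else trace_entry (l - q - (l + 1 - p)) (l + 1 - p) g)
     else 0)"

fun trace_sum :: "nat \<Rightarrow> nat \<Rightarrow> nat \<Rightarrow> int list \<Rightarrow> int" where
  "trace_sum p q l [] = 0"
| "trace_sum p q l (g # gs) = trace_val p q l g + trace_sum p q (Suc l) gs"

text \<open>The pair (2, 1) is exempt, being the tight matrix treated through \<open>RT\<close>.
  Since l \<le> 10, nonempty index sets have p \<le> 11 and q \<le> 10.\<close>

fun trace_row_ok :: "nat \<Rightarrow> nat \<Rightarrow> bool" where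
  "trace_row_ok p 0 \<longleftrightarrow> True"
| "trace_row_ok p (Suc q) \<longleftrightarrow> (p = 2 \<and> q = 1 \<or> trace_sum p q 1 GL \<le> 2 ^ 44) \<and> trace_row_ok p q"

fun trace_rows_ok :: "nat \<Rightarrow> bool" where
  "trace_rows_ok 0 \<longleftrightarrow> True"
| "trace_rows_ok (Suc p) \<longleftrightarrow> trace_row_ok p 11 \<and> trace_rows_ok p"

text \<open>The residual of the factorisation at scale 2^56, at which one unit of \<open>QT\<close>
  becomes 2^12.\<close>

definition gram_res :: "nat \<Rightarrow> nat \<Rightarrow> int" where
  "gram_res n m = (if n = m then GL ! n * 2 ^ 22 else 0) - 2 ^ 12 * QT ! n ! m - dot (RT ! n) (RT ! m)"

fun offdiag_sum :: "nat \<Rightarrow> nat \<Rightarrow> int" where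
  "offdiag_sum n 0 = 0"
| "offdiag_sum n (Suc m) = (if n = m then 0 else \<bar>gram_res n m\<bar> + 2 ^ 12) + offdiag_sum n m"

fun psd_rows_ok :: "nat \<Rightarrow> int list list \<Rightarrow> bool" where
  "psd_rows_ok n [] \<longleftrightarrow> True"
| "psd_rows_ok n (r # rs) \<longleftrightarrow> offdiag_sum n 10 \<le> gram_res n n - 2 ^ 12 \<and> psd_rows_ok (Suc n) rs"

text \<open>The majorant (1 - 2 \<rho> Z)^2 U + 2 \<rho> Z^2 of 1 / (2 \<rho> + W) at scale 2^114,
  with 2 \<rho> = 11985839 / 2^29.\<close>

definition sqlow_list :: "(int \<times> int) list" where
  "sqlow_list = sadd (smul (smul (sadd [(0, 2 ^ 41)] (smono 0 (- 11985839) ZL7)) (sadd [(0, 2 ^ 41)] (smono 0 (- 11985839) ZL7))) UL)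
     (smono 0 (11985839 * 2 ^ 61) (smul ZL7 ZL7))"

fun s_bound :: "int list \<Rightarrow> int list \<Rightarrow> int list \<Rightarrow> int" where
  "s_bound P M E = dot P M + dot (map abs P) E"

fun sq0 :: "int list \<Rightarrow> int list" where "sq0 h = 0 # pmul h h"

text \<open>The polynomial t h(t)^2 has degree at most 21, hence 22 moments; a factor 2^44 is
  removed from the coefficients at the start.\<close>

fun s_list_bound :: "(int \<times> int) list \<Rightarrow> int" where
  "s_list_bound p = s_bound (sq0 (lag_sum 0 EL)) (moms 22 1 1 (mstart 1 (2 ^ 44) p)) (errs 22 1 1 (int (length p)))"

text \<open>Both parts of Y (1 - z) + z^2 / U over the common denominator 7 * 2^104. The shift -1
  and the factor 10 / 7 come from 1 / U \<le> 10 / 7 exp(t / 8).\<close>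

fun mean_bound :: "(int \<times> int) list \<Rightarrow> int" where
  "mean_bound z = 7 * 2 ^ 32 * bmean 0 YL (sadd [(0, 2 ^ 52)] (smono 0 (-1) z)) + 10 * bmean (-1) z z"

section \<open>Integer evaluations for the lower bound\<close>

lemma UM_eq: "moms 22 1 1 (mstart (2 ^ 80) 1 UL) = UM"
  by code_simp

lemma diag_rows_ok: "diag_rows_ok 0 TT"
  by code_simp

lemma gram_rows_ok: "gram_rows_ok 0 QT"
  by code_simp

lemma trace_ok: "trace_rows_ok 12"
  by code_simp

lemma gram_psd_ok: "psd_rows_ok 0 QT"
  by code_simp

lemma s_list_bound_ok: "s_list_bound sqlow_list \<le> 525596597838575882538045186468241616158204272071147520000"
  by code_simp

lemma mean_bound_ok: "mean_bound (sadd (smul UL YL) [(0, - (2 ^ 52))]) \<le> 101960831506164515210119995736622"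
  by code_simp

section \<open>Soundness of the list arithmetic\<close>

fun sval :: "(int \<times> int) list \<Rightarrow> real \<Rightarrow> real" where
  "sval [] t = 0"
| "sval ((i, c) # p) t = real_of_int c * exp (- (real_of_int i / 8 * t)) + sval p t"

lemma sval_sadd [simp]: "sval (sadd p q) t = sval p t + sval q t"
  by (induction p q rule: sadd.induct) (simp_all add: algebra_simps)

lemma sval_smono [simp]: "sval (smono i c q) t = real_of_int c * exp (- (real_of_int i / 8 * t)) * sval q t"
  by (induction i c q rule: smono.induct) (simp_all add: algebra_simps add_divide_distrib flip: exp_add)

lemma sval_smul [simp]: "sval (smul p q) t = sval p t * sval q t"
  by (induction p q rule: smul.induct) (simp_all add: algebra_simps)

lemma continuous_sval: "continuous_on UNIV (sval p)"
proof (induction p)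
  case (Cons x p)
  obtain i c where x: "x = (i, c)" by force
  have "sval (x # p) = (\<lambda>t. real_of_int c * exp (- (real_of_int i / 8 * t)) + sval p t)" by (simp add: x fun_eq_iff)
  then show ?case using Cons by (auto intro!: continuous_intros)
qed (simp add: continuous_on_const[of UNIV 0, simplified] fun_eq_iff cong: continuous_on_cong)

fun fmom :: "(int \<times> int) list \<Rightarrow> nat \<Rightarrow> real" where
  "fmom [] k = 0"
| "fmom ((i, c) # p) k = real_of_int c * (8 / (8 + real_of_int i)) ^ Suc k + fmom p k"

lemma sval_moment:
  assumes "\<forall>(i, c)\<in>set p. -8 < i"
  shows "has_bochner_integral nu (\<lambda>r. (r\<^sup>2) ^ k * sval p (r\<^sup>2)) (fact k * fmom p k)"
  using assms
proof (induction p)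
  case (Cons x p)
  obtain i c where x: "x = (i, c)" by force
  have i: "-8 < real_of_int i" using Cons(2) by (simp add: x)
  then have i8: "-1 < real_of_int i / 8" by simp
  have "has_bochner_integral nu (\<lambda>r. real_of_int c * ((r\<^sup>2) ^ k * exp (- (real_of_int i / 8 * r\<^sup>2))) + (r\<^sup>2) ^ k * sval p (r\<^sup>2))
    (real_of_int c * (fact k / (1 + real_of_int i / 8) ^ Suc k) + fact k * fmom p k)"
    by (intro has_bochner_integral_add has_bochner_integral_mult_right nu_moment i8 Cons.IH) (use Cons(2) in auto)
  also have "(\<lambda>r. real_of_int c * ((r\<^sup>2) ^ k * exp (- (real_of_int i / 8 * r\<^sup>2))) + (r\<^sup>2) ^ k * sval p (r\<^sup>2))
    = (\<lambda>r. (r\<^sup>2) ^ k * sval (x # p) (r\<^sup>2))"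
    by (simp add: x fun_eq_iff algebra_simps)
  also have "real_of_int c * (fact k / (1 + real_of_int i / 8) ^ Suc k) + fact k * fmom p k = fact k * fmom (x # p) k"
  proof -
    have "1 + real_of_int i / 8 = (8 + real_of_int i) / 8" by simp
    then have "fact k / (1 + real_of_int i / 8) ^ Suc k = fact k * (8 / (8 + real_of_int i)) ^ Suc k" by (simp only: power_divide) simp
    then show ?thesis unfolding x fmom.simps by (simp only: distrib_left ac_simps)
  qed
  finally show ?case .
qed (simp add: has_bochner_integral_iff)

lemma sval_pval_integral:
  assumes "\<forall>(i, c)\<in>set p. -8 < i"
  shows "has_bochner_integral nu (\<lambda>r. pval P (r\<^sup>2) * sval p (r\<^sup>2)) (\<Sum>k<length P. real_of_int (P ! k) * (fact k * fmom p k))"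
proof -
  have "has_bochner_integral nu (\<lambda>r. \<Sum>k<length P. real_of_int (P ! k) * ((r\<^sup>2) ^ k * sval p (r\<^sup>2))) (\<Sum>k<length P. real_of_int (P ! k) * (fact k * fmom p k))"
    by (intro has_bochner_integral_sum has_bochner_integral_mult_right sval_moment assms)
  then show ?thesis by (simp add: pval_def sum_distrib_right mult.assoc)
qed

lemma div_bounds: "real_of_int x / real_of_int d - 1 \<le> real_of_int (x div d)" "real_of_int (x div d) \<le> real_of_int x / real_of_int d"
  using real_of_int_div3[of x d] real_of_int_div4[of x d] by simp_all

text \<open>Each step multiplies by a factor at most 1, because 0 \<le> i, and truncates once: the
  error grows by one unit per order.\<close>

definition near_moms :: "real \<Rightarrow> nat \<Rightarrow> (int \<times> int) list \<Rightarrow> (int \<times> int) list \<Rightarrow> bool" where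
  "near_moms s k st p \<longleftrightarrow> list_all2 (\<lambda>(i, x) (j, c). i = j \<and> 0 \<le> i \<and>
     \<bar>real_of_int x - s * real_of_int c * (8 / (8 + real_of_int i)) ^ Suc k\<bar> \<le> real (Suc k)) st p"

lemma near_moms_start:
  assumes "\<forall>(i, c)\<in>set p. 0 \<le> i" "0 < b"
  shows "near_moms (real_of_int a / real_of_int b) 0 (mstart a b p) p"
  using assms unfolding near_moms_def
proof (induction a b p rule: mstart.induct)
  case (2 a b i c p)
  have "\<bar>real_of_int (a * c * 8 div ((8 + i) * b)) - real_of_int (a * c * 8) / real_of_int ((8 + i) * b)\<bar> \<le> 1"
    using div_bounds[of "a * c * 8" "(8 + i) * b"] by linarith
  moreover have "real_of_int (a * c * 8) / real_of_int ((8 + i) * b) = real_of_int a / real_of_int b * real_of_int c * (8 / (8 + real_of_int i))"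
    by simp
  ultimately show ?case using 2 by (simp add: mult_ac)
qed simp

lemma near_moms_step:
  assumes "near_moms s k st p" shows "near_moms s (Suc k) (mstep st) p"
  using assms unfolding near_moms_def
proof (induction st p rule: list_all2_induct)
  case (Cons x xs y ys)
  obtain i a j c where xy: "x = (i, a)" "y = (j, c)" by (cases x, cases y)
  define q where "q = 8 / (8 + real_of_int i)"
  define w where "w = s * real_of_int c * q ^ Suc k"
  have i: "0 \<le> i" "i = j" and e: "\<bar>real_of_int a - w\<bar> \<le> real (Suc k)" using Cons(1) by (auto simp: xy w_def q_def)
  have q: "0 \<le> q" "q \<le> 1" using i by (auto simp: q_def)
  have "\<bar>(real_of_int a - w) * q\<bar> \<le> real (Suc k) * 1" unfolding abs_mult using e q by (intro mult_mono) auto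
  moreover have "\<bar>real_of_int (a * 8 div (8 + i)) - real_of_int a * q\<bar> \<le> 1"
    using div_bounds[of "a * 8" "8 + i"] by (simp add: q_def abs_le_iff)
  ultimately have "\<bar>real_of_int (a * 8 div (8 + i)) - w * q\<bar> \<le> real (Suc (Suc k))" by (simp add: left_diff_distrib abs_le_iff)
  moreover have "w * q = s * real_of_int c * q ^ Suc (Suc k)" by (simp add: w_def mult_ac)
  ultimately show ?case using Cons i by (simp add: xy q_def)
qed simp

lemma near_moms_ssum:
  assumes "near_moms s k st p" shows "\<bar>real_of_int (ssum st) - s * fmom p k\<bar> \<le> real (length p) * real (Suc k)"
  using assms unfolding near_moms_def
proof (induction st p rule: list_all2_induct)
  case (Cons x xs y ys)
  obtain i a j c where xy: "x = (i, a)" "y = (j, c)" by (cases x, cases y)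
  have "\<bar>real_of_int a - s * real_of_int c * (8 / (8 + real_of_int i)) ^ Suc k\<bar> \<le> real (Suc k)" "i = j"
    using Cons(1) by (auto simp: xy)
  then have "\<bar>real_of_int a - s * real_of_int c * (8 / (8 + real_of_int j)) ^ Suc k\<bar> \<le> real (Suc k)" by simp
  moreover have "s * fmom (y # ys) k = s * real_of_int c * (8 / (8 + real_of_int j)) ^ Suc k + s * fmom ys k"
    by (simp add: xy distrib_left mult.assoc)
  moreover have "real (length (y # ys)) * real (Suc k) = real (Suc k) + real (length ys) * real (Suc k)" by (simp add: algebra_simps)
  ultimately show ?case using Cons(3) unfolding xy ssum.simps of_int_add abs_le_iff by linarith
qed simp

lemma length_moms [simp]: "length (moms n f k st) = n" "length (errs n f k b) = n"
  by (induction n arbitrary: f k st) auto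

lemma moms_sound:
  assumes "near_moms s k st p" "j < n"
  shows "\<bar>real_of_int (moms n (fact k) (int (Suc k)) st ! j) - s * (fact (k + j) * fmom p (k + j))\<bar>
    \<le> real_of_int (errs n (fact k) (int (Suc k)) (int (length p)) ! j)"
  using assms
proof (induction n arbitrary: k st j)
  case (Suc n)
  show ?case
  proof (cases j)
    case 0
    have "\<bar>(real_of_int (ssum st) - s * fmom p k) * fact k\<bar> \<le> real (length p) * real (Suc k) * fact k"
      unfolding abs_mult using near_moms_ssum[OF Suc(2)] by (intro mult_mono) auto
    then show ?thesis by (simp add: 0 algebra_simps)
  next
    case (Suc i)
    have f: "fact k * int (Suc k) = fact (Suc k)" "int (Suc k) + 1 = int (Suc (Suc k))" by simp_all
    show ?thesis
      using Suc.IH[OF near_moms_step[OF Suc.prems(1)], of i] Suc.prems(2) Suc unfolding moms.simps errs.simps f by simp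
  qed
qed simp

lemma dot_eq_sum_le: "length xs \<le> length ys \<Longrightarrow> dot xs ys = (\<Sum>j<length xs. xs ! j * ys ! j)"
  by (induction xs ys rule: dot.induct) (simp_all add: sum.lessThan_Suc_shift del: sum.lessThan_Suc)

lemma integral_near_dot:
  assumes st: "near_moms s 0 st p" and P: "length P \<le> n" and M: "M = moms n 1 1 st" and E: "E = errs n 1 1 (int (length p))"
  shows "\<bar>s * (\<Sum>k<length P. real_of_int (P ! k) * (fact k * fmom p k)) - real_of_int (dot P M)\<bar> \<le> real_of_int (dot (map abs P) E)"
proof -
  have d: "real_of_int (dot P M) = (\<Sum>k<length P. real_of_int (P ! k) * real_of_int (M ! k))"
    "real_of_int (dot (map abs P) E) = (\<Sum>k<length P. \<bar>real_of_int (P ! k)\<bar> * real_of_int (E ! k))"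
    using P by (simp_all add: dot_eq_sum_le M E)
  have "\<bar>s * (\<Sum>k<length P. real_of_int (P ! k) * (fact k * fmom p k)) - real_of_int (dot P M)\<bar>
    = \<bar>\<Sum>k<length P. real_of_int (P ! k) * (s * (fact k * fmom p k) - real_of_int (M ! k))\<bar>"
    unfolding d sum_distrib_left sum_subtractf[symmetric] by (intro arg_cong[where f = abs] sum.cong refl) (simp add: algebra_simps)
  also have "\<dots> \<le> (\<Sum>k<length P. \<bar>real_of_int (P ! k) * (s * (fact k * fmom p k) - real_of_int (M ! k))\<bar>)" by (rule sum_abs)
  also have "\<dots> \<le> real_of_int (dot (map abs P) E)"
    unfolding d abs_mult
  proof (intro sum_mono mult_left_mono)
    fix k assume "k \<in> {..<length P}"
    then have "k < n" using P by simp
    from moms_sound[OF st this] show "\<bar>s * (fact k * fmom p k) - real_of_int (M ! k)\<bar> \<le> real_of_int (E ! k)"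
      by (simp add: M E abs_minus_commute)
  qed simp
  finally show ?thesis .
qed

lemma imean_sound:
  assumes "\<forall>(j, d)\<in>set q. -8 < j + s"
  shows "has_bochner_integral nu (\<lambda>r. sval q (r\<^sup>2) * exp (- (real_of_int s / 8 * r\<^sup>2))) (fmom (smono s 1 q) 0)"
    and "\<bar>real_of_int (imean s q) - fmom (smono s 1 q) 0\<bar> \<le> real (length q)"
proof -
  have "\<forall>(i, c)\<in>set (smono s 1 q). -8 < i"
    using assms by (induction s "1::int" q rule: smono.induct) (auto simp: add.commute)
  from sval_moment[OF this, of 0] show "has_bochner_integral nu (\<lambda>r. sval q (r\<^sup>2) * exp (- (real_of_int s / 8 * r\<^sup>2))) (fmom (smono s 1 q) 0)"
    by (simp add: mult.commute)
  show "\<bar>real_of_int (imean s q) - fmom (smono s 1 q) 0\<bar> \<le> real (length q)"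
  proof (induction s q rule: imean.induct)
    case (2 s j d q)
    have "\<bar>real_of_int (d * 8 div (8 + j + s)) - real_of_int d * (8 / (8 + real_of_int (s + j)))\<bar> \<le> 1"
      using div_bounds[of "d * 8" "8 + j + s"] by (simp add: abs_le_iff algebra_simps)
    then show ?case using 2 by simp
  qed simp
qed

text \<open>The hypothesis is integrability against the Gaussian measure. It admits the growing
  exponentials in \<open>YL\<close> and in the bound for 1 / U.\<close>

lemma bmean_sound:
  assumes "\<forall>(i, c)\<in>set p. \<forall>(j, d)\<in>set q. -8 < i + j + s"
  shows "integrable nu (\<lambda>r. sval p (r\<^sup>2) * sval q (r\<^sup>2) * exp (- (real_of_int s / 8 * r\<^sup>2)))"
    and "(\<integral>r. sval p (r\<^sup>2) * sval q (r\<^sup>2) * exp (- (real_of_int s / 8 * r\<^sup>2)) \<partial>nu) \<le> real_of_int (bmean s p q)"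
proof -
  have "\<exists>v. has_bochner_integral nu (\<lambda>r. sval p (r\<^sup>2) * sval q (r\<^sup>2) * exp (- (real_of_int s / 8 * r\<^sup>2))) v \<and> v \<le> real_of_int (bmean s p q)"
    using assms
  proof (induction s p q rule: bmean.induct)
    case (2 s i c p q)
    obtain v where v: "has_bochner_integral nu (\<lambda>r. sval p (r\<^sup>2) * sval q (r\<^sup>2) * exp (- (real_of_int s / 8 * r\<^sup>2))) v" "v \<le> real_of_int (bmean s p q)"
      using 2 by auto
    have q: "\<forall>(j, d)\<in>set q. -8 < j + (s + i)" using 2(2) by (auto simp: algebra_simps)
    note im = imean_sound[OF q]
    have "has_bochner_integral nu (\<lambda>r. real_of_int c * (sval q (r\<^sup>2) * exp (- (real_of_int (s + i) / 8 * r\<^sup>2))) + sval p (r\<^sup>2) * sval q (r\<^sup>2) * exp (- (real_of_int s / 8 * r\<^sup>2)))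
      (real_of_int c * fmom (smono (s + i) 1 q) 0 + v)"
      by (intro has_bochner_integral_add has_bochner_integral_mult_right im v)
    also have "(\<lambda>r. real_of_int c * (sval q (r\<^sup>2) * exp (- (real_of_int (s + i) / 8 * r\<^sup>2))) + sval p (r\<^sup>2) * sval q (r\<^sup>2) * exp (- (real_of_int s / 8 * r\<^sup>2)))
      = (\<lambda>r. sval ((i, c) # p) (r\<^sup>2) * sval q (r\<^sup>2) * exp (- (real_of_int s / 8 * r\<^sup>2)))"
      by (simp add: fun_eq_iff algebra_simps add_divide_distrib flip: exp_add)
    finally have "has_bochner_integral nu (\<lambda>r. sval ((i, c) # p) (r\<^sup>2) * sval q (r\<^sup>2) * exp (- (real_of_int s / 8 * r\<^sup>2))) (real_of_int c * fmom (smono (s + i) 1 q) 0 + v)" .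
    moreover have "\<bar>real_of_int c * (real_of_int (imean (s + i) q) - fmom (smono (s + i) 1 q) 0)\<bar> \<le> \<bar>real_of_int c\<bar> * real (length q)"
      unfolding abs_mult using im(2) by (intro mult_left_mono) auto
    then have "real_of_int c * fmom (smono (s + i) 1 q) 0 \<le> real_of_int (c * imean (s + i) q + \<bar>c\<bar> * int (length q))"
      by (simp add: right_diff_distrib abs_le_iff)
    ultimately show ?case using v(2) by (intro exI[of _ "real_of_int c * fmom (smono (s + i) 1 q) 0 + v"]) simp
  qed (auto intro!: exI[of _ 0] simp: has_bochner_integral_iff)
  then show "integrable nu (\<lambda>r. sval p (r\<^sup>2) * sval q (r\<^sup>2) * exp (- (real_of_int s / 8 * r\<^sup>2)))"
    "(\<integral>r. sval p (r\<^sup>2) * sval q (r\<^sup>2) * exp (- (real_of_int s / 8 * r\<^sup>2)) \<partial>nu) \<le> real_of_int (bmean s p q)"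
    by (auto simp: has_bochner_integral_iff)
qed

lemma length_pascal_step: "length (pascal_step xs) = length xs"
  by (induction xs rule: pascal_step.induct) auto

lemma pascal_step_nth: "i < length xs \<Longrightarrow> pascal_step xs ! i = xs ! i + (if Suc i < length xs then xs ! Suc i else 0)"
  by (induction xs arbitrary: i rule: pascal_step.induct) (auto simp: nth_Cons split: nat.split)

lemma pascal: "length (pascal n) = Suc n \<and> (\<forall>i\<le>n. pascal n ! i = int (n choose i))"
proof (induction n)
  case (Suc n)
  have "pascal (Suc n) ! i = int (Suc n choose i)" if "i \<le> Suc n" for i
  proof (cases i)
    case (Suc j)
    then show ?thesis using Suc.IH that
      by (cases "j < n") (auto simp: pascal_step_nth binomial_eq_0)
  qed simp
  then show ?case using Suc by (simp add: length_pascal_step)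
qed simp

lemma fact11_nth: "i < 12 \<Longrightarrow> real_of_int (fact11 ! i) = (-1) ^ i * 39916800 / fact i"
proof -
  have "\<forall>i<12. real_of_int (fact11 ! i) = (-1) ^ i * 39916800 / fact i"
    by (simp add: fact11_def eval_nat_numeral less_Suc_eq all_conj_distrib fact_numeral)
  then show "i < 12 \<Longrightarrow> real_of_int (fact11 ! i) = (-1) ^ i * 39916800 / fact i" by blast
qed

lemma length_lag_list: "n + k \<le> 11 \<Longrightarrow> length (lag_list k n) = Suc n"
  using pascal[of "n + k"] by (simp add: lag_list_def fact11_def)

lemma pval_lag_list:
  assumes "n + k \<le> 11" shows "pval (lag_list k n) t = 39916800 * lag k n t"
proof -
  have "real_of_int (lag_list k n ! i) = 39916800 * ((-1) ^ i * real ((n + k) choose (n - i)) / fact i)" if "i \<le> n" for i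
  proof -
    have "lag_list k n ! i = pascal (n + k) ! (k + i) * fact11 ! i"
      using that assms pascal[of "n + k"] by (simp add: lag_list_def fact11_def)
    moreover have "pascal (n + k) ! (k + i) = int ((n + k) choose (n - i))"
      using that pascal[of "n + k"] binomial_symmetric[of "k + i" "n + k"] by simp
    ultimately show ?thesis using fact11_nth[of i] that assms by simp
  qed
  then show ?thesis unfolding pval_def length_lag_list[OF assms] lag_def sum_distrib_left lessThan_Suc_atMost
    by (intro sum.cong) (auto simp: mult_ac)
qed

lemma pval_lag_sum:
  "length es + l \<le> 11 \<Longrightarrow> pval (lag_sum l es) t = 39916800 * (\<Sum>j<length es. real_of_int (es ! j) * lag 1 (l + j) t)"
  by (induction l es rule: lag_sum.induct)
    (simp_all add: pval_padd pval_scale pval_lag_list sum.lessThan_Suc_shift distrib_left sum_distrib_left mult_ac del: sum.lessThan_Suc)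

text \<open>The coefficients are those of U up to exponent 8, times 1000 and rounded down, with one
  power of v = exp(-t / 8) removed. Nonnegativity on each half of [0, 1] is shown by a Bernstein
  expansion with nonnegative coefficients.\<close>

lemma low_poly_ge:
  fixes v :: real
  assumes "0 \<le> v" "v \<le> 1"
  shows "700 \<le> (2350) * v ^ 0 + (-13657) * v ^ 1 + (51085) * v ^ 2 + (-106056) * v ^ 3 + (122388) * v ^ 4 + (-64102) * v ^ 5 + (10188) * v ^ 7"
proof (cases "v \<le> 1 / 2")
  case True
  \<comment> \<open>Made homogeneous of degree 7 through 1 = 2 v + (1 - 2 v); in the other half
    through 1 = (2 v - 1) + 2 (1 - v).\<close>
  have "1 * ((2350) * v ^ 0 + (-13657) * v ^ 1 + (51085) * v ^ 2 + (-106056) * v ^ 3 + (122388) * v ^ 4 + (-64102) * v ^ 5 + (10188) * v ^ 7 - 700) = 1650 * v ^ 0 * (1 - 2 * v) ^ 7 + 9443 * v ^ 1 * (1 - 2 * v) ^ 6 + 25801 * v ^ 2 * (1 - 2 * v) ^ 5 + 47374 * v ^ 3 * (1 - 2 * v) ^ 4 + 56220 * v ^ 4 * (1 - 2 * v) ^ 3 + 42802 * v ^ 5 * (1 - 2 * v) ^ 2 + 22312 * v ^ 6 * (1 - 2 * v) ^ 1 + 7860 * v ^ 7 * (1 - 2 * v) ^ 0"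
    by (simp add: eval_nat_numeral algebra_simps)
  also have "\<dots> \<ge> 0" using assms True by (intro add_nonneg_nonneg mult_nonneg_nonneg zero_le_power) auto
  finally show ?thesis by simp
next
  case False
  have "1 * ((2350) * v ^ 0 + (-13657) * v ^ 1 + (51085) * v ^ 2 + (-106056) * v ^ 3 + (122388) * v ^ 4 + (-64102) * v ^ 5 + (10188) * v ^ 7 - 700) = 7860 * (2 * v - 1) ^ 0 * (1 - v) ^ 7 + 32708 * (2 * v - 1) ^ 1 * (1 - v) ^ 6 + 73990 * (2 * v - 1) ^ 2 * (1 - v) ^ 5 + 98210 * (2 * v - 1) ^ 3 * (1 - v) ^ 4 + 79374 * (2 * v - 1) ^ 4 * (1 - v) ^ 3 + 37401 * (2 * v - 1) ^ 5 * (1 - v) ^ 2 + 10241 * (2 * v - 1) ^ 6 * (1 - v) ^ 1 + 1496 * (2 * v - 1) ^ 7 * (1 - v) ^ 0"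
    by (simp add: eval_nat_numeral algebra_simps)
  also have "\<dots> \<ge> 0" using assms False by (intro add_nonneg_nonneg mult_nonneg_nonneg zero_le_power) auto
  finally show ?thesis by simp
qed

section \<open>The function U and its Laguerre integrals\<close>

definition low_U :: "real \<Rightarrow> real" where "low_U t = sval UL t / 2 ^ 32"

lemma low_U_ge:
  assumes t: "0 \<le> t" shows "7 / 10 * exp (- (t / 8)) \<le> low_U t"
proof -
  define v where "v = exp (- (t / 8))"
  have v: "0 \<le> v" "v \<le> 1" using t by (auto simp: v_def)
  \<comment> \<open>Treating the powers of v as opaque nonnegative quantities makes the comparison
    with \<open>low_poly_ge\<close> linear.\<close>
  define X where "X k = v * v ^ k" for k :: nat
  have X: "0 \<le> X k" for k using v by (simp add: X_def)
  have e: "exp (- (real_of_int i / 8 * t)) = X n" if "i = int n + 1" for i n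
  proof -
    have "X n = exp (real (Suc n) * (- (t / 8)))" unfolding X_def v_def exp_of_nat_mult by simp
    then show ?thesis using that by (simp add: algebra_simps)
  qed
  have E: "exp (- (real_of_int 1 / 8 * t)) = X 0" "exp (- (real_of_int 2 / 8 * t)) = X 1" "exp (- (real_of_int 3 / 8 * t)) = X 2"
    "exp (- (real_of_int 4 / 8 * t)) = X 3" "exp (- (real_of_int 5 / 8 * t)) = X 4" "exp (- (real_of_int 6 / 8 * t)) = X 5"
    "exp (- (real_of_int 8 / 8 * t)) = X 7" "exp (- (real_of_int 16 / 8 * t)) = X 15" "exp (- (real_of_int 32 / 8 * t)) = X 31"
    "exp (- (real_of_int 64 / 8 * t)) = X 63" "exp (- (real_of_int 128 / 8 * t)) = X 127"
    by (rule e; simp)+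
  define P where "P = 2350 * v ^ 0 + (-13657) * v ^ 1 + 51085 * v ^ 2 + (-106056) * v ^ 3 + 122388 * v ^ 4 + (-64102) * v ^ 5 + 10188 * v ^ 7"
  have P: "700 \<le> P" unfolding P_def using low_poly_ge[OF v] by simp
  have "v * P = 2350 * X 0 + (-13657) * X 1 + 51085 * X 2 + (-106056) * X 3 + 122388 * X 4 + (-64102) * X 5 + 10188 * X 7"
    by (simp add: P_def X_def algebra_simps)
  moreover have "low_U t * 2 ^ 32 = sval UL t" by (simp add: low_U_def)
  ultimately have "v * P \<le> 1000 * low_U t"
    using X[of 0] X[of 1] X[of 2] X[of 3] X[of 4] X[of 5] X[of 7] X[of 15] X[of 31] X[of 63] X[of 127]
    unfolding UL_def sval.simps E by simp
  moreover have "v * 700 \<le> v * P" using P v by (intro mult_left_mono)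
  ultimately show ?thesis by (fold v_def) simp
qed

lemma low_U_pos: "0 \<le> t \<Longrightarrow> 0 < low_U t"
  using low_U_ge[of t] exp_gt_zero[of "- (t / 8)"] by linarith

lemma length_pmul: "q \<noteq> [] \<Longrightarrow> length (pmul p q) \<le> length p + length q - 1"
proof (induction p q rule: pmul.induct)
  case (2 a p q)
  have l: "length (padd x y) = max (length x) (length y)" for x y
    by (induction x y rule: padd.induct) auto
  obtain n where "length q = Suc n" using 2(2) by (cases q) auto
  then show ?case using 2 by (cases p) (auto simp: l)
qed simp

definition low_J :: "nat \<Rightarrow> nat \<Rightarrow> nat \<Rightarrow> real" where
  "low_J k n m = (\<integral>r. (r\<^sup>2) ^ k * lag k n (r\<^sup>2) * lag k m (r\<^sup>2) * low_U (r\<^sup>2) \<partial>nu)"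

lemma pval_shift: "pval (replicate k 0 @ p) x = x ^ k * pval p x"
  by (induction k) simp_all

lemma UL_exps: "\<forall>(i, c)\<in>set UL. 0 \<le> i" "\<forall>(i, c)\<in>set UL. -8 < i" "length UL = 11"
  by (simp_all add: UL_def)

text \<open>The condition on k + n + m is the range of \<open>UM\<close>, which holds the moments of
  orders 0 to 21.\<close>

lemma low_J:
  assumes "n + k \<le> 11" "m + k \<le> 11"
  shows "has_bochner_integral nu (\<lambda>r. (r\<^sup>2) ^ k * lag k n (r\<^sup>2) * lag k m (r\<^sup>2) * low_U (r\<^sup>2)) (low_J k n m)"
    and "n + m \<le> 20 \<Longrightarrow> k + n + m \<le> 21 \<Longrightarrow> entry_ok k n m v \<Longrightarrow> \<bar>2 ^ 44 * low_J k n m - real_of_int v\<bar> \<le> 1"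
proof -
  define P where "P = replicate k 0 @ pmul (lag_list k n) (lag_list k m)"
  define I where "I = (\<Sum>i<length P. real_of_int (P ! i) * (fact i * fmom UL i))"
  have "has_bochner_integral nu (\<lambda>r. pval P (r\<^sup>2) * sval UL (r\<^sup>2)) I"
    unfolding I_def by (rule sval_pval_integral[OF UL_exps(2)])
  then have "has_bochner_integral nu (\<lambda>r. 1 / (39916800\<^sup>2 * 2 ^ 32) * (pval P (r\<^sup>2) * sval UL (r\<^sup>2))) (1 / (39916800\<^sup>2 * 2 ^ 32) * I)"
    by (rule has_bochner_integral_mult_right)
  also have "(\<lambda>r. 1 / (39916800\<^sup>2 * 2 ^ 32) * (pval P (r\<^sup>2) * sval UL (r\<^sup>2))) = (\<lambda>r. (r\<^sup>2) ^ k * lag k n (r\<^sup>2) * lag k m (r\<^sup>2) * low_U (r\<^sup>2))"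
    unfolding P_def pval_shift pval_pmul pval_lag_list[OF assms(1)] pval_lag_list[OF assms(2)] low_U_def
    by (simp add: fun_eq_iff power2_eq_square)
  finally have h: "has_bochner_integral nu (\<lambda>r. (r\<^sup>2) ^ k * lag k n (r\<^sup>2) * lag k m (r\<^sup>2) * low_U (r\<^sup>2)) (1 / (39916800\<^sup>2 * 2 ^ 32) * I)" .
  then have J: "low_J k n m = 1 / (39916800\<^sup>2 * 2 ^ 32) * I" unfolding low_J_def by (rule has_bochner_integral_integral_eq)
  show "has_bochner_integral nu (\<lambda>r. (r\<^sup>2) ^ k * lag k n (r\<^sup>2) * lag k m (r\<^sup>2) * low_U (r\<^sup>2)) (low_J k n m)"
    unfolding J by (rule h)
  assume nm: "n + m \<le> 20" "k + n + m \<le> 21" and ok: "entry_ok k n m v"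
  have "lag_list k m \<noteq> []" using length_lag_list[OF assms(2)] by auto
  then have len: "length P \<le> 22"
    using length_pmul[of "lag_list k m" "lag_list k n"] nm length_lag_list[OF assms(1)] length_lag_list[OF assms(2)] by (simp add: P_def)
  have st: "near_moms (2 ^ 80) 0 (mstart (2 ^ 80) 1 UL) UL" using near_moms_start[OF UL_exps(1), of 1 "2 ^ 80"] by simp
  have "\<bar>2 ^ 80 * I - real_of_int (dot P UM)\<bar> \<le> real_of_int (dot (map abs P) UE)"
    unfolding I_def by (rule integral_near_dot[OF st len UM_eq[symmetric]]) (simp add: UE_def UL_exps)
  moreover have "real_of_int (\<bar>dot P UM - v * 470274186914725897684007717437440000\<bar> + dot (map abs P) UE) \<le> real_of_int 470274186914725897684007717437440000"
    using ok unfolding entry_ok_def moment_near_def P_def[symmetric] of_int_le_iff .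
  ultimately have "\<bar>2 ^ 80 * I - real_of_int v * 470274186914725897684007717437440000\<bar> \<le> 470274186914725897684007717437440000" by simp
  then show "\<bar>2 ^ 44 * low_J k n m - real_of_int v\<bar> \<le> 1"
    unfolding J abs_le_iff by (simp add: field_simps)
qed

lemma diag_row_ok_nth: "diag_row_ok k n vs \<Longrightarrow> i < length vs \<Longrightarrow> entry_ok k (n + i) (n + i) (vs ! i)"
  by (induction k n vs arbitrary: i rule: diag_row_ok.induct) (auto simp: nth_Cons split: nat.split)

lemma diag_rows_ok_nth: "diag_rows_ok k rs \<Longrightarrow> i < length rs \<Longrightarrow> j < length (rs ! i) \<Longrightarrow> entry_ok (k + i) j j (rs ! i ! j)"
proof (induction k rs arbitrary: i rule: diag_rows_ok.induct)
  case (2 k r rs)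
  then show ?case using diag_row_ok_nth[of k 0 r j] by (cases i) auto
qed simp

lemma gram_row_ok_nth: "gram_row_ok n m vs \<Longrightarrow> i < length vs \<Longrightarrow> n \<le> m + i \<Longrightarrow> entry_ok 0 n (m + i) (vs ! i)"
proof (induction n m vs arbitrary: i rule: gram_row_ok.induct)
  case (2 n m v vs)
  then show ?case by (cases i) auto
qed simp

lemma gram_rows_ok_nth: "gram_rows_ok n rs \<Longrightarrow> i < length rs \<Longrightarrow> j < length (rs ! i) \<Longrightarrow> n + i \<le> j \<Longrightarrow> entry_ok 0 (n + i) j (rs ! i ! j)"
proof (induction n rs arbitrary: i rule: gram_rows_ok.induct)
  case (2 n r rs)
  then show ?case using gram_row_ok_nth[of n 0 r j] by (cases i) auto
qed simp

definition low_beta :: "nat \<Rightarrow> real" where "low_beta l = 2 ^ 34 / real_of_int (GL ! (l - 1))"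

lemma GL_pos: "l \<in> {1..10} \<Longrightarrow> 0 < GL ! (l - 1)"
proof -
  have "\<forall>j<10. 0 < GL ! j" unfolding all_less_numeral by (simp add: GL_def)
  then show "l \<in> {1..10} \<Longrightarrow> 0 < GL ! (l - 1)" by auto
qed

lemma low_beta_pos: "l \<in> {1..10} \<Longrightarrow> 0 < low_beta l"
  using GL_pos by (simp add: low_beta_def)

lemma e_fun_gram:
  assumes "n + k \<le> 11" "m + k \<le> 11"
  shows "has_bochner_integral nu (\<lambda>r. e_fun (n + k) n r * e_fun (m + k) m r * low_U (r\<^sup>2))
    ((-1) ^ (n + m) * sqrt (fact n / fact (n + k)) * sqrt (fact m / fact (m + k)) * low_J k n m)"
proof -
  have "has_bochner_integral nu (\<lambda>r. ((-1) ^ (n + m) * sqrt (fact n / fact (n + k)) * sqrt (fact m / fact (m + k))) * ((r\<^sup>2) ^ k * lag k n (r\<^sup>2) * lag k m (r\<^sup>2) * low_U (r\<^sup>2)))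
    (((-1) ^ (n + m) * sqrt (fact n / fact (n + k)) * sqrt (fact m / fact (m + k))) * low_J k n m)"
    by (intro has_bochner_integral_mult_right low_J(1) assms)
  also have "(\<lambda>r. ((-1) ^ (n + m) * sqrt (fact n / fact (n + k)) * sqrt (fact m / fact (m + k))) * ((r\<^sup>2) ^ k * lag k n (r\<^sup>2) * lag k m (r\<^sup>2) * low_U (r\<^sup>2)))
    = (\<lambda>r. e_fun (n + k) n r * e_fun (m + k) m r * low_U (r\<^sup>2))"
    unfolding e_fun_lag by (simp add: fun_eq_iff power_add power2_eq_square power_mult_distrib)
  finally show ?thesis .
qed

text \<open>All functions \<open>e_fun (l + 1 - p) (l - q)\<close> with fixed \<open>p\<close> and \<open>q\<close> lie in the same angular sector \<open>k\<close>.\<close>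

definition sector_k :: "nat \<Rightarrow> nat \<Rightarrow> nat" where "sector_k p q = (if p \<le> q + 1 then q + 1 - p else p - (q + 1))"
definition sector_d :: "nat \<Rightarrow> nat \<Rightarrow> nat" where "sector_d p q = (if p \<le> q + 1 then q + 1 else p)"

text \<open>The number \<open>l + 1 - sector_d p q\<close> is the smaller of the two indices and
  \<open>sector_k p q\<close> their difference; the symmetry of \<open>e_fun\<close> allows the
  larger index to be put first, independently of l.\<close>

lemma e_fun_sector:
  assumes a: "p \<le> l + 1" "q \<le> l"
  shows "e_fun (l + 1 - p) (l - q) = e_fun (l + 1 - sector_d p q + sector_k p q) (l + 1 - sector_d p q)"
    and "l + 1 - sector_d p q + sector_k p q \<le> l + 1" "l + 1 - sector_d p q \<le> l"
    and "trace_val p q l g = trace_entry (sector_k p q) (l + 1 - sector_d p q) g"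
proof -
  have "e_fun (l + 1 - p) (l - q) = e_fun (l + 1 - sector_d p q + sector_k p q) (l + 1 - sector_d p q)
    \<and> l + 1 - sector_d p q + sector_k p q \<le> l + 1 \<and> l + 1 - sector_d p q \<le> l
    \<and> trace_val p q l g = trace_entry (sector_k p q) (l + 1 - sector_d p q) g"
  proof (cases "p \<le> q + 1")
    case True
    have s: "sector_k p q = q + 1 - p" "sector_d p q = q + 1" using True by (simp_all add: sector_k_def sector_d_def)
    have e: "l + 1 - p = l - q + (q + 1 - p)" "l + 1 - (q + 1) = l - q" using a True by simp_all
    have c: "p + l - q \<le> l + 1" "l + 1 - p - (l - q) = q + 1 - p" "l - q + (q + 1 - p) \<le> l + 1" "l - q \<le> l" using a True by simp_all
    have "e_fun (l + 1 - p) (l - q) = e_fun (l - q + (q + 1 - p)) (l - q)" by (rule arg_cong2[OF e(1) refl])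
    moreover have "trace_val p q l g = trace_entry (q + 1 - p) (l - q) g"
      unfolding trace_val_def using a by (simp only: c(1,2) if_True simp_thms)
    ultimately show ?thesis unfolding s e(2) using c by blast
  next
    case False
    have s: "sector_k p q = p - (q + 1)" "sector_d p q = p" using False by (simp_all add: sector_k_def sector_d_def)
    have e: "l - q = l + 1 - p + (p - (q + 1))" using a False by simp
    have c: "\<not> p + l - q \<le> l + 1" "l - q - (l + 1 - p) = p - (q + 1)" "l + 1 - p + (p - (q + 1)) \<le> l + 1" "l + 1 - p \<le> l" using a False by simp_all
    have "e_fun (l + 1 - p) (l - q) = e_fun (l - q) (l + 1 - p)" by (rule e_fun_commute)
    also have "\<dots> = e_fun (l + 1 - p + (p - (q + 1))) (l + 1 - p)" by (rule arg_cong2[OF e refl])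
    finally have "e_fun (l + 1 - p) (l - q) = e_fun (l + 1 - p + (p - (q + 1))) (l + 1 - p)" .
    moreover have "trace_val p q l g = trace_entry (p - (q + 1)) (l + 1 - p) g"
      unfolding trace_val_def using a by (simp only: c(1,2) if_True if_False simp_thms)
    ultimately show ?thesis unfolding s using c by blast
  qed
  then show "e_fun (l + 1 - p) (l - q) = e_fun (l + 1 - sector_d p q + sector_k p q) (l + 1 - sector_d p q)"
    "l + 1 - sector_d p q + sector_k p q \<le> l + 1" "l + 1 - sector_d p q \<le> l"
    "trace_val p q l g = trace_entry (sector_k p q) (l + 1 - sector_d p q) g" by blast+
qed

section \<open>Criteria for being dominated by the identity\<close>

lemma id_minus_gram:
  fixes Q :: "nat \<Rightarrow> nat \<Rightarrow> real"
  assumes fin: "finite I" and sym: "\<And>i j. Q i j = Q j i" and \<beta>: "\<And>i. i \<in> I \<Longrightarrow> 0 \<le> \<beta> i"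
    and le: "\<And>x. (\<Sum>i\<in>I. \<Sum>j\<in>I. (sqrt (\<beta> i) * x i) * Q i j * (sqrt (\<beta> j) * x j)) \<le> (\<Sum>i\<in>I. (x i)\<^sup>2)"
  shows "loewner_le_on I (\<lambda>i j. sqrt (\<beta> i * \<beta> j) * Q i j) id_mat"
  unfolding loewner_le_on_def psd_on_def
proof (intro conjI ballI allI)
  show "id_mat i j - sqrt (\<beta> i * \<beta> j) * Q i j = id_mat j i - sqrt (\<beta> j * \<beta> i) * Q j i" for i j
    using sym[of i j] by (simp add: id_mat_def diag_mat_def mult.commute)
  fix x :: "nat \<Rightarrow> real"
  have "(\<Sum>i\<in>I. \<Sum>j\<in>I. x i * (id_mat i j - sqrt (\<beta> i * \<beta> j) * Q i j) * x j)
    = (\<Sum>i\<in>I. \<Sum>j\<in>I. x i * id_mat i j * x j) - (\<Sum>i\<in>I. \<Sum>j\<in>I. (sqrt (\<beta> i) * x i) * Q i j * (sqrt (\<beta> j) * x j))"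
    unfolding sum_subtractf[symmetric] by (intro sum.cong refl) (simp add: algebra_simps real_sqrt_mult)
  also have "(\<Sum>i\<in>I. \<Sum>j\<in>I. x i * id_mat i j * x j) = (\<Sum>i\<in>I. (x i)\<^sup>2)"
    using fin by (intro sum.cong refl) (simp add: id_mat_def diag_mat_def if_distrib[of "\<lambda>z. _ * z"] if_distrib[of "\<lambda>z. z * _"] power2_eq_square cong: if_cong)
  finally show "0 \<le> (\<Sum>i\<in>I. \<Sum>j\<in>I. x i * (id_mat i j - sqrt (\<beta> i * \<beta> j) * Q i j) * x j)" using le[of x] by simp
qed

text \<open>A positive semidefinite matrix is dominated by its trace. For a Gram matrix this is the
  Cauchy-Schwarz inequality applied at each point and then integrated.\<close>

lemma loewner_le_trace:
  fixes v :: "nat \<Rightarrow> real \<Rightarrow> real" and u :: "real \<Rightarrow> real"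
  assumes fin: "finite I" and int: "\<And>i j. i \<in> I \<Longrightarrow> j \<in> I \<Longrightarrow> integrable nu (\<lambda>r. v i r * v j r * u r)"
    and u: "\<And>r. 0 \<le> r \<Longrightarrow> 0 \<le> u r" and \<beta>: "\<And>i. i \<in> I \<Longrightarrow> 0 \<le> \<beta> i"
    and tr: "(\<Sum>i\<in>I. \<beta> i * (\<integral>r. v i r * v i r * u r \<partial>nu)) \<le> 1"
  shows "loewner_le_on I (\<lambda>i j. sqrt (\<beta> i * \<beta> j) * (\<integral>r. v i r * v j r * u r \<partial>nu)) id_mat"
proof (rule id_minus_gram[OF fin _ \<beta>])
  show "(\<integral>r. v i r * v j r * u r \<partial>nu) = (\<integral>r. v j r * v i r * u r \<partial>nu)" for i j by (simp add: mult.commute)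
  fix x :: "nat \<Rightarrow> real"
  let ?X = "\<Sum>i\<in>I. (x i)\<^sup>2"
  have "(\<Sum>i\<in>I. \<Sum>j\<in>I. (sqrt (\<beta> i) * x i) * (\<integral>r. v i r * v j r * u r \<partial>nu) * (sqrt (\<beta> j) * x j))
    = (\<integral>r. (\<Sum>i\<in>I. \<Sum>j\<in>I. (sqrt (\<beta> i) * x i) * (sqrt (\<beta> j) * x j) * (v i r * v j r * u r)) \<partial>nu)"
  proof -
    have "has_bochner_integral nu (\<lambda>r. \<Sum>i\<in>I. \<Sum>j\<in>I. (sqrt (\<beta> i) * x i) * (sqrt (\<beta> j) * x j) * (v i r * v j r * u r))
      (\<Sum>i\<in>I. \<Sum>j\<in>I. (sqrt (\<beta> i) * x i) * (sqrt (\<beta> j) * x j) * (\<integral>r. v i r * v j r * u r \<partial>nu))"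
      by (intro has_bochner_integral_sum has_bochner_integral_mult_right has_bochner_integral_integrable int; assumption)
    from has_bochner_integral_integral_eq[OF this, symmetric] show ?thesis by (simp only: mult_ac)
  qed
  also have "\<dots> \<le> (\<integral>r. ?X * (\<Sum>i\<in>I. \<beta> i * (v i r * v i r * u r)) \<partial>nu)"
  proof (rule integral_mono)
    show "integrable nu (\<lambda>r. \<Sum>i\<in>I. \<Sum>j\<in>I. (sqrt (\<beta> i) * x i) * (sqrt (\<beta> j) * x j) * (v i r * v j r * u r))"
      "integrable nu (\<lambda>r. ?X * (\<Sum>i\<in>I. \<beta> i * (v i r * v i r * u r)))"
      by (auto intro!: Bochner_Integration.integrable_sum integrable_mult_right int)
    fix r assume "r \<in> space nu"
    then have r: "0 \<le> u r" using u by simp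
    have "(\<Sum>i\<in>I. \<Sum>j\<in>I. (sqrt (\<beta> i) * x i) * (sqrt (\<beta> j) * x j) * (v i r * v j r * u r))
      = (\<Sum>i\<in>I. x i * (sqrt (\<beta> i) * v i r))\<^sup>2 * u r"
      unfolding power2_eq_square sum_product unfolding sum_distrib_right by (intro sum.cong refl) (simp only: mult_ac)
    also have "\<dots> \<le> (?X * (\<Sum>i\<in>I. (sqrt (\<beta> i) * v i r)\<^sup>2)) * u r"
      by (intro mult_right_mono Cauchy_Schwarz_ineq_sum r)
    also have "\<dots> = ?X * ((\<Sum>i\<in>I. (sqrt (\<beta> i) * v i r)\<^sup>2) * u r)" by (rule mult.assoc)
    also have "(\<Sum>i\<in>I. (sqrt (\<beta> i) * v i r)\<^sup>2) * u r = (\<Sum>i\<in>I. \<beta> i * (v i r * v i r * u r))"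
      unfolding sum_distrib_right
    proof (intro sum.cong refl)
      fix i assume "i \<in> I"
      then have "(sqrt (\<beta> i) * v i r)\<^sup>2 = \<beta> i * (v i r)\<^sup>2" using \<beta> by (simp add: power_mult_distrib)
      then show "(sqrt (\<beta> i) * v i r)\<^sup>2 * u r = \<beta> i * (v i r * v i r * u r)" by (simp add: power2_eq_square mult_ac)
    qed
    finally show "(\<Sum>i\<in>I. \<Sum>j\<in>I. (sqrt (\<beta> i) * x i) * (sqrt (\<beta> j) * x j) * (v i r * v j r * u r)) \<le> ?X * (\<Sum>i\<in>I. \<beta> i * (v i r * v i r * u r))" .
  qed
  also have "\<dots> = ?X * (\<Sum>i\<in>I. \<beta> i * (\<integral>r. v i r * v i r * u r \<partial>nu))" using int by simp
  also have "\<dots> \<le> ?X * 1" using tr by (intro mult_left_mono sum_nonneg) auto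
  finally show "(\<Sum>i\<in>I. \<Sum>j\<in>I. (sqrt (\<beta> i) * x i) * (\<integral>r. v i r * v j r * u r \<partial>nu) * (sqrt (\<beta> j) * x j)) \<le> ?X" by simp
qed

text \<open>Gershgorin's argument: 2 |w_i w_j| \<le> w_i^2 + w_j^2 distributes every off-diagonal
  entry over two diagonal ones.\<close>

lemma diag_dominant_psd:
  fixes B :: "nat \<Rightarrow> nat \<Rightarrow> real"
  assumes sym: "\<And>i j. B i j = B j i" and dom: "\<And>i. i < N \<Longrightarrow> (\<Sum>j\<in>{..<N} - {i}. \<bar>B i j\<bar>) \<le> B i i"
  shows "0 \<le> (\<Sum>i<N. \<Sum>j<N. w i * B i j * w j)"
proof -
  have ge: "- (\<bar>B i j\<bar> * ((w i)\<^sup>2 + (w j)\<^sup>2) / 2) \<le> w i * B i j * w j" for i j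
  proof -
    have "\<bar>w i * w j\<bar> \<le> ((w i)\<^sup>2 + (w j)\<^sup>2) / 2"
      using sum_squares_ge_zero[of "w i + w j" 0] sum_squares_ge_zero[of "w i - w j" 0] by (simp add: abs_le_iff power2_eq_square algebra_simps)
    then have "\<bar>B i j\<bar> * \<bar>w i * w j\<bar> \<le> \<bar>B i j\<bar> * (((w i)\<^sup>2 + (w j)\<^sup>2) / 2)" by (intro mult_left_mono) auto
    then have "\<bar>w i * B i j * w j\<bar> \<le> \<bar>B i j\<bar> * ((w i)\<^sup>2 + (w j)\<^sup>2) / 2" by (simp add: abs_mult mult_ac)
    then show ?thesis by linarith
  qed
  define a where "a i = (\<Sum>j\<in>{..<N} - {i}. \<bar>B i j\<bar>)" for i
  have s: "(\<Sum>i<N. \<Sum>j\<in>{..<N} - {i}. \<bar>B i j\<bar> * (w j)\<^sup>2) = (\<Sum>i<N. a i * (w i)\<^sup>2)"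
  proof -
    have d: "{..<N} - {i} = {j \<in> {..<N}. i \<noteq> j}" "{..<N} - {i} = {j \<in> {..<N}. j \<noteq> i}" for i by auto
    have "(\<Sum>i<N. \<Sum>j\<in>{..<N} - {i}. \<bar>B i j\<bar> * (w j)\<^sup>2) = (\<Sum>j<N. \<Sum>i\<in>{..<N} - {j}. \<bar>B i j\<bar> * (w j)\<^sup>2)"
      unfolding d(1) by (subst sum.swap_restrict) (auto intro!: sum.cong simp: d(1))
    also have "\<dots> = (\<Sum>i<N. a i * (w i)\<^sup>2)" unfolding a_def sum_distrib_right using sym by (intro sum.cong refl) simp
    finally show ?thesis .
  qed
  have "(\<Sum>i<N. \<Sum>j<N. w i * B i j * w j) = (\<Sum>i<N. w i * B i i * w i + (\<Sum>j\<in>{..<N} - {i}. w i * B i j * w j))"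
    by (intro sum.cong refl) (simp add: sum.remove)
  also have "\<dots> \<ge> (\<Sum>i<N. a i * (w i)\<^sup>2 + (\<Sum>j\<in>{..<N} - {i}. - (\<bar>B i j\<bar> * ((w i)\<^sup>2 + (w j)\<^sup>2) / 2)))"
  proof (intro sum_mono add_mono ge)
    fix i assume "i \<in> {..<N}"
    then have "a i * (w i)\<^sup>2 \<le> B i i * (w i)\<^sup>2" unfolding a_def by (intro mult_right_mono dom) auto
    then show "a i * (w i)\<^sup>2 \<le> w i * B i i * w i" by (simp add: power2_eq_square mult_ac)
  qed
  also have "(\<Sum>i<N. a i * (w i)\<^sup>2 + (\<Sum>j\<in>{..<N} - {i}. - (\<bar>B i j\<bar> * ((w i)\<^sup>2 + (w j)\<^sup>2) / 2)))
    = (\<Sum>i<N. a i * (w i)\<^sup>2) - (\<Sum>i<N. a i * (w i)\<^sup>2) / 2 - (\<Sum>i<N. \<Sum>j\<in>{..<N} - {i}. \<bar>B i j\<bar> * (w j)\<^sup>2) / 2"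
    unfolding a_def sum.distrib sum_negf distrib_left add_divide_distrib sum_divide_distrib sum_distrib_right by simp
  also have "\<dots> = 0" unfolding s by simp
  finally show ?thesis .
qed

lemma cfact_eq: "cfact n = fact n"
  by (induction n) simp_all

lemma trace_sum_eq: "trace_sum p q l gs = (\<Sum>j<length gs. trace_val p q (l + j) (gs ! j))"
  by (induction p q l gs rule: trace_sum.induct) (simp_all add: sum.lessThan_Suc_shift del: sum.lessThan_Suc)

lemma TT_entry:
  assumes "n + k \<le> 11" "n \<le> 10" shows "entry_ok k n n (TT ! k ! n)"
proof -
  \<comment> \<open>Row 0 has 11 entries instead of 12, because n is at most 10 in every
    sector.\<close>
  have "\<forall>k<12. length (TT ! k) = (if k = 0 then 11 else 12 - k)"
    by (simp add: TT_def eval_nat_numeral less_Suc_eq all_conj_distrib)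
  then have "n < length (TT ! k)" using assms by (auto split: if_splits)
  moreover have "length TT = 12" by (simp add: TT_def)
  ultimately show ?thesis using diag_rows_ok_nth[OF diag_rows_ok, of k n] assms by simp
qed

lemma trace_entry_ge:
  assumes "n + k \<le> 11" "n \<le> 10" "0 < g"
  shows "2 ^ 34 / real_of_int g * (fact n / fact (n + k) * low_J k n n) \<le> real_of_int (trace_entry k n g) / 2 ^ 44"
proof -
  define v where "v = TT ! k ! n"
  have "\<bar>2 ^ 44 * low_J k n n - real_of_int v\<bar> \<le> 1"
    by (rule low_J(2)[OF assms(1) assms(1)]) (use assms TT_entry[OF assms(1,2)] in \<open>auto simp: v_def\<close>)
  then have J: "low_J k n n \<le> (real_of_int v + 1) / 2 ^ 44" by (simp add: abs_le_iff)
  have g: "0 < real_of_int g" using assms(3) by simp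
  have "2 ^ 34 / real_of_int g * (fact n / fact (n + k) * low_J k n n) = 2 ^ 34 / real_of_int g * (fact n / fact (n + k)) * low_J k n n" by simp
  also have "\<dots> \<le> 2 ^ 34 / real_of_int g * (fact n / fact (n + k)) * ((real_of_int v + 1) / 2 ^ 44)"
    using g by (intro mult_left_mono J) auto
  also have "\<dots> = real_of_int ((v + 1) * fact n * 2 ^ 34) / real_of_int (fact (n + k) * g) / 2 ^ 44" by (simp add: mult_ac)
  also have "\<dots> \<le> real_of_int (trace_entry k n g) / 2 ^ 44"
    unfolding trace_entry_def cfact_eq v_def[symmetric]
    using div_bounds(1)[of "(v + 1) * fact n * 2 ^ 34" "fact (n + k) * g"] by (intro divide_right_mono) simp_all
  finally show ?thesis .
qed

lemma sum_1_10: "(\<Sum>l\<in>{1..10}. f l) = (\<Sum>n<10. f (Suc n))" for f :: "nat \<Rightarrow> real"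
  using sum.atLeast1_atMost_eq[of f 10] by simp

lemma trace_rows_ok_sound:
  assumes "trace_rows_ok n" "p < n" "q < 11" shows "p = 2 \<and> q = 1 \<or> trace_sum p q 1 GL \<le> 2 ^ 44"
proof -
  have "trace_row_ok p m \<Longrightarrow> q < m \<Longrightarrow> p = 2 \<and> q = 1 \<or> trace_sum p q 1 GL \<le> 2 ^ 44" for m
    by (induction p m rule: trace_row_ok.induct) (auto simp: less_Suc_eq)
  moreover have "trace_row_ok p 11" using assms(1,2) by (induction n rule: trace_rows_ok.induct) (auto simp: less_Suc_eq)
  ultimately show ?thesis using assms(3) by blast
qed

lemma low_trace:
  assumes ne: "idx {1..10} p q \<noteq> {}" and pq: "(p, q) \<noteq> (2, 1)"
  shows "(\<Sum>l\<in>idx {1..10} p q. low_beta l * (\<integral>r. e_fun (l + 1 - p) (l - q) r * e_fun (l + 1 - p) (l - q) r * low_U (r\<^sup>2) \<partial>nu)) \<le> 1"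
proof -
  define k where "k = sector_k p q"
  define d where "d = sector_d p q"
  note e = e_fun_sector(1)[of p _ q, folded k_def d_def] and k = e_fun_sector(2)[of p _ q, folded k_def d_def]
    and n = e_fun_sector(3)[of p _ q, folded k_def d_def] and tr = e_fun_sector(4)[of p _ q, folded k_def d_def]
  have "p < 12" "q < 11" using ne by (auto simp: idx_def)
  then have ts: "trace_sum p q 1 GL \<le> 2 ^ 44"
    using trace_rows_ok_sound[OF trace_ok, of p q] pq by auto
  let ?t = "\<lambda>l. if p \<le> l + 1 \<and> q \<le> l then trace_entry k (l + 1 - d) (GL ! (l - 1)) else 0"
  have "(\<Sum>l\<in>idx {1..10} p q. low_beta l * (\<integral>r. e_fun (l + 1 - p) (l - q) r * e_fun (l + 1 - p) (l - q) r * low_U (r\<^sup>2) \<partial>nu))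
    \<le> (\<Sum>l\<in>idx {1..10} p q. real_of_int (?t l) / 2 ^ 44)"
  proof (rule sum_mono)
    fix l assume "l \<in> idx {1..10} p q"
    then have l: "l \<in> {1..10}" "p \<le> l + 1" "q \<le> l" by (auto simp: idx_def)
    have nk: "l + 1 - d + k \<le> 11" "l + 1 - d \<le> 10" using k[OF l(2,3)] n[OF l(2,3)] l(1) by auto
    have "(\<integral>r. e_fun (l + 1 - p) (l - q) r * e_fun (l + 1 - p) (l - q) r * low_U (r\<^sup>2) \<partial>nu)
      = fact (l + 1 - d) / fact (l + 1 - d + k) * low_J k (l + 1 - d) (l + 1 - d)"
      unfolding e[OF l(2,3)] has_bochner_integral_integral_eq[OF e_fun_gram[OF nk(1) nk(1)]] by simp
    then show "low_beta l * (\<integral>r. e_fun (l + 1 - p) (l - q) r * e_fun (l + 1 - p) (l - q) r * low_U (r\<^sup>2) \<partial>nu) \<le> real_of_int (?t l) / 2 ^ 44"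
      using trace_entry_ge[OF nk GL_pos[OF l(1)]] l by (simp add: low_beta_def)
  qed
  \<comment> \<open>Indices outside \<open>idx\<close> contribute 0, as they do in
    \<open>trace_val\<close>.\<close>
  also have "\<dots> \<le> (\<Sum>l\<in>{1..10}. real_of_int (?t l) / 2 ^ 44)"
  proof (rule order.eq_iff[THEN iffD1, THEN conjunct1], rule sum.mono_neutral_left)
    show "\<forall>l\<in>{1..10} - idx {1..10} p q. real_of_int (?t l) / 2 ^ 44 = 0" by (auto simp: idx_def)
  qed (auto simp: idx_def)
  also have "\<dots> = real_of_int (trace_sum p q 1 GL) / 2 ^ 44"
  proof -
    have "length GL = 10" by (simp add: GL_def)
    moreover have "trace_val p q (1 + j) g = (if p \<le> 1 + j + 1 \<and> q \<le> 1 + j then trace_entry k (1 + j + 1 - d) g else 0)" for j g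
      using tr[of "1 + j" g] by (auto simp: trace_val_def)
    ultimately have "trace_sum p q 1 GL = (\<Sum>j<10. ?t (Suc j))"
      unfolding trace_sum_eq by (intro sum.cong) simp_all
    then show ?thesis unfolding sum_1_10 sum_divide_distrib[symmetric] by (simp only: of_int_sum)
  qed
  also have "\<dots> \<le> 1" using ts by simp
  finally show ?thesis .
qed

lemma QT_entry:
  assumes "n < 10" "m < 10" shows "\<bar>2 ^ 44 * low_J 0 n m - real_of_int (QT ! n ! m)\<bar> \<le> 1"
proof -
  have len: "\<forall>n<10. length (QT ! n) = 10" "length QT = 10" unfolding all_less_numeral by (simp_all add: QT_def)
  have *: "\<bar>2 ^ 44 * low_J 0 n m - real_of_int (QT ! n ! m)\<bar> \<le> 1" if "n \<le> m" "m < 10" for n m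
    by (rule low_J(2)) (use gram_rows_ok_nth[OF gram_rows_ok, of n m] len that in auto)
  \<comment> \<open>Only the entries on or above the diagonal were tested; symmetry of the table
    gives the others.\<close>
  have "\<forall>n<10. \<forall>m<10. QT ! n ! m = QT ! m ! n" unfolding all_less_numeral by (simp add: QT_def)
  then have "QT ! n ! m = QT ! m ! n" using assms by blast
  moreover have "low_J 0 n m = low_J 0 m n" unfolding low_J_def by (simp add: mult_ac)
  ultimately show ?thesis using *[of n m] *[of m n] assms by (cases "n \<le> m") auto
qed

lemma psd_rows_ok_nth: "psd_rows_ok n rs \<Longrightarrow> i < length rs \<Longrightarrow> offdiag_sum (n + i) 10 \<le> gram_res (n + i) (n + i) - 2 ^ 12"
proof (induction n rs arbitrary: i rule: psd_rows_ok.induct)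
  case (2 n r rs)
  then show ?case by (cases i) auto
qed simp

lemma offdiag_sum_eq: "offdiag_sum n m = (\<Sum>j\<in>{..<m} - {n}. \<bar>gram_res n j\<bar> + 2 ^ 12)"
proof (induction m)
  case (Suc m)
  have "{..<Suc m} - {n} = (if n = m then {..<m} - {n} else insert m ({..<m} - {n}))" by (auto simp: less_Suc_eq)
  then show ?case using Suc by simp
qed simp

text \<open>\<open>RT\<close> is only a rounded Cholesky factor, but what remains after subtracting
  its square is diagonally dominant, with the errors of \<open>QT\<close> included. The difference
  is thus a sum of squares plus a positive semidefinite form.\<close>

lemma low_gram_psd: "(\<Sum>n<10. \<Sum>m<10. w n * low_J 0 n m * w m) \<le> (\<Sum>n<10. real_of_int (GL ! n) / 2 ^ 34 * (w n)\<^sup>2)"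
proof -
  define R where "R n k = real_of_int (RT ! n ! k) / 2 ^ 28" for n k
  define B where "B n m = (if n = m then real_of_int (GL ! n) / 2 ^ 34 else 0) - low_J 0 n m - (\<Sum>k<10. R n k * R m k)" for n m
  have sym: "B n m = B m n" for n m
    unfolding B_def low_J_def by (auto simp: mult_ac)
  have len: "\<forall>n<10. length (RT ! n) = 10" unfolding all_less_numeral by (simp add: RT_def)
  have near: "\<bar>B n m - real_of_int (gram_res n m) / 2 ^ 56\<bar> \<le> 2 ^ 12 / 2 ^ 56" if "n < 10" "m < 10" for n m
  proof -
    have "real_of_int (dot (RT ! n) (RT ! m)) / 2 ^ 56 = (\<Sum>k<10. R n k * R m k)"
      using len that by (simp add: dot_eq_sum R_def sum_divide_distrib)
    then have "B n m - real_of_int (gram_res n m) / 2 ^ 56 = real_of_int (QT ! n ! m) / 2 ^ 44 - low_J 0 n m"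
      unfolding B_def gram_res_def by (simp add: diff_divide_distrib)
    then show ?thesis using QT_entry[OF that] unfolding abs_le_iff by (simp add: field_simps)
  qed
  have "0 \<le> (\<Sum>n<10. \<Sum>m<10. w n * B n m * w m)"
  proof (rule diag_dominant_psd[OF sym])
    fix n :: nat assume n: "n < 10"
    have "(\<Sum>m\<in>{..<10} - {n}. \<bar>B n m\<bar>) \<le> (\<Sum>m\<in>{..<10} - {n}. real_of_int (\<bar>gram_res n m\<bar> + 2 ^ 12) / 2 ^ 56)"
    proof (rule sum_mono)
      fix m assume "m \<in> {..<10} - {n}"
      then show "\<bar>B n m\<bar> \<le> real_of_int (\<bar>gram_res n m\<bar> + 2 ^ 12) / 2 ^ 56"
        using near[OF n, of m] by (simp add: add_divide_distrib abs_if split: if_splits)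
    qed
    also have "\<dots> = real_of_int (offdiag_sum n 10) / 2 ^ 56"
      unfolding offdiag_sum_eq of_int_sum sum_divide_distrib ..
    also have "\<dots> \<le> real_of_int (gram_res n n - 2 ^ 12) / 2 ^ 56"
      using psd_rows_ok_nth[OF gram_psd_ok, of n] n by (intro divide_right_mono) (simp_all only: of_int_le_iff, simp_all add: QT_def)
    also have "\<dots> \<le> B n n" using abs_le_D2[OF near[OF n n]] by (simp add: diff_divide_distrib)
    finally show "(\<Sum>m\<in>{..<10} - {n}. \<bar>B n m\<bar>) \<le> B n n" .
  qed
  moreover have "(\<Sum>n<10. \<Sum>m<10. w n * B n m * w m) = (\<Sum>n<10. real_of_int (GL ! n) / 2 ^ 34 * (w n)\<^sup>2)
    - (\<Sum>n<10. \<Sum>m<10. w n * low_J 0 n m * w m) - (\<Sum>k<10. (\<Sum>n<10. R n k * w n)\<^sup>2)"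
  proof -
    have "(\<Sum>k<10. (\<Sum>n<10. R n k * w n)\<^sup>2) = (\<Sum>k<10. \<Sum>n<10. \<Sum>m<10. R n k * w n * (R m k * w m))"
      unfolding power2_eq_square sum_product ..
    also have "\<dots> = (\<Sum>n<10. \<Sum>k<10. \<Sum>m<10. R n k * w n * (R m k * w m))" by (rule sum.swap)
    also have "\<dots> = (\<Sum>n<10. \<Sum>m<10. \<Sum>k<10. R n k * w n * (R m k * w m))" by (rule sum.cong[OF refl], rule sum.swap)
    also have "\<dots> = (\<Sum>n<10. \<Sum>m<10. w n * (\<Sum>k<10. R n k * R m k) * w m)"
      unfolding sum_distrib_left sum_distrib_right by (intro sum.cong refl) (simp add: mult_ac)
    finally have 1: "(\<Sum>k<10. (\<Sum>n<10. R n k * w n)\<^sup>2) = (\<Sum>n<10. \<Sum>m<10. w n * (\<Sum>k<10. R n k * R m k) * w m)" .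
    have 2: "(\<Sum>n<10. real_of_int (GL ! n) / 2 ^ 34 * (w n)\<^sup>2) = (\<Sum>n<10. \<Sum>m<10. w n * (if n = m then real_of_int (GL ! n) / 2 ^ 34 else 0) * w m)"
      by (intro sum.cong refl) (simp add: if_distrib[of "\<lambda>z. _ * z"] if_distrib[of "\<lambda>z. z * _"] power2_eq_square mult_ac cong: if_cong)
    show ?thesis unfolding 1 2 B_def by (simp only: left_diff_distrib right_diff_distrib sum_subtractf)
  qed
  moreover have "0 \<le> (\<Sum>k<10. (\<Sum>n<10. R n k * w n)\<^sup>2)" by (intro sum_nonneg) simp
  ultimately show ?thesis by linarith
qed

section \<open>The weight 1 / U and its constraints\<close>

lemma low_U_nu [measurable]: "(\<lambda>r. low_U (r\<^sup>2)) \<in> borel_measurable borel"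
  unfolding low_U_def
  by (intro borel_measurable_divide borel_measurable_const measurable_compose[OF _ borel_measurable_continuous_onI[OF continuous_sval]]) measurable

definition low_W :: "real \<Rightarrow> real" where "low_W t = 1 / low_U t"
definition low_rho :: real where "low_rho = 11985839 / 2 ^ 30"

lemma low_W_pos: "0 \<le> t \<Longrightarrow> 0 < low_W t"
  using low_U_pos by (simp add: low_W_def)

lemma low_W_le:
  assumes "0 \<le> t" shows "low_W t \<le> 10 / 7 * exp (t / 8)"
proof -
  have "low_W t \<le> 1 / (7 / 10 * exp (- (t / 8)))"
    unfolding low_W_def by (intro divide_left_mono low_U_ge assms mult_pos_pos low_U_pos) auto
  also have "\<dots> = 10 / 7 * exp (t / 8)" by (simp add: exp_minus field_simps)
  finally show ?thesis .
qed

lemma integrable_low_W: "integrable nu (\<lambda>r. low_W (r\<^sup>2))"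
proof (rule Bochner_Integration.integrable_bound)
  show "integrable nu (\<lambda>r. 10 / 7 * ((r\<^sup>2) ^ 0 * exp (- ((- 1 / 8) * r\<^sup>2))))"
    using nu_moment[of "- 1 / 8" 0] by (intro integrable_mult_right) (simp add: has_bochner_integral_iff)
  show "(\<lambda>r. low_W (r\<^sup>2)) \<in> borel_measurable nu"
    unfolding low_W_def by (rule measurable_nu_borel) measurable
  show "AE r in nu. norm (low_W (r\<^sup>2)) \<le> norm (10 / 7 * ((r\<^sup>2) ^ 0 * exp (- ((- 1 / 8) * r\<^sup>2))))"
    by (rule AE_I2) (use low_W_le low_W_pos[of "_\<^sup>2"] in \<open>simp add: less_imp_le\<close>)
qed

lemma M_integrand_low: "M_integrand low_W p q l m r = e_fun (l + 1 - p) (l - q) r * e_fun (m + 1 - p) (m - q) r * low_U (r\<^sup>2)"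
  by (simp add: M_integrand_def low_W_def)

lemma integrable_low_M:
  assumes "l \<in> idx {1..10} p q" "m \<in> idx {1..10} p q"
  shows "integrable nu (\<lambda>r. e_fun (l + 1 - p) (l - q) r * e_fun (m + 1 - p) (m - q) r * low_U (r\<^sup>2))"
proof -
  have l: "l \<le> 10" "p \<le> l + 1" "q \<le> l" and m: "m \<le> 10" "p \<le> m + 1" "q \<le> m" using assms by (auto simp: idx_def)
  have "l + 1 - sector_d p q + sector_k p q \<le> 11" "m + 1 - sector_d p q + sector_k p q \<le> 11"
    using e_fun_sector(2)[OF l(2,3)] e_fun_sector(2)[OF m(2,3)] l m by simp_all
  from e_fun_gram[OF this] show ?thesis
    unfolding e_fun_sector(1)[OF l(2,3)] e_fun_sector(1)[OF m(2,3)] by (simp add: has_bochner_integral_iff)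
qed

lemma low_loewner:
  assumes ne: "idx {1..10} p q \<noteq> {}"
  shows "loewner_le_on (idx {1..10} p q) (M_mat low_beta low_W p q) id_mat"
proof (cases "(p, q) = (2, 1)")
  case False
  show ?thesis
    unfolding M_mat_def M_integrand_low
    by (rule loewner_le_trace[where v = "\<lambda>l. e_fun (l + 1 - p) (l - q)" and u = "\<lambda>r. low_U (r\<^sup>2)"])
      (use low_trace[OF ne False] integrable_low_M low_U_pos low_beta_pos in \<open>auto simp: idx_def less_imp_le\<close>)
next
  case True
  have idx: "idx {1..10} 2 1 = {1..10}" by (auto simp: idx_def)
  define Q where "Q l m = (\<integral>r. e_fun (l + 1 - 2) (l - 1) r * e_fun (m + 1 - 2) (m - 1) r * low_U (r\<^sup>2) \<partial>nu)" for l m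
  have Qs: "Q (Suc n) (Suc m) = (-1) ^ n * (-1) ^ m * low_J 0 n m" if "n < 10" "m < 10" for n m
    using has_bochner_integral_integral_eq[OF e_fun_gram[of n 0 m]] that by (simp add: Q_def power_add)
  have "loewner_le_on {1..10} (\<lambda>l m. sqrt (low_beta l * low_beta m) * Q l m) id_mat"
  proof (rule id_minus_gram)
    show "Q i j = Q j i" for i j by (simp add: Q_def mult_ac)
    fix x :: "nat \<Rightarrow> real"
    \<comment> \<open>The alternating signs of the functions \<open>e_fun n n\<close> are absorbed
      into the vector.\<close>
    define w where "w n = (-1) ^ n * (sqrt (low_beta (Suc n)) * x (Suc n))" for n
    have "(\<Sum>l\<in>{1..10}. \<Sum>m\<in>{1..10}. sqrt (low_beta l) * x l * Q l m * (sqrt (low_beta m) * x m))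
      = (\<Sum>n<10. \<Sum>m<10. w n * low_J 0 n m * w m)"
      unfolding sum_1_10 by (intro sum.cong refl) (simp add: Qs w_def mult_ac)
    also have "\<dots> \<le> (\<Sum>n<10. real_of_int (GL ! n) / 2 ^ 34 * (w n)\<^sup>2)" by (rule low_gram_psd)
    also have "\<dots> = (\<Sum>n<10. (x (Suc n))\<^sup>2)"
    proof (intro sum.cong refl)
      fix n :: nat assume "n \<in> {..<10}"
      then have "0 < low_beta (Suc n)" by (intro low_beta_pos) auto
      moreover have "(w n)\<^sup>2 = low_beta (Suc n) * (x (Suc n))\<^sup>2"
        using \<open>0 < low_beta (Suc n)\<close> by (simp add: w_def power_mult_distrib flip: power_mult)
      moreover have "real_of_int (GL ! n) / 2 ^ 34 = 1 / low_beta (Suc n)" by (simp add: low_beta_def)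
      ultimately show "real_of_int (GL ! n) / 2 ^ 34 * (w n)\<^sup>2 = (x (Suc n))\<^sup>2" by simp
    qed
    finally show "(\<Sum>l\<in>{1..10}. \<Sum>m\<in>{1..10}. sqrt (low_beta l) * x l * Q l m * (sqrt (low_beta m) * x m)) \<le> (\<Sum>l\<in>{1..10}. (x l)\<^sup>2)"
      unfolding sum_1_10 .
  qed (use low_beta_pos in \<open>auto simp: less_imp_le\<close>)
  note L = this
  have pq: "p = 2" "q = 1" using True by simp_all
  show ?thesis using L unfolding pq idx M_mat_def M_integrand_low Q_def .
qed

lemma exps_sadd: "\<forall>(i, c)\<in>set p. b \<le> i \<Longrightarrow> \<forall>(i, c)\<in>set q. b \<le> i \<Longrightarrow> \<forall>(i, c)\<in>set (sadd p q). b \<le> i"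
  by (induction p q rule: sadd.induct) auto

lemma exps_smono: "\<forall>(j, d)\<in>set q. b \<le> j \<Longrightarrow> \<forall>(j, d)\<in>set (smono i c q). i + b \<le> j"
  by (induction i c q rule: smono.induct) auto

lemma exps_smul:
  "\<forall>(i, c)\<in>set p. a \<le> i \<Longrightarrow> \<forall>(j, d)\<in>set q. b \<le> j \<Longrightarrow> \<forall>(j, d)\<in>set (smul p q). a + b \<le> j"
proof (induction p q rule: smul.induct)
  case (2 i c p q)
  have "\<forall>(j, d)\<in>set (smono i c q). a + b \<le> j" using exps_smono[OF 2(3), of i c] 2(2) by force
  moreover have "\<forall>(j, d)\<in>set (smul p q). a + b \<le> j" using 2 by simp
  ultimately show ?case using exps_sadd[of "smono i c q" "a + b" "smul p q"] by simp
qed simp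

definition low_z :: "(int \<times> int) list" where "low_z = sadd (smul UL YL) [(0, - (2 ^ 52))]"

text \<open>\<open>y\<close> approximates 1 / U with relative error \<open>z\<close>. The term z^2 /
  U is of second order, so the crude exponential bound on 1 / U is good enough there.\<close>

lemma mu_low: "mu_val low_W \<le> (35907550821 / 50000000000)"
proof -
  have yl: "\<forall>(i, c)\<in>set YL. -1 \<le> i" "\<forall>(i, c)\<in>set UL. 1 \<le> i" by (simp_all add: YL_def UL_def)
  \<comment> \<open>The growing term of exponent -1 in \<open>YL\<close> is compensated by the
    factor U, whose exponents start at 1.\<close>
  have zl: "\<forall>(i, c)\<in>set low_z. 0 \<le> i" unfolding low_z_def using exps_smul[OF yl(2,1)] by (intro exps_sadd) auto
  define w where "w = sadd [(0, 2 ^ 52)] (smono 0 (-1) low_z)"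
  have wl: "\<forall>(i, c)\<in>set w. 0 \<le> i" unfolding w_def using exps_smono[OF zl, of 0 "-1"] by (intro exps_sadd) auto
  define y where "y t = sval YL t / 2 ^ 20" for t
  define z where "z t = low_U t * y t - 1" for t
  have zs: "sval low_z t = 2 ^ 52 * z t" and ws: "sval w t = 2 ^ 52 * (1 - z t)" for t
    unfolding w_def by (simp_all add: low_z_def z_def y_def low_U_def)
  have bw: "\<forall>(i, c)\<in>set YL. \<forall>(j, d)\<in>set w. -8 < i + j + 0" using yl(1) by (auto dest!: bspec[OF wl])
  have bz: "\<forall>(i, c)\<in>set low_z. \<forall>(j, d)\<in>set low_z. -8 < i + j + (-1)" by (auto dest!: bspec[OF zl])
  note b1 = bmean_sound[OF bw] and b2 = bmean_sound[OF bz]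
  let ?f = "\<lambda>r. sval YL (r\<^sup>2) * sval w (r\<^sup>2) * exp (- (real_of_int 0 / 8 * r\<^sup>2))"
  let ?g = "\<lambda>r. sval low_z (r\<^sup>2) * sval low_z (r\<^sup>2) * exp (- (real_of_int (-1) / 8 * r\<^sup>2))"
  have le: "low_W t \<le> 1 / 2 ^ 72 * (sval YL t * sval w t * exp (- (real_of_int 0 / 8 * t))) + 10 / 7 / 2 ^ 104 * (sval low_z t * sval low_z t * exp (- (real_of_int (-1) / 8 * t)))"
    if t: "0 \<le> t" for t
  proof -
    have "low_W t = y t * (1 - z t) + (z t)\<^sup>2 * low_W t"
      using low_U_pos[OF t] by (simp add: low_W_def z_def field_simps power2_eq_square)
    also have "\<dots> \<le> y t * (1 - z t) + (z t)\<^sup>2 * (10 / 7 * exp (t / 8))"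
      using low_W_le[OF t] by (intro add_left_mono mult_left_mono) auto
    also have "\<dots> = 1 / 2 ^ 72 * (sval YL t * sval w t * exp (- (real_of_int 0 / 8 * t))) + 10 / 7 / 2 ^ 104 * (sval low_z t * sval low_z t * exp (- (real_of_int (-1) / 8 * t)))"
      unfolding zs ws y_def by (simp add: power2_eq_square field_simps)
    finally show ?thesis .
  qed
  have "mu_val low_W \<le> (\<integral>r. 1 / 2 ^ 72 * ?f r + 10 / 7 / 2 ^ 104 * ?g r \<partial>nu)"
    unfolding mu_val_def
    by (rule integral_mono[OF integrable_low_W]) (use le b1(1) b2(1) in \<open>auto intro!: Bochner_Integration.integrable_add integrable_mult_right simp del: of_int_0 of_int_minus of_int_1\<close>)
  also have "\<dots> = 1 / 2 ^ 72 * integral\<^sup>L nu ?f + 10 / 7 / 2 ^ 104 * integral\<^sup>L nu ?g"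
    by (subst Bochner_Integration.integral_add) (use b1(1) b2(1) in \<open>auto intro!: integrable_mult_right simp del: of_int_0 of_int_minus of_int_1\<close>)
  also have "\<dots> \<le> 1 / 2 ^ 72 * real_of_int (bmean 0 YL w) + 10 / 7 / 2 ^ 104 * real_of_int (bmean (-1) low_z low_z)"
    by (intro add_mono mult_left_mono b1(2) b2(2)) auto
  also have "\<dots> = real_of_int (mean_bound low_z) / (7 * 2 ^ 104)" by (simp add: w_def)
  also have "\<dots> \<le> real_of_int 101960831506164515210119995736622 / (7 * 2 ^ 104)"
    using mean_bound_ok unfolding low_z_def by (intro divide_right_mono) (simp_all only: of_int_le_iff, simp)
  also have "\<dots> \<le> (35907550821 / 50000000000)" by simp
  finally show ?thesis .
qed

text \<open>Any trial vector in the variational form bounds S from above. The one chosen leaves the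
  residual r H(r^2), with H the Laguerre sum of coefficients \<open>EL\<close>.\<close>

lemma S_low: "S_val {1..10} low_rho low_beta low_W \<le> 1"
proof -
  interpret weight low_rho low_W
    by unfold_locales (use integrable_low_W low_W_pos in \<open>auto simp: low_rho_def\<close>)
  define eta where "eta l = real_of_int (EL ! l) / 2 ^ 34" for l
  \<comment> \<open>Sign and square root cancel the normalisation of \<open>phi l\<close>, so that
    \<open>eta\<close> becomes the plain coefficient of \<open>lag 1 l\<close>.\<close>
  define c where "c l = - ((-1) ^ l * sqrt (real (l + 1)) * eta l)" for l
  define H where "H t = pval (lag_sum 0 EL) t / (39916800 * 2 ^ 34)" for t
  define P where "P = sq0 (lag_sum 0 EL)"
  have lenE: "length EL = 11" and e0: "eta 0 = 1" by (simp_all add: EL_def eta_def)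
  have H: "H t = (\<Sum>l<11. eta l * lag 1 l t)" for t
    unfolding H_def by (simp add: pval_lag_sum lenE eta_def sum_distrib_left sum_divide_distrib)
  have r: "r - (\<Sum>l\<in>{1..10}. c l * phi l r) = r * H (r\<^sup>2)" for r
  proof -
    have t: "c l * phi l r = - (r * (eta l * lag 1 l (r\<^sup>2)))" for l
    proof -
      have "((-1) ^ l * (-1) ^ l :: real) = 1" by (simp flip: power_mult_distrib)
      moreover have "c l * phi l r = - (((-1) ^ l * (-1) ^ l) * (sqrt (real (l + 1)) / sqrt (real (l + 1))) * (r * (eta l * lag 1 l (r\<^sup>2))))"
        unfolding c_def phi_lag by (simp add: mult_ac)
      ultimately show ?thesis by simp
    qed
    have "H (r\<^sup>2) = eta 0 * lag 1 0 (r\<^sup>2) + (\<Sum>l<10. eta (Suc l) * lag 1 (Suc l) (r\<^sup>2))"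
      unfolding H using sum.lessThan_Suc_shift[of "\<lambda>l. eta l * lag 1 l (r\<^sup>2)" 10] by simp
    also have "lag 1 0 (r\<^sup>2) = 1" by (simp add: lag_def)
    finally have "r * H (r\<^sup>2) = r + (\<Sum>l<10. r * (eta (Suc l) * lag 1 (Suc l) (r\<^sup>2)))"
      by (simp add: e0 distrib_left sum_distrib_left)
    then show ?thesis unfolding sum_1_10 t by (simp add: sum_negf)
  qed
  define G where "G t = sval sqlow_list t / 2 ^ 114" for t
  have G: "1 / (2 * low_rho + low_W t) \<le> G t" if t: "0 \<le> t" for t
  proof -
    define Z where "Z = sval ZL7 t / 2 ^ 12"
    define U where "U = low_U t"
    have U: "0 < U" using low_U_pos[OF t] by (simp add: U_def)
    have rho: "0 < low_rho" by (simp add: low_rho_def)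
    have G: "G t = (1 - 2 * low_rho * Z)\<^sup>2 * U + 2 * low_rho * Z\<^sup>2"
      unfolding G_def sqlow_list_def Z_def U_def low_U_def low_rho_def by (simp add: power2_eq_square field_simps)
    \<comment> \<open>The majorant exceeds U / (1 + 2 \<rho> U) by a multiple of this square,
      whatever Z is; equality holds at Z = U / (1 + 2 \<rho> U).\<close>
    have "0 \<le> 2 * low_rho * ((1 + 2 * low_rho * U) * Z - U)\<^sup>2" using rho by simp
    also have "\<dots> = (1 + 2 * low_rho * U) * G t - U"
    proof -
      have "2 * a * ((1 + 2 * a * U) * Z - U)\<^sup>2 = (1 + 2 * a * U) * ((1 - 2 * a * Z)\<^sup>2 * U + 2 * a * Z\<^sup>2) - U" for a :: real
        by (simp add: power2_eq_square algebra_simps)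
      then show ?thesis unfolding G .
    qed
    finally have "U / (1 + 2 * low_rho * U) \<le> G t" using U rho by (simp add: pos_divide_le_eq add_pos_pos mult.commute)
    moreover have "1 / (2 * low_rho + low_W t) = U / (1 + 2 * low_rho * U)"
      using U rho by (simp add: low_W_def U_def[symmetric] field_simps)
    ultimately show ?thesis by simp
  qed
  have sl: "\<forall>(i, c)\<in>set sqlow_list. 0 \<le> i"
  proof -
    have u: "\<forall>(i, c)\<in>set UL. (0::int) \<le> i" and z: "\<forall>(i, c)\<in>set ZL7. (0::int) \<le> i" by (simp_all add: UL_def ZL7_def)
    have o: "\<forall>(i, c)\<in>set (sadd [(0, 2 ^ 41)] (smono 0 (- 11985839) ZL7)). (0::int) \<le> i"
      using exps_smono[OF z, of 0] by (intro exps_sadd) auto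
    show ?thesis unfolding sqlow_list_def
      using exps_smul[OF exps_smul[OF o o] u] exps_smono[OF exps_smul[OF z z], of 0] by (intro exps_sadd) simp_all
  qed
  have sl8: "\<forall>(i, c)\<in>set sqlow_list. -8 < i" using sl by fastforce
  define X where "X = (\<Sum>k<length P. real_of_int (P ! k) * (fact k * fmom sqlow_list k))"
  have hX: "has_bochner_integral nu (\<lambda>r. pval P (r\<^sup>2) * sval sqlow_list (r\<^sup>2)) X"
    unfolding X_def by (rule sval_pval_integral[OF sl8])
  have pP: "pval P t = t * (39916800 * 2 ^ 34 * H t)\<^sup>2" for t
    unfolding P_def by (simp add: pval_pmul H_def power2_eq_square)
  have X: "X \<le> 2 ^ 44 * real_of_int 525596597838575882538045186468241616158204272071147520000"
  proof -
    have l11: "length (lag_sum 0 EL) \<le> 11"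
    proof -
      have pl: "length (padd x y) = max (length x) (length y)" for x y by (induction x y rule: padd.induct) auto
      have "length es + l \<le> 11 \<Longrightarrow> length (lag_sum l es) \<le> 11" for l es
        by (induction l es rule: lag_sum.induct) (simp_all add: pl length_lag_list)
      then show ?thesis by (simp add: lenE)
    qed
    have "length P \<le> 22"
      using length_pmul[of "lag_sum 0 EL" "lag_sum 0 EL"] l11 unfolding P_def by (cases "lag_sum 0 EL = []") auto
    moreover have "near_moms (1 / 2 ^ 44) 0 (mstart 1 (2 ^ 44) sqlow_list) sqlow_list"
      using near_moms_start[OF sl, of "2 ^ 44" 1] by simp
    ultimately have "\<bar>1 / 2 ^ 44 * X - real_of_int (dot P (moms 22 1 1 (mstart 1 (2 ^ 44) sqlow_list)))\<bar>
      \<le> real_of_int (dot (map abs P) (errs 22 1 1 (int (length sqlow_list))))"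
      unfolding X_def by (intro integral_near_dot[OF _ _ refl refl])
    then have "1 / 2 ^ 44 * X \<le> real_of_int (s_list_bound sqlow_list)"
      unfolding s_list_bound.simps s_bound.simps P_def[symmetric] of_int_add by linarith
    also have "\<dots> \<le> real_of_int 525596597838575882538045186468241616158204272071147520000" using s_list_bound_ok by (simp only: of_int_le_iff)
    finally show ?thesis by simp
  qed
  have "S_val {1..10} low_rho low_beta low_W \<le> Qf {1..10} low_beta c"
    using S_val_variational[of "{1..10}" low_beta] low_beta_pos by auto
  also have "\<dots> = (\<integral>r. (r * H (r\<^sup>2))\<^sup>2 / D_fun low_rho low_W r \<partial>nu) + (\<Sum>l\<in>{1..10}. (c l)\<^sup>2 / low_beta l)"
    unfolding Qf_def r ..
  finally have S: "S_val {1..10} low_rho low_beta low_W \<le> (\<integral>r. (r * H (r\<^sup>2))\<^sup>2 / D_fun low_rho low_W r \<partial>nu) + (\<Sum>l\<in>{1..10}. (c l)\<^sup>2 / low_beta l)" .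
  have "(\<integral>r. (r * H (r\<^sup>2))\<^sup>2 / D_fun low_rho low_W r \<partial>nu) \<le> (\<integral>r. 1 / ((39916800 * 2 ^ 34)\<^sup>2 * 2 ^ 114) * (pval P (r\<^sup>2) * sval sqlow_list (r\<^sup>2)) \<partial>nu)"
  proof (rule Bochner_Integration.integral_mono')
    show "integrable nu (\<lambda>r. 1 / ((39916800 * 2 ^ 34)\<^sup>2 * 2 ^ 114) * (pval P (r\<^sup>2) * sval sqlow_list (r\<^sup>2)))"
      using hX by (intro integrable_mult_right) (simp add: has_bochner_integral_iff)
    fix r
    have "(r * H (r\<^sup>2))\<^sup>2 / D_fun low_rho low_W r = (r * H (r\<^sup>2))\<^sup>2 * (1 / (2 * low_rho + low_W (r\<^sup>2)))" by (simp add: D_fun_def)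
    also have "\<dots> \<le> (r * H (r\<^sup>2))\<^sup>2 * G (r\<^sup>2)" by (intro mult_left_mono G) auto
    also have "\<dots> = 1 / ((39916800 * 2 ^ 34)\<^sup>2 * 2 ^ 114) * (pval P (r\<^sup>2) * sval sqlow_list (r\<^sup>2))"
      unfolding pP G_def power_mult_distrib by simp
    finally show le: "(r * H (r\<^sup>2))\<^sup>2 / D_fun low_rho low_W r \<le> 1 / ((39916800 * 2 ^ 34)\<^sup>2 * 2 ^ 114) * (pval P (r\<^sup>2) * sval sqlow_list (r\<^sup>2))" .
    have "0 < low_rho" by (simp add: low_rho_def)
    then have "0 \<le> (r * H (r\<^sup>2))\<^sup>2 / D_fun low_rho low_W r"
      using low_W_pos[of "r\<^sup>2"] by (simp add: D_fun_def)
    then show "0 \<le> 1 / ((39916800 * 2 ^ 34)\<^sup>2 * 2 ^ 114) * (pval P (r\<^sup>2) * sval sqlow_list (r\<^sup>2))"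
      using le by (rule order_trans)
  qed
  also have "\<dots> = 1 / ((39916800 * 2 ^ 34)\<^sup>2 * 2 ^ 114) * X"
    using has_bochner_integral_integral_eq[OF hX] by simp
  also have "\<dots> \<le> 1 / ((39916800 * 2 ^ 34)\<^sup>2 * 2 ^ 114) * (2 ^ 44 * real_of_int 525596597838575882538045186468241616158204272071147520000)" by (intro mult_left_mono X) simp
  finally have I: "(\<integral>r. (r * H (r\<^sup>2))\<^sup>2 / D_fun low_rho low_W r \<partial>nu) \<le> 1 / ((39916800 * 2 ^ 34)\<^sup>2 * 2 ^ 114) * (2 ^ 44 * real_of_int 525596597838575882538045186468241616158204272071147520000)" .
  have C: "(\<Sum>l\<in>{1..10}. (c l)\<^sup>2 / low_beta l) = (\<Sum>n<10. real (n + 2) * (eta (Suc n))\<^sup>2 * (real_of_int (GL ! n) / 2 ^ 34))"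
  proof -
    have "(c (Suc n))\<^sup>2 / low_beta (Suc n) = real (n + 2) * (eta (Suc n))\<^sup>2 * (real_of_int (GL ! n) / 2 ^ 34)" for n
    proof -
      have "(c (Suc n))\<^sup>2 = ((-1) ^ Suc n)\<^sup>2 * (sqrt (real (Suc n + 1)))\<^sup>2 * (eta (Suc n))\<^sup>2"
        unfolding c_def by (simp only: power2_minus power_mult_distrib)
      also have "((-1) ^ Suc n :: real)\<^sup>2 = 1" by (simp only: power2_eq_square power_mult_distrib[symmetric]) simp
      finally show ?thesis by (simp add: low_beta_def)
    qed
    then show ?thesis unfolding sum_1_10 by (intro sum.cong refl)
  qed
  \<comment> \<open>The weighted residual and the penalty with 1 / \<beta> = \<open>GL\<close> /
    2^34 must together not exceed 1.\<close>
  have "1 / ((39916800 * 2 ^ 34)\<^sup>2 * 2 ^ 114) * (2 ^ 44 * real_of_int 525596597838575882538045186468241616158204272071147520000) + (\<Sum>l\<in>{1..10}. (c l)\<^sup>2 / low_beta l) \<le> 1"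
    unfolding C sum_lessThan_numeral by (simp add: eta_def EL_def GL_def power2_eq_square)
  then show ?thesis using S I by linarith
qed

section \<open>The two bounds on the supremum\<close>

theorem low_admissible: "admissible {1..10} low_rho low_beta low_W"
  unfolding admissible_def
proof (intro conjI ballI allI impI)
  show "0 < low_rho" "low_rho < 1" by (simp_all add: low_rho_def)
  show "low_W \<in> borel_measurable (restrict_space borel {0..})"
    unfolding low_W_def low_U_def
    by (intro measurable_restrict_space1 borel_measurable_divide borel_measurable_const borel_measurable_continuous_onI continuous_sval)
  show "integrable nu (M_integrand low_W p q l m)" if "l \<in> idx {1..10} p q" "m \<in> idx {1..10} p q" for p q l m
    using integrable_low_M[OF that] by (simp add: M_integrand_low[abs_def])
qed (use low_beta_pos low_W_pos integrable_low_W low_loewner S_low in auto)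

theorem low_value: "1.35584631827168 < (1 - low_rho) / (low_rho + mu_val low_W)"
proof -
  have "0 \<le> mu_val low_W"
    unfolding mu_val_def by (rule Bochner_Integration.integral_nonneg) (simp add: low_W_pos less_imp_le)
  moreover have "0 < low_rho" "low_rho < 1" by (simp_all add: low_rho_def)
  ultimately have "(1 - low_rho) / (low_rho + (35907550821 / 50000000000)) \<le> (1 - low_rho) / (low_rho + mu_val low_W)"
    using mu_low by (intro divide_left_mono add_left_mono mult_pos_pos) auto
  moreover have "1.35584631827168 < (1 - low_rho) / (low_rho + (35907550821 / 50000000000))" by (simp add: low_rho_def)
  ultimately show ?thesis by linarith
qed

theorem theorem5p2:
  "ereal 1.35584631827168 < Kstar \<and> Kstar < ereal 1.35584697425050"
proof
  have "ereal 1.35584631827168 < ereal ((1 - low_rho) / (low_rho + mu_val low_W))" using low_value by simp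
  also have "\<dots> \<le> Kstar" unfolding Kstar_def by (rule Sup_upper) (use low_admissible in blast)
  finally show "ereal 1.35584631827168 < Kstar" .
  \<comment> \<open>The supremum inherits only a weak inequality; strictness comes from the gap
    between this value and the stated one.\<close>
  have "Kstar \<le> ereal 1.35584691"
    unfolding Kstar_def
  proof (rule Sup_least)
    fix x assume "x \<in> {ereal ((1 - \<rho>) / (\<rho> + mu_val W)) | \<Lambda> \<rho> \<beta> W. admissible \<Lambda> \<rho> \<beta> W}"
    then obtain \<Lambda> \<rho> \<beta> W where x: "x = ereal ((1 - \<rho>) / (\<rho> + mu_val W))" and adm: "admissible \<Lambda> \<rho> \<beta> W" by blast
    show "x \<le> ereal 1.35584691" unfolding x using admissible_upper[OF adm] by simp
  qed
  also have "ereal 1.35584691 < ereal 1.35584697425050" by simp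
  finally show "Kstar < ereal 1.35584697425050" .
qed

end
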